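(* Let $(S,\mathcal A,\mu)$ be a complete measure space, $f:\mathbb R^p\times S\to\mathbb R$ a function and $D:\mathbb R^p\times S\rightrightarrows\mathbb R^p$ a set-valued map with nonempty compact values such that: 1. for all $x\in\mathbb R^p$, $f(x,\cdot)$ is $\mu$-integrable; 2. for $\mu$-almost all $s\in S$, $f(\cdot,s)$ is locally Lipschitz continuous and $D(\cdot,s)$ is a conservative gradient for $f(\cdot,s)$; 3. $D$ is jointly measurable with respect to $\mathcal B(\mathbb R^p)\otimes\mathcal A$; 4. for every compact $C\subset\mathbb R^p$ there exists a $\mu$-integrable function $\kappa:S\to\mathbb R_+$ such that for all $(x,s)\in C\times S$, $\|D(x,s)\|:=\sup_{y\in D(x,s)}\|y\|\le\kappa(s)$. Then the function $x\mapsto\int_Sf(x,s)\,d\mu(s)$ is path-differentiable, and the set-valued map $x\mapsto\int_SD(x,s)\,d\mu(s)$ (Aumann integral) is a conservative gradient for it.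
   Context: Conservative gradient. For $g:\mathbb R^p\to\mathbb R$ locally Lipschitz, a set-valued map $E:\mathbb R^p\rightrightarrows\mathbb R^p$ that is nonempty valued, locally bounded (each point has a neighborhood on which all elements of the values are bounded by a common constant) and graph closed (its graph $\{(x,y):y\in E(x)\}$ is closed) is a conservative gradient for $g$ if for every absolutely continuous curve $\gamma:[0,1]\to\mathbb R^p$, for almost all $t\in[0,1]$, $\frac{d}{dt}(g\circ\gamma)(t)=\langle v,\dot\gamma(t)\rangle$ for all $v\in E(\gamma(t))$. A locally Lipschitz function admitting a conservative gradient is called path-differentiable. Measurability. A nonempty compact valued map is measurable if it is measurable as a map into the space of nonempty compact subsets of $\mathbb R^p$ with the Borel $\sigma$-algebra of the Hausdorff distance. Aumann integral. $\int_SF\,d\mu:=\{\int_Sv\,d\mu: v\text{ integrable},\ v(s)\in F(s)\text{ for all }s\in S\}$. *)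

theory Defs
  imports "HOL-Analysis.Analysis"
begin

definition locally_lipschitz :: "('a::metric_space \<Rightarrow> 'b::metric_space) \<Rightarrow> bool" where
  "locally_lipschitz g \<longleftrightarrow> (\<forall>x. \<exists>u>0. \<exists>L. L-lipschitz_on (cball x u) g)"

text \<open>The library predicate \<^const>\<open>local_lipschitz\<close> concerns families indexed by a time parameter;
  the notion above is its instance for a constant family.\<close>

lemma locally_lipschitz_iff_local_lipschitz:
  "locally_lipschitz g \<longleftrightarrow> local_lipschitz (UNIV :: real set) UNIV (\<lambda>_. g)"
proof -
  have "(\<exists>L. \<forall>t\<in>cball t u. L-lipschitz_on (cball x u) g) \<longleftrightarrow> (\<exists>L. L-lipschitz_on (cball x u) g)"
    if "u > 0" for x and t u :: real
    using that by (metis centre_in_cball less_imp_le)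
  then show ?thesis
    unfolding locally_lipschitz_def local_lipschitz_def by (simp cong: conj_cong)
qed

text \<open>Only the values of \<open>\<gamma>\<close> on \<open>[0,1]\<close> matter, here and in the derivatives below.\<close>

definition absolutely_continuous_curve :: "(real \<Rightarrow> 'a::real_normed_vector) \<Rightarrow> bool" where
  "absolutely_continuous_curve \<gamma> \<longleftrightarrow>
     (\<forall>\<epsilon>>0. \<exists>\<delta>>0. \<forall>(n::nat) a b.
        (\<forall>i<n. 0 \<le> a i \<and> a i \<le> b i \<and> b i \<le> 1) \<and>
        disjoint_family_on (\<lambda>i. {a i<..<b i}) {..<n} \<and>
        (\<Sum>i<n. b i - a i) < \<delta>
        \<longrightarrow> (\<Sum>i<n. norm (\<gamma> (b i) - \<gamma> (a i))) < \<epsilon>)"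

definition locally_bounded_map :: "('a::topological_space \<Rightarrow> 'b::real_normed_vector set) \<Rightarrow> bool" where
  "locally_bounded_map E \<longleftrightarrow>
     (\<forall>x. \<exists>U. open U \<and> x \<in> U \<and> (\<exists>B. \<forall>x'\<in>U. \<forall>y\<in>E x'. norm y \<le> B))"

text \<open>For almost every \<open>t\<close>, both \<open>\<gamma>\<close> and \<open>g \<circ> \<gamma>\<close> are required to be differentiable at \<open>t\<close>; for an
  absolutely continuous \<open>\<gamma>\<close> and a locally Lipschitz \<open>g\<close> this differentiability is automatic.\<close>

definition conservative_gradient ::
    "('a::euclidean_space \<Rightarrow> real) \<Rightarrow> ('a \<Rightarrow> 'a set) \<Rightarrow> bool" where
  "conservative_gradient g E \<longleftrightarrow>
     (\<forall>x. E x \<noteq> {}) \<and>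
     locally_bounded_map E \<and>
     closed {(x, y). y \<in> E x} \<and>
     (\<forall>\<gamma>. absolutely_continuous_curve \<gamma> \<longrightarrow>
        (AE t in lebesgue_on {0..1}.
           \<exists>\<gamma>'. (\<gamma> has_vector_derivative \<gamma>') (at t within {0..1}) \<and>
                (\<forall>v\<in>E (\<gamma> t). ((g \<circ> \<gamma>) has_real_derivative v \<bullet> \<gamma>') (at t within {0..1}))))"

definition path_differentiable :: "('a::euclidean_space \<Rightarrow> real) \<Rightarrow> bool" where
  "path_differentiable g \<longleftrightarrow> locally_lipschitz g \<and> (\<exists>E. conservative_gradient g E)"

text \<open>The value \<open>0\<close> outside the nonempty bounded sets is a dummy: \<^locale>\<open>Metric_space\<close> demands
  nonnegativity and symmetry for all arguments, not only on the carrier.\<close>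

definition hausdorff_distance :: "'a::metric_space set \<Rightarrow> 'a set \<Rightarrow> real" where
  "hausdorff_distance A B =
     (if A \<noteq> {} \<and> bounded A \<and> B \<noteq> {} \<and> bounded B
      then max (SUP x\<in>A. infdist x B) (SUP y\<in>B. infdist y A) else 0)"

lemma bdd_above_infdist:
  assumes "bounded A" "B \<noteq> {}"
  shows "bdd_above ((\<lambda>x. infdist x B) ` A)"
proof -
  obtain b where b: "b \<in> B" using assms(2) by blast
  obtain e where e: "\<forall>x\<in>A. dist b x \<le> e" using assms(1) bounded_any_center by blast
  show ?thesis
    using e by (intro bdd_aboveI[where M = e]) (auto intro!: infdist_le2[OF b] simp: dist_commute)
qed

lemma hausdorff_distance_le_iff:
  assumes "A \<noteq> {}" "bounded A" "B \<noteq> {}" "bounded B"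
  shows "hausdorff_distance A B \<le> r \<longleftrightarrow> (\<forall>x\<in>A. infdist x B \<le> r) \<and> (\<forall>y\<in>B. infdist y A \<le> r)"
  using assms by (simp add: hausdorff_distance_def cSUP_le_iff bdd_above_infdist)

lemma infdist_le_add:
  assumes "B \<noteq> {}" and "\<And>b. b \<in> B \<Longrightarrow> infdist b C \<le> s"
  shows "infdist a C \<le> infdist a B + s"
proof -
  have "infdist a C - s \<le> infdist a B"
    unfolding infdist_notempty[OF assms(1)]
  proof (rule cINF_greatest[OF assms(1)])
    fix b assume "b \<in> B"
    then show "infdist a C - s \<le> dist a b"
      using infdist_triangle[of a C b] assms(2)[of b] by linarith
  qed
  then show ?thesis by linarith
qed

interpretation Hausdorff: Metric_space "{K. compact K \<and> K \<noteq> {}}" hausdorff_distance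
proof
  fix A B C :: "'a set"
  show "0 \<le> hausdorff_distance A B"
  proof (cases "A \<noteq> {} \<and> bounded A \<and> B \<noteq> {} \<and> bounded B")
    case True
    then obtain x where "x \<in> A" by blast
    with True show ?thesis
      using hausdorff_distance_le_iff[of A B "hausdorff_distance A B"] infdist_nonneg[of x B]
      by force
  qed (auto simp: hausdorff_distance_def)
  show "hausdorff_distance A B = hausdorff_distance B A"
    by (auto simp: hausdorff_distance_def max.commute)
  assume A: "A \<in> {K. compact K \<and> K \<noteq> {}}" and B: "B \<in> {K. compact K \<and> K \<noteq> {}}"
  have le: "hausdorff_distance K L \<le> r \<longleftrightarrow>
      (\<forall>x\<in>K. infdist x L \<le> r) \<and> (\<forall>y\<in>L. infdist y K \<le> r)"
    if "K \<in> {K. compact K \<and> K \<noteq> {}}" "L \<in> {K. compact K \<and> K \<noteq> {}}" for K L :: "'a set" and r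
    using that by (intro hausdorff_distance_le_iff) (auto intro: compact_imp_bounded)
  show "hausdorff_distance A B = 0 \<longleftrightarrow> A = B"
  proof
    assume "hausdorff_distance A B = 0"
    then have "(\<forall>x\<in>A. infdist x B = 0) \<and> (\<forall>y\<in>B. infdist y A = 0)"
      using le[OF A B, of 0] by (simp add: order.antisym[OF _ infdist_nonneg])
    then show "A = B"
      using A B in_closed_iff_infdist_zero[of A] in_closed_iff_infdist_zero[of B]
      by (auto dest: compact_imp_closed)
  next
    assume "A = B"
    then show "hausdorff_distance A B = 0"
      using A by (simp add: hausdorff_distance_def compact_imp_bounded)
  qed
  assume C: "C \<in> {K. compact K \<and> K \<noteq> {}}"
  have AB: "(\<forall>x\<in>A. infdist x B \<le> hausdorff_distance A B) \<and>
      (\<forall>y\<in>B. infdist y A \<le> hausdorff_distance A B)"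
    using le[OF A B] by blast
  have BC: "(\<forall>x\<in>B. infdist x C \<le> hausdorff_distance B C) \<and>
      (\<forall>y\<in>C. infdist y B \<le> hausdorff_distance B C)"
    using le[OF B C] by blast
  have "infdist x C \<le> hausdorff_distance A B + hausdorff_distance B C" if "x \<in> A" for x
    using infdist_le_add[of B C "hausdorff_distance B C" x] AB BC B that by fastforce
  moreover have "infdist y A \<le> hausdorff_distance A B + hausdorff_distance B C" if "y \<in> C" for y
    using infdist_le_add[of B A "hausdorff_distance A B" y] AB BC B that by fastforce
  ultimately show "hausdorff_distance A C \<le> hausdorff_distance A B + hausdorff_distance B C"
    using le[OF A C] by blast
qed

definition hausdorff_borel :: "'a::metric_space set measure" where
  "hausdorff_borel = sigma {K. compact K \<and> K \<noteq> {}} {U. openin Hausdorff.mtopology U}"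

lemma hausdorff_open_subset:
  "{U. openin Hausdorff.mtopology U} \<subseteq> Pow {K :: 'a::metric_space set. compact K \<and> K \<noteq> {}}"
  by (auto dest!: openin_subset)

lemma space_hausdorff_borel: "space hausdorff_borel = {K. compact K \<and> K \<noteq> {}}"
  by (simp add: hausdorff_borel_def space_measure_of[OF hausdorff_open_subset])

lemma sets_hausdorff_borel: "sets hausdorff_borel =
    sigma_sets {K. compact K \<and> K \<noteq> {}} {U. openin Hausdorff.mtopology U}"
  by (simp add: hausdorff_borel_def sets_measure_of[OF hausdorff_open_subset])

definition set_norm :: "'a::real_normed_vector set \<Rightarrow> real" where
  "set_norm A = (SUP y\<in>A. norm y)"

text \<open>Selections must lie in \<open>F s\<close> for every \<open>s\<close> in the space, not just almost every one.\<close>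

definition aumann_integral ::
    "'s measure \<Rightarrow> ('s \<Rightarrow> 'a::{banach, second_countable_topology} set) \<Rightarrow> 'a set" where
  "aumann_integral M F =
     {integral\<^sup>L M v | v. integrable M v \<and> (\<forall>s\<in>space M. v s \<in> F s)}"

end

theory Submission
  imports Defs "HOL-Complex_Analysis.Great_Picard"
begin

text \<open>The graph of the Aumann integral is closed by Fatou's lemma in several dimensions: for dominated
  \<open>v\<^sub>k\<close> with \<open>\<integral>v\<^sub>k \<rightarrow> y\<close> there is \<open>w\<close> with \<open>\<integral>w = y\<close> whose values are cluster points of \<open>v\<^sub>k\<close>. On the atoms a
  subsequence converges. On the nonatomic part the integrals of the cluster selections form a convex set
  (Lyapunov), and if \<open>y\<close> is not one of them, a supporting hyperplane forces \<open>v\<^sub>k\<close> to converge in its normal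
  direction along a subsequence; this lowers the dimension.

  For the chain rule, the derivative of \<open>f (\<gamma> \<cdot>) s\<close> at \<open>t\<close> is \<open>w \<bullet> \<gamma>' t\<close> for all \<open>w \<in> D (\<gamma> t) s\<close>, for almost every
  \<open>s\<close> and then almost every \<open>t\<close>. This is a jointly measurable condition, so Fubini exchanges the quantifiers, and
  one differentiates under the integral; the difference quotients are dominated because \<open>\<kappa> s\<close> is a Lipschitz
  constant of \<open>f \<cdot> s\<close>. Fubini is applied to the finite measure \<open>density M \<kappa>\<close>, as \<open>M\<close> need not be \<open>\<sigma>\<close>-finite. If \<open>M\<close> is the null
  measure, the hypotheses say nothing about \<open>\<gamma>\<close>, and its differentiability almost everywhere is Lebesgue's theorem.\<close>

section \<open>Measurable selection of cluster points\<close>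

text \<open>The values of \<open>D\<close> need not be convex. Weak compactness of selections would
  therefore only give selections of the convex hulls, which is why cluster points are used, and why
  atoms, on which nothing convexifies, are treated apart. Cluster points lie in \<open>D x s\<close>
  only for almost every \<open>s\<close>; a measurable selection of \<open>D x\<close> repairs the
  rest, because the Aumann integral asks for membership everywhere. Fubini needs a measurable set of
  pairs of \<open>t\<close> and \<open>s\<close>, whereas the chain rule speaks of all elements of
  \<open>D\<close>, of all increments, and of a derivative of the curve that is only given
  pointwise. Support functions absorb the first, rational increments the second, and an explicit
  limit of quotients the third. Passing to \<open>density M \<kappa>\<close> forgets the
  \<open>s\<close> with \<open>\<kappa> s = 0\<close>. Nothing is lost: there all selections vanish,
  and for almost every such \<open>s\<close> the function \<open>f\<close> is constant on the ball
  considered.\<close>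

lemma LIMSEQ_dist_less_inverse:
  assumes "\<And>k. dist (X k) x < 1 / Suc k"
  shows "X \<longlonglongrightarrow> x"
  unfolding tendsto_dist_iff[of X]
  by (rule tendsto_sandwich[OF _ _ tendsto_const lim_inverse_n'[THEN LIMSEQ_Suc]])
     (use assms in \<open>auto intro!: always_eventually less_imp_le\<close>)

definition cluster_point :: "(nat \<Rightarrow> 'a::metric_space) \<Rightarrow> 'a \<Rightarrow> bool" where
  "cluster_point X x \<longleftrightarrow> (\<forall>e>0. \<forall>n. \<exists>k\<ge>n. dist (X k) x < e)"

lemma cluster_point_LIMSEQ:
  assumes "X \<longlonglongrightarrow> x"
  shows "cluster_point X y \<longleftrightarrow> y = x"
proof
  assume c: "cluster_point X y"
  show "y = x"
  proof (rule ccontr)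
    assume "y \<noteq> x"
    then have "dist x y / 2 > 0" by simp
    from tendstoD[OF assms this] obtain n where n: "\<And>k. k \<ge> n \<Longrightarrow> dist (X k) x < dist x y / 2"
      by (auto simp: eventually_sequentially)
    from c \<open>dist x y / 2 > 0\<close> obtain k where "k \<ge> n" "dist (X k) y < dist x y / 2"
      unfolding cluster_point_def by blast
    with n[of k] show False using dist_triangle_half_l[of "X k" x "dist x y" y]
      by (smt (verit) dist_commute dist_triangle2 field_sum_of_halves)
  qed
next
  assume "y = x"
  show "cluster_point X y" unfolding cluster_point_def
  proof (intro allI impI)
    fix e :: real and n :: nat assume "e > 0"
    from tendstoD[OF assms this] obtain m where "\<And>k. k \<ge> m \<Longrightarrow> dist (X k) x < e"
      by (auto simp: eventually_sequentially)
    then show "\<exists>k\<ge>n. dist (X k) y < e" using \<open>y = x\<close> by (intro exI[of _ "max m n"]) auto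
  qed
qed

text \<open>Indices selected pointwise depend on \<open>s\<close> and need not increase with
  \<open>j\<close>, so measurable thinning does not produce subsequences. Membership of the
  \<open>j\<close>-th term in the \<open>j\<close>-th tail survives repeated thinning and suffices
  for cluster points.\<close>

lemma cluster_point_tails:
  assumes "cluster_point Y x" and "\<And>j. Y j \<in> X ` {j..}"
  shows "cluster_point X x"
  unfolding cluster_point_def
proof (intro allI impI)
  fix e :: real and n :: nat assume "e > 0"
  then obtain j where "j \<ge> n" "dist (Y j) x < e" using assms(1) unfolding cluster_point_def by blast
  moreover obtain k where "k \<ge> j" "Y j = X k" using assms(2)[of j] by auto
  ultimately show "\<exists>k\<ge>n. dist (X k) x < e" by (intro exI[of _ k]) auto
qed

lemma cluster_point_subseq:
  assumes "cluster_point (X \<circ> r) x" "strict_mono r"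
  shows "cluster_point X x"
  using assms(1) by (rule cluster_point_tails) (auto simp: seq_suble[OF assms(2)])

lemma cluster_point_imp_subseq:
  assumes "cluster_point X x"
  obtains r :: "nat \<Rightarrow> nat" where "strict_mono r" "(X \<circ> r) \<longlonglongrightarrow> x"
proof -
  have "\<exists>r. \<forall>n. (dist (X (r n)) x < 1 / (Suc n)) \<and> r n < r (Suc n)"
  proof (rule dependent_nat_choice)
    show "\<exists>k. dist (X k) x < 1 / real (Suc 0)"
      using assms unfolding cluster_point_def by (metis div_by_1 of_nat_1 One_nat_def zero_less_one)
    fix y n
    have "1 / real (Suc (Suc n)) > 0" by simp
    then obtain k where "k \<ge> Suc y" "dist (X k) x < 1 / real (Suc (Suc n))"
      using assms unfolding cluster_point_def by blast
    then show "\<exists>k. dist (X k) x < 1 / real (Suc (Suc n)) \<and> y < k" by auto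
  qed
  then obtain r where r: "\<And>n. dist (X (r n)) x < 1 / (Suc n)" "\<And>n. r n < r (Suc n)" by blast
  have "(X \<circ> r) \<longlonglongrightarrow> x" by (rule LIMSEQ_dist_less_inverse) (use r(1) in \<open>simp add: o_def\<close>)
  moreover have "strict_mono r" using r(2) by (simp add: strict_mono_Suc_iff)
  ultimately show ?thesis by (rule that[rotated])
qed

text \<open>Taking the least admissible index makes the choice measurable in \<open>s\<close>; that
  some index is admissible is the cluster property.\<close>

lemma measurable_subsequence:
  fixes a :: "nat \<Rightarrow> 's \<Rightarrow> real"
  assumes [measurable]: "\<And>k. a k \<in> borel_measurable M" "m \<in> borel_measurable M"
    and cl: "\<And>s. s \<in> space M \<Longrightarrow> cluster_point (\<lambda>k. a k s) (m s)"
  obtains N :: "nat \<Rightarrow> 's \<Rightarrow> nat" where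
    "\<And>j. N j \<in> M \<rightarrow>\<^sub>M count_space UNIV"
    "\<And>j s. s \<in> space M \<Longrightarrow> j \<le> N j s"
    "\<And>s. s \<in> space M \<Longrightarrow> (\<lambda>j. a (N j s) s) \<longlonglongrightarrow> m s"
proof -
  define N where "N j s = (LEAST k. j \<le> k \<and> dist (a k s) (m s) < 1 / Suc j)" for j s
  have N: "j \<le> N j s \<and> dist (a (N j s) s) (m s) < 1 / Suc j" if "s \<in> space M" for j s
    unfolding N_def
  proof (rule LeastI_ex)
    have "1 / real (Suc j) > 0" by simp
    then show "\<exists>k\<ge>j. dist (a k s) (m s) < 1 / Suc j"
      using cl[OF that] unfolding cluster_point_def by blast
  qed
  show ?thesis
  proof
    show "N j \<in> M \<rightarrow>\<^sub>M count_space UNIV" for j unfolding N_def by measurable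
    show "j \<le> N j s" if "s \<in> space M" for j s using N[OF that] by blast
    show "(\<lambda>j. a (N j s) s) \<longlonglongrightarrow> m s" if "s \<in> space M" for s
      by (rule LIMSEQ_dist_less_inverse) (use N[OF that] in blast)
  qed
qed

lemma bounded_real_limsup:
  fixes a :: "nat \<Rightarrow> real"
  assumes "bounded (range a)"
  shows "\<exists>m. limsup (\<lambda>k. ereal (a k)) = ereal m"
proof -
  obtain B where B: "\<And>k. \<bar>a k\<bar> \<le> B" using assms unfolding bounded_iff by auto
  have "limsup (\<lambda>k. ereal (a k)) \<le> ereal B"
    by (rule Limsup_bounded) (use B abs_le_D1 in \<open>auto intro!: always_eventually\<close>)
  moreover have "ereal (-B) \<le> limsup (\<lambda>k. ereal (a k))"
    by (rule order_trans[OF Liminf_bounded Liminf_le_Limsup]) (use B in \<open>auto intro!: always_eventually simp: abs_le_iff minus_le_iff\<close>)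
  ultimately show ?thesis by (cases "limsup (\<lambda>k. ereal (a k))") auto
qed

lemma cluster_point_limsup:
  fixes a :: "nat \<Rightarrow> real"
  assumes "limsup (\<lambda>k. ereal (a k)) = ereal m"
  shows "cluster_point a m"
proof -
  obtain r :: "nat \<Rightarrow> nat" where r: "strict_mono r" "((\<lambda>k. ereal (a k)) \<circ> r) \<longlonglongrightarrow> limsup (\<lambda>k. ereal (a k))"
    using limsup_subseq_lim by blast
  then have "(a \<circ> r) \<longlonglongrightarrow> m" using assms by (simp add: o_def)
  then have "cluster_point (a \<circ> r) m" by (simp add: cluster_point_LIMSEQ)
  then show ?thesis using r(1) by (rule cluster_point_subseq)
qed

text \<open>The indices are found from the scalars \<open>e \<bullet> u k s\<close> alone and then
  used on the vectors. Boundedness makes the limsup a real number and hence a cluster point.\<close>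

lemma measurable_tails_limsup:
  fixes u :: "nat \<Rightarrow> 's \<Rightarrow> 'a::euclidean_space"
  assumes u[measurable]: "\<And>k. u k \<in> borel_measurable M"
    and bd: "\<And>s. s \<in> space M \<Longrightarrow> bounded (range (\<lambda>k. u k s))"
  obtains v where "\<And>j. v j \<in> borel_measurable M"
    "\<And>j s. s \<in> space M \<Longrightarrow> v j s \<in> (\<lambda>k. u k s) ` {j..}"
    "\<And>s. s \<in> space M \<Longrightarrow>
      (\<lambda>j. e \<bullet> v j s) \<longlonglongrightarrow> real_of_ereal (limsup (\<lambda>k. ereal (e \<bullet> u k s)))"
proof -
  define m where "m s = real_of_ereal (limsup (\<lambda>k. ereal (e \<bullet> u k s)))" for s
  have [measurable]: "m \<in> borel_measurable M" unfolding m_def by measurable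
  have cl: "cluster_point (\<lambda>k. e \<bullet> u k s) (m s)" if s: "s \<in> space M" for s
  proof -
    have "bounded ((\<lambda>x. e \<bullet> x) ` range (\<lambda>k. u k s))"
      using bd[OF s] by (intro bounded_linear_image bounded_linear_inner_right)
    then have "bounded (range (\<lambda>k. e \<bullet> u k s))" by (simp add: image_comp o_def)
    then obtain c where "limsup (\<lambda>k. ereal (e \<bullet> u k s)) = ereal c"
      using bounded_real_limsup by blast
    then show ?thesis unfolding m_def by (simp add: cluster_point_limsup)
  qed
  obtain N where N[measurable]: "\<And>j. N j \<in> M \<rightarrow>\<^sub>M count_space UNIV"
    and Nj: "\<And>j s. s \<in> space M \<Longrightarrow> j \<le> N j s"
    and lim: "\<And>s. s \<in> space M \<Longrightarrow> (\<lambda>j. e \<bullet> u (N j s) s) \<longlonglongrightarrow> m s"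
    by (rule measurable_subsequence[OF _ _ cl]) (auto intro: that)
  show ?thesis
  proof
    show "(\<lambda>s. u (N j s) s) \<in> borel_measurable M" for j
      by (rule measurable_compose_countable'[OF u N]) auto
  qed (use Nj lim in \<open>auto simp: m_def\<close>)
qed

text \<open>Thinning by tails keeps every limit already reached, so a new direction can be made
  convergent without spoiling the earlier ones.\<close>

lemma measurable_tails_convergent:
  fixes u :: "nat \<Rightarrow> 's \<Rightarrow> 'a::euclidean_space"
  assumes u: "\<And>k. u k \<in> borel_measurable M"
    and bd: "\<And>s. s \<in> space M \<Longrightarrow> bounded (range (\<lambda>k. u k s))"
    and "finite B"
  shows "\<exists>v. (\<forall>j. v j \<in> borel_measurable M) \<and>
    (\<forall>j. \<forall>s\<in>space M. v j s \<in> (\<lambda>k. u k s) ` {j..}) \<and>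
    (\<forall>s\<in>space M. \<forall>b\<in>B. convergent (\<lambda>j. b \<bullet> v j s))"
  using \<open>finite B\<close>
proof induction
  case empty
  then show ?case using u by (intro exI[of _ u]) auto
next
  case (insert e B)
  then obtain v where v: "\<And>j. v j \<in> borel_measurable M"
    "\<And>j s. s \<in> space M \<Longrightarrow> v j s \<in> (\<lambda>k. u k s) ` {j..}"
    "\<And>s b. s \<in> space M \<Longrightarrow> b \<in> B \<Longrightarrow> convergent (\<lambda>j. b \<bullet> v j s)" by blast
  have "bounded (range (\<lambda>k. v k s))" if "s \<in> space M" for s
    by (rule bounded_subset[OF bd[OF that]]) (use v(2)[OF that] in blast)
  then obtain w where w: "\<And>j. w j \<in> borel_measurable M"
    "\<And>j s. s \<in> space M \<Longrightarrow> w j s \<in> (\<lambda>k. v k s) ` {j..}"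
    "\<And>s. s \<in> space M \<Longrightarrow> (\<lambda>j. e \<bullet> w j s) \<longlonglongrightarrow> real_of_ereal (limsup (\<lambda>k. ereal (e \<bullet> v k s)))"
    using measurable_tails_limsup[where M = M and u = v and e = e, OF v(1)] by blast
  have "w j s \<in> (\<lambda>k. u k s) ` {j..}" if s: "s \<in> space M" for j s
  proof -
    obtain k where k: "k \<ge> j" "w j s = v k s" using w(2)[OF s, of j] by auto
    obtain l where "l \<ge> k" "v k s = u l s" using v(2)[OF s, of k] by auto
    then show ?thesis using k by auto
  qed
  moreover have "convergent (\<lambda>j. b \<bullet> w j s)" if s: "s \<in> space M" and b: "b \<in> insert e B" for b s
  proof (cases "b = e")
    case True
    then show ?thesis using w(3)[OF s] by (auto simp: convergent_def)
  next
    case False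
    then obtain l where l: "(\<lambda>j. b \<bullet> v j s) \<longlonglongrightarrow> l" using v(3)[OF s] b by (auto simp: convergent_def)
    have "(\<lambda>j. b \<bullet> w j s) \<longlonglongrightarrow> l"
    proof (rule tendstoI)
      fix \<epsilon> :: real assume "\<epsilon> > 0"
      from tendstoD[OF l this] obtain n where n: "\<And>k. k \<ge> n \<Longrightarrow> dist (b \<bullet> v k s) l < \<epsilon>"
        by (auto simp: eventually_sequentially)
      show "\<forall>\<^sub>F j in sequentially. dist (b \<bullet> w j s) l < \<epsilon>"
        unfolding eventually_sequentially
      proof (intro exI allI impI)
        fix j assume "n \<le> j"
        obtain k where "k \<ge> j" "w j s = v k s" using w(2)[OF s, of j] by auto
        with n[of k] \<open>n \<le> j\<close> show "dist (b \<bullet> w j s) l < \<epsilon>" by simp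
      qed
    qed
    then show ?thesis by (auto simp: convergent_def)
  qed
  ultimately show ?case using w(1) by (intro exI[of _ w]) blast
qed

lemma convergent_componentwise:
  fixes X :: "nat \<Rightarrow> 'a::euclidean_space"
  assumes "\<And>b. b \<in> Basis \<Longrightarrow> convergent (\<lambda>j. b \<bullet> X j)"
  shows "convergent X"
proof -
  have "(\<lambda>j. X j) \<longlonglongrightarrow> (\<Sum>b\<in>Basis. lim (\<lambda>j. b \<bullet> X j) *\<^sub>R b)"
    unfolding tendsto_componentwise_iff[of X]
  proof
    fix b :: 'a assume b: "b \<in> Basis"
    have "(\<Sum>c\<in>Basis. lim (\<lambda>j. c \<bullet> X j) *\<^sub>R c) \<bullet> b = lim (\<lambda>j. b \<bullet> X j)"
      using b by simp
    then show "(\<lambda>j. X j \<bullet> b) \<longlonglongrightarrow> (\<Sum>c\<in>Basis. lim (\<lambda>j. c \<bullet> X j) *\<^sub>R c) \<bullet> b"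
      using assms[OF b] by (simp add: inner_commute convergent_LIMSEQ_iff)
  qed
  then show ?thesis by (auto simp: convergent_def)
qed

text \<open>Maximizing \<open>p\<close> first and then making the coordinates converge one after the other replaces a
  measurable selection theorem for the set of cluster points.\<close>

lemma measurable_cluster_selection:
  fixes u :: "nat \<Rightarrow> 's \<Rightarrow> 'a::euclidean_space"
  assumes u: "\<And>k. u k \<in> borel_measurable M"
    and bd: "\<And>s. s \<in> space M \<Longrightarrow> bounded (range (\<lambda>k. u k s))"
  obtains w where "w \<in> borel_measurable M"
    "\<And>s. s \<in> space M \<Longrightarrow> cluster_point (\<lambda>k. u k s) (w s)"
    "\<And>s. s \<in> space M \<Longrightarrow> ereal (p \<bullet> w s) = limsup (\<lambda>k. ereal (p \<bullet> u k s))"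
proof -
  obtain v where v: "\<And>j. v j \<in> borel_measurable M"
    "\<And>j s. s \<in> space M \<Longrightarrow> v j s \<in> (\<lambda>k. u k s) ` {j..}"
    "\<And>s. s \<in> space M \<Longrightarrow> (\<lambda>j. p \<bullet> v j s) \<longlonglongrightarrow> real_of_ereal (limsup (\<lambda>k. ereal (p \<bullet> u k s)))"
    using measurable_tails_limsup[where u = u and e = p, OF u bd] by blast
  have "bounded (range (\<lambda>k. v k s))" if "s \<in> space M" for s
    by (rule bounded_subset[OF bd[OF that]]) (use v(2)[OF that] in blast)
  from measurable_tails_convergent[OF v(1) this finite_Basis]
  obtain x where x: "\<And>j. x j \<in> borel_measurable M"
    "\<And>j s. s \<in> space M \<Longrightarrow> x j s \<in> (\<lambda>k. v k s) ` {j..}"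
    "\<And>s b. s \<in> space M \<Longrightarrow> b \<in> Basis \<Longrightarrow> convergent (\<lambda>j. b \<bullet> x j s)" by blast
  define w where "w s = lim (\<lambda>j. x j s)" for s
  have lim: "(\<lambda>j. x j s) \<longlonglongrightarrow> w s" if "s \<in> space M" for s
    unfolding w_def using convergent_componentwise[of "\<lambda>j. x j s"] x(3)[OF that]
    by (simp add: convergent_LIMSEQ_iff)
  have clv: "cluster_point (\<lambda>k. v k s) (w s)" if "s \<in> space M" for s
  proof (rule cluster_point_tails)
    show "cluster_point (\<lambda>j. x j s) (w s)" by (simp add: cluster_point_LIMSEQ[OF lim[OF that]])
  qed (rule x(2)[OF that])
  show ?thesis
  proof
    show "w \<in> borel_measurable M" unfolding w_def using x(1) by measurable
    fix s assume s: "s \<in> space M"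
    show "cluster_point (\<lambda>k. u k s) (w s)"
      by (rule cluster_point_tails[OF clv[OF s]]) (rule v(2)[OF s])
    \<comment> \<open>Since \<open>w s\<close> is a cluster point of \<open>v\<close>, whose
      \<open>p\<close>-components already tend to the limsup, the maximal value in direction
      \<open>p\<close> passes to \<open>w s\<close>.\<close>
    obtain r where r: "strict_mono r" "((\<lambda>k. v k s) \<circ> r) \<longlonglongrightarrow> w s"
      using cluster_point_imp_subseq[OF clv[OF s]] .
    have "(\<lambda>k. p \<bullet> v (r k) s) \<longlonglongrightarrow> p \<bullet> w s" using r(2) by (auto simp: o_def intro!: tendsto_intros)
    moreover have "(\<lambda>k. p \<bullet> v (r k) s) \<longlonglongrightarrow> real_of_ereal (limsup (\<lambda>k. ereal (p \<bullet> u k s)))"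
      using LIMSEQ_subseq_LIMSEQ[OF v(3)[OF s] r(1)] by (simp add: o_def)
    ultimately have eq: "p \<bullet> w s = real_of_ereal (limsup (\<lambda>k. ereal (p \<bullet> u k s)))"
      by (rule LIMSEQ_unique)
    have "bounded ((\<lambda>x. p \<bullet> x) ` range (\<lambda>k. u k s))"
      using bd[OF s] by (intro bounded_linear_image bounded_linear_inner_right)
    then have "bounded (range (\<lambda>k. p \<bullet> u k s))" by (simp add: image_comp o_def)
    then obtain c where "limsup (\<lambda>k. ereal (p \<bullet> u k s)) = ereal c"
      using bounded_real_limsup by blast
    then show "ereal (p \<bullet> w s) = limsup (\<lambda>k. ereal (p \<bullet> u k s))" using eq by simp
  qed
qed

section \<open>Lyapunov's convexity theorem\<close>

text \<open>With the real-valued \<open>measure\<close>, a set of infinite measure counts as null,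
  so the notion is meant for finite measures.\<close>

definition nonatomic :: "'s measure \<Rightarrow> bool" where
  "nonatomic M \<longleftrightarrow> (\<forall>A\<in>sets M. 0 < measure M A \<longrightarrow>
     (\<exists>B\<in>sets M. B \<subseteq> A \<and> 0 < measure M B \<and> measure M B < measure M A))"

context finite_measure
begin

text \<open>Of a part of intermediate measure and its complement, one has at most half the measure;
  iterating brings the measure below \<open>\<epsilon>\<close> while it stays positive.\<close>

lemma nonatomic_small_subset:
  assumes "nonatomic M" "A \<in> sets M" "0 < measure M A" "0 < \<epsilon>"
  obtains B where "B \<in> sets M" "B \<subseteq> A" "0 < measure M B" "measure M B < \<epsilon>"
proof -
  have "\<exists>B\<in>sets M. B \<subseteq> A \<and> 0 < measure M B \<and> measure M B \<le> measure M A / 2 ^ n" for n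
  proof (induction n)
    case 0
    then show ?case using assms by auto
  next
    case (Suc n)
    then obtain B where B: "B \<in> sets M" "B \<subseteq> A" "0 < measure M B" "measure M B \<le> measure M A / 2 ^ n"
      by blast
    obtain C where C: "C \<in> sets M" "C \<subseteq> B" "0 < measure M C" "measure M C < measure M B"
      using assms(1) B(1,3) unfolding nonatomic_def by blast
    have BC: "measure M (B - C) = measure M B - measure M C"
      using B(1) C(1,2) by (simp add: finite_measure_Diff)
    show ?case
    proof (cases "measure M C \<le> measure M B / 2")
      case True
      then have "measure M C \<le> measure M A / 2 ^ Suc n" using B(4) by simp
      then show ?thesis using B C by (intro bexI[of _ C]) auto
    next
      case False
      then have "measure M (B - C) \<le> measure M A / 2 ^ Suc n" using B(4) BC by simp
      then show ?thesis using B C BC by (intro bexI[of _ "B - C"]) auto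
    qed
  qed
  moreover obtain n where "measure M A / 2 ^ n < \<epsilon>"
  proof -
    have "(\<lambda>n. measure M A * (1/2) ^ n) \<longlonglongrightarrow> measure M A * 0"
      by (intro tendsto_intros LIMSEQ_power_zero) auto
    from order_tendstoD(2)[OF this, of \<epsilon>] assms(4) obtain n where "measure M A * (1/2) ^ n < \<epsilon>"
      by (auto simp: eventually_sequentially)
    then show ?thesis by (intro that[of n]) (simp add: power_divide)
  qed
  ultimately show ?thesis using that by (meson le_less_trans)
qed

text \<open>Greedy exhaustion: each step adds a set of at least half the largest admissible measure.\<close>

lemma nonatomic_subset_of_measure:
  assumes na: "nonatomic M" and E: "E \<in> sets M" and c: "0 \<le> c" "c \<le> measure M E"
  obtains A where "A \<in> sets M" "A \<subseteq> E" "measure M A = c"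
proof -
  define adm where "adm A = {B \<in> sets M. B \<subseteq> E - A \<and> measure M B \<le> c - measure M A}" for A
  define ok where "ok A \<longleftrightarrow> A \<in> sets M \<and> A \<subseteq> E \<and> measure M A \<le> c" for A
  have bdd: "bdd_above (measure M ` X)" for X
    by (rule bdd_aboveI[of _ "measure M (space M)"]) (auto intro: bounded_measure)
  have step: "\<exists>B. ok B \<and> A \<subseteq> B \<and> (SUP B\<in>adm A. measure M B) / 2 \<le> measure M B - measure M A"
    if A: "ok A" for A
  proof -
    define S where "S = (SUP B\<in>adm A. measure M B)"
    have ne: "{} \<in> adm A" using A by (auto simp: adm_def ok_def)
    have "\<exists>B\<in>adm A. S / 2 \<le> measure M B"
    proof (cases "S \<le> 0")
      case True
      then show ?thesis using ne by (intro bexI[of _ "{}"]) auto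
    next
      case False
      then have "S / 2 < (SUP B\<in>adm A. measure M B)" unfolding S_def by simp
      then show ?thesis using ne bdd by (subst (asm) less_cSUP_iff) (auto intro: less_imp_le)
    qed
    then obtain B where B: "B \<in> adm A" "S / 2 \<le> measure M B" by blast
    have "measure M (A \<union> B) = measure M A + measure M B"
      using A B by (intro finite_measure_Union) (auto simp: adm_def ok_def)
    then show ?thesis using A B unfolding S_def[symmetric]
      by (intro exI[of _ "A \<union> B"]) (auto simp: adm_def ok_def)
  qed
  have "\<exists>F. \<forall>n. ok (F n) \<and> (F n \<subseteq> F (Suc n) \<and>
      (SUP B\<in>adm (F n). measure M B) / 2 \<le> measure M (F (Suc n)) - measure M (F n))"
    by (rule dependent_nat_choice) (use step c in \<open>auto simp: ok_def intro!: exI[of _ "{}"]\<close>)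
  then obtain F where F: "\<And>n. ok (F n)" "\<And>n. F n \<subseteq> F (Suc n)"
    "\<And>n. (SUP B\<in>adm (F n). measure M B) / 2 \<le> measure M (F (Suc n)) - measure M (F n)" by blast
  define A where "A = (\<Union>n. F n)"
  have A: "A \<in> sets M" "A \<subseteq> E" using F(1) by (auto simp: A_def ok_def)
  have lim: "(\<lambda>n. measure M (F n)) \<longlonglongrightarrow> measure M A"
    unfolding A_def by (rule finite_Lim_measure_incseq) (use F in \<open>auto simp: ok_def incseq_SucI\<close>)
  have le: "measure M A \<le> c"
    by (rule LIMSEQ_le_const2[OF lim]) (use F(1) in \<open>auto simp: ok_def\<close>)
  have "measure M A = c"
  proof (rule ccontr)
    assume "measure M A \<noteq> c"
    then have lt: "0 < c - measure M A" using le by simp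
    moreover have "measure M (E - A) = measure M E - measure M A"
      using E A by (simp add: finite_measure_Diff)
    ultimately obtain B where B: "B \<in> sets M" "B \<subseteq> E - A" "0 < measure M B" "measure M B < c - measure M A"
      using nonatomic_small_subset[OF na, of "E - A" "c - measure M A"] E A c by auto
    \<comment> \<open>The leftover \<open>B\<close> is admissible at every stage, so every greedy
      step gains at least half of its measure; but the gains tend to 0.\<close>
    have "measure M B / 2 \<le> measure M (F (Suc n)) - measure M (F n)" for n
    proof -
      have "measure M (F n) \<le> measure M A"
        by (rule finite_measure_mono) (use A in \<open>auto simp: A_def\<close>)
      then have "B \<in> adm (F n)" using B by (auto simp: adm_def A_def)
      then have "measure M B \<le> (SUP B\<in>adm (F n). measure M B)" by (rule cSUP_upper[OF _ bdd])
      then show ?thesis using F(3)[of n] by linarith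
    qed
    moreover have "(\<lambda>n. measure M (F (Suc n)) - measure M (F n)) \<longlonglongrightarrow> measure M A - measure M A"
      by (intro tendsto_diff lim LIMSEQ_Suc)
    ultimately have "measure M B / 2 \<le> measure M A - measure M A"
      by (intro LIMSEQ_le_const) auto
    then show False using B(3) by simp
  qed
  then show ?thesis using A that by blast
qed

text \<open>Halving is asked of every measurable \<open>E\<close> because the halves are to be
  halved again; this is how \<open>splittable_chain\<close> reaches all ratios.\<close>

definition splittable :: "('a \<Rightarrow> real) set \<Rightarrow> bool" where
  "splittable \<Phi> \<longleftrightarrow> (\<forall>E\<in>sets M. \<exists>A\<in>sets M. A \<subseteq> E \<and>
     (\<forall>\<phi>\<in>\<Phi>. 2 * (LINT s:A|M. \<phi> s) = (LINT s:E|M. \<phi> s)))"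

text \<open>Iterated halving gives the sets with dyadic parameter; the others are unions of these.\<close>

lemma splittable_chain:
  assumes sp: "splittable \<Phi>" and int: "\<And>\<phi>. \<phi> \<in> \<Phi> \<Longrightarrow> integrable M \<phi>" and E: "E \<in> sets M"
  obtains C :: "real \<Rightarrow> 'a set" where "\<And>t. C t \<in> sets M" "\<And>t. 0 \<le> t \<Longrightarrow> t \<le> 1 \<Longrightarrow> C t \<subseteq> E"
    "\<And>t u. 0 \<le> t \<Longrightarrow> t \<le> u \<Longrightarrow> u \<le> 1 \<Longrightarrow> C t \<subseteq> C u"
    "\<And>t \<phi>. 0 \<le> t \<Longrightarrow> t \<le> 1 \<Longrightarrow> \<phi> \<in> \<Phi> \<Longrightarrow> (LINT s:C t|M. \<phi> s) = t * (LINT s:E|M. \<phi> s)"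
proof -
  obtain H where H: "\<And>E. E \<in> sets M \<Longrightarrow> H E \<in> sets M" "\<And>E. E \<in> sets M \<Longrightarrow> H E \<subseteq> E"
    "\<And>E \<phi>. E \<in> sets M \<Longrightarrow> \<phi> \<in> \<Phi> \<Longrightarrow> 2 * (LINT s:H E|M. \<phi> s) = (LINT s:E|M. \<phi> s)"
    using sp unfolding splittable_def by metis
  \<comment> \<open>\<open>P m k\<close> is the union of the first \<open>k\<close> of
    \<open>2 ^ m\<close> pieces with equal \<open>\<Phi>\<close>-integrals. At the next level, an
    odd \<open>k\<close> adds the chosen half of the piece in which it ends.\<close>
  define P where "P = rec_nat (\<lambda>k::nat. if k = 0 then {} else E)
    (\<lambda>_ Q k. if even k then Q (k div 2) else Q (k div 2) \<union> H (Q (Suc (k div 2)) - Q (k div 2)))"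
  have P0: "P 0 k = (if k = 0 then {} else E)" for k by (simp add: P_def)
  have PS: "P (Suc m) k = (if even k then P m (k div 2)
      else P m (k div 2) \<union> H (P m (Suc (k div 2)) - P m (k div 2)))" for m k
    by (simp add: P_def)
  have meas: "P m k \<in> sets M" for m k
    by (induction m arbitrary: k) (auto simp: P0 PS E intro!: H(1))
  have mono1: "P m k \<subseteq> P m (Suc k)" for m k
  proof (induction m arbitrary: k)
    case (Suc m)
    show ?case
    proof (cases "even k")
      case True
      then show ?thesis by (auto simp: PS)
    next
      case False
      then have "Suc k div 2 = Suc (k div 2)" by presburger
      moreover have "H (P m (Suc (k div 2)) - P m (k div 2)) \<subseteq> P m (Suc (k div 2))"
        using H(2)[of "P m (Suc (k div 2)) - P m (k div 2)"] meas by auto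
      ultimately show ?thesis using False Suc[of "k div 2"] by (auto simp: PS)
    qed
  qed (auto simp: P0)
  have mono: "P m k \<subseteq> P m l" if "k \<le> l" for m k l
    using that by (induction rule: dec_induct) (use mono1 in blast)+
  have sub: "P m k \<subseteq> E" for m k
  proof (induction m arbitrary: k)
    case (Suc m)
    have "H (P m (Suc (k div 2)) - P m (k div 2)) \<subseteq> P m (Suc (k div 2))"
      using H(2)[of "P m (Suc (k div 2)) - P m (k div 2)"] meas by auto
    then show ?case using Suc by (auto simp: PS)
  qed (auto simp: P0)
  have sint: "set_integrable M A \<phi>" if "A \<in> sets M" "\<phi> \<in> \<Phi>" for A \<phi>
    using int[OF that(2)] that(1) unfolding set_integrable_def by (intro integrable_mult_indicator)
  have val: "(LINT s:P m k|M. \<phi> s) = real k / 2 ^ m * (LINT s:E|M. \<phi> s)" if "\<phi> \<in> \<Phi>" "k \<le> 2 ^ m" for m k \<phi>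
    using that(2)
  proof (induction m arbitrary: k)
    case 0
    then show ?case by (cases k) (auto simp: P0 set_lebesgue_integral_def)
  next
    case (Suc m)
    show ?case
    proof (cases "even k")
      case True
      then obtain j where "k = 2 * j" by blast
      then show ?thesis using Suc by (simp add: PS)
    next
      case False
      then obtain j where k: "k = 2 * j + 1" using oddE by blast
      then have j: "Suc j \<le> 2 ^ m" using Suc.prems by simp
      define R where "R = P m (Suc j) - P m j"
      have R: "R \<in> sets M" unfolding R_def using meas by auto
      have "(LINT s:P m (Suc j)|M. \<phi> s) = (LINT s:P m j|M. \<phi> s) + (LINT s:R|M. \<phi> s)"
      proof -
        have "P m (Suc j) = P m j \<union> R" "P m j \<inter> R = {}" using mono1[of m j] by (auto simp: R_def)
        then show ?thesis using sint[OF meas that(1)] sint[OF R that(1)] by (metis set_integral_Un)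
      qed
      then have "(LINT s:R|M. \<phi> s) = (LINT s:E|M. \<phi> s) / 2 ^ m"
        using Suc.IH[of j] Suc.IH[of "Suc j"] j by (simp add: field_simps)
      then have h: "(LINT s:H R|M. \<phi> s) = (LINT s:E|M. \<phi> s) / 2 ^ Suc m"
        using H(3)[OF R that(1)] by simp
      have "P (Suc m) k = P m j \<union> H R" using k by (simp add: PS R_def)
      moreover have "P m j \<inter> H R = {}" using H(2)[OF R] by (auto simp: R_def)
      ultimately have "(LINT s:P (Suc m) k|M. \<phi> s) = (LINT s:P m j|M. \<phi> s) + (LINT s:H R|M. \<phi> s)"
        using sint[OF meas that(1)] sint[OF H(1)[OF R] that(1)] by (simp add: set_integral_Un)
      then show ?thesis using Suc.IH[of j] j h k by (simp add: field_simps)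
    qed
  qed
  \<comment> \<open>Rounding \<open>t * 2 ^ m\<close> down makes these sets increase with
    \<open>m\<close>, so that their integrals converge to the integral over the union.\<close>
  define C where "C t = (\<Union>m. P m (nat \<lfloor>t * 2 ^ m\<rfloor>))" for t :: real
  have inc: "incseq (\<lambda>m. P m (nat \<lfloor>t * 2 ^ m\<rfloor>))" if "0 \<le> t" for t :: real
  proof (rule incseq_SucI)
    fix m
    have "real_of_int \<lfloor>t * 2 ^ m\<rfloor> \<le> t * 2 ^ m" by simp
    then have "2 * \<lfloor>t * 2 ^ m\<rfloor> \<le> \<lfloor>t * 2 ^ Suc m\<rfloor>" by (subst le_floor_iff) simp
    then have "2 * nat \<lfloor>t * 2 ^ m\<rfloor> \<le> nat \<lfloor>t * 2 ^ Suc m\<rfloor>" by linarith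
    from mono[OF this] have "P (Suc m) (2 * nat \<lfloor>t * 2 ^ m\<rfloor>) \<subseteq> P (Suc m) (nat \<lfloor>t * 2 ^ Suc m\<rfloor>)" .
    then show "P m (nat \<lfloor>t * 2 ^ m\<rfloor>) \<subseteq> P (Suc m) (nat \<lfloor>t * 2 ^ Suc m\<rfloor>)" by (simp add: PS)
  qed
  show ?thesis
  proof
    show Cm: "C t \<in> sets M" for t unfolding C_def using meas by auto
    show "C t \<subseteq> E" for t unfolding C_def using sub by auto
    show "C t \<subseteq> C u" if "0 \<le> t" "t \<le> u" for t u
      unfolding C_def by (intro UN_mono mono nat_mono floor_mono) (use that in auto)
    fix t \<phi> assume t: "0 \<le> (t::real)" "t \<le> 1" and \<phi>: "\<phi> \<in> \<Phi>"
    have "(\<lambda>m. LINT s:P m (nat \<lfloor>t * 2 ^ m\<rfloor>)|M. \<phi> s) \<longlonglongrightarrow> (LINT s:C t|M. \<phi> s)"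
      unfolding C_def
      by (rule set_integral_cont_up) (use inc[OF t(1)] meas sint[OF Cm \<phi>] in \<open>auto simp: C_def\<close>)
    moreover have "(\<lambda>m. LINT s:P m (nat \<lfloor>t * 2 ^ m\<rfloor>)|M. \<phi> s) \<longlonglongrightarrow> t * (LINT s:E|M. \<phi> s)"
    proof -
      have eq: "(LINT s:P m (nat \<lfloor>t * 2 ^ m\<rfloor>)|M. \<phi> s) = \<lfloor>t * 2 ^ m\<rfloor> / 2 ^ m * (LINT s:E|M. \<phi> s)" for m
      proof -
        have "\<lfloor>t * 2 ^ m\<rfloor> \<le> \<lfloor>(2::real) ^ m\<rfloor>" using t by (intro floor_mono) auto
        then have "nat \<lfloor>t * 2 ^ m\<rfloor> \<le> 2 ^ m"
          by (metis floor_of_int floor_numeral_power nat_le_iff of_nat_numeral of_nat_power)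
        then show ?thesis using val[OF \<phi>, of "nat \<lfloor>t * 2 ^ m\<rfloor>" m] t by simp
      qed
      have "(\<lambda>m. \<lfloor>t * 2 ^ m\<rfloor> / 2 ^ m) \<longlonglongrightarrow> t"
      proof (rule tendsto_sandwich[of "\<lambda>m. t - (1/2) ^ m" _ _ "\<lambda>_. t"])
        have "(\<lambda>m. t - (1/2) ^ m) \<longlonglongrightarrow> t - 0" by (intro tendsto_intros LIMSEQ_power_zero) auto
        then show "(\<lambda>m. t - (1/2) ^ m) \<longlonglongrightarrow> t" by simp
        show "\<forall>\<^sub>F m in sequentially. t - (1/2) ^ m \<le> \<lfloor>t * 2 ^ m\<rfloor> / 2 ^ m"
        proof (rule always_eventually, rule allI)
          fix m :: nat
          have "t * 2 ^ m - 1 \<le> \<lfloor>t * 2 ^ m\<rfloor>" by linarith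
          then have "(t * 2 ^ m - 1) / 2 ^ m \<le> \<lfloor>t * 2 ^ m\<rfloor> / 2 ^ m" by (intro divide_right_mono) auto
          then show "t - (1/2) ^ m \<le> \<lfloor>t * 2 ^ m\<rfloor> / 2 ^ m" by (simp add: diff_divide_distrib power_divide)
        qed
        show "\<forall>\<^sub>F m in sequentially. \<lfloor>t * 2 ^ m\<rfloor> / 2 ^ m \<le> t"
          by (rule always_eventually) (simp add: divide_le_eq)
      qed auto
      then show ?thesis unfolding eq by (intro tendsto_mult tendsto_const)
    qed
    ultimately show "(LINT s:C t|M. \<phi> s) = t * (LINT s:E|M. \<phi> s)" by (rule LIMSEQ_unique)
  qed
qed

text \<open>Halmos: sliding a window of half the length along a chain that halves \<open>\<Phi>\<close>, the intermediate value
  theorem finds a position where it also halves \<open>\<psi>\<close>.\<close>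

lemma splittable_insert:
  assumes sp: "splittable \<Phi>" and one: "(\<lambda>_. 1) \<in> \<Phi>" and int: "\<And>\<phi>. \<phi> \<in> \<Phi> \<Longrightarrow> integrable M \<phi>"
    and \<psi>[measurable]: "\<psi> \<in> borel_measurable M" and bd: "\<And>s. s \<in> space M \<Longrightarrow> \<bar>\<psi> s\<bar> \<le> K"
  shows "splittable (insert \<psi> \<Phi>)"
  unfolding splittable_def
proof
  fix E assume E: "E \<in> sets M"
  obtain C :: "real \<Rightarrow> 'a set" where C: "\<And>t. C t \<in> sets M" "\<And>t. 0 \<le> t \<Longrightarrow> t \<le> 1 \<Longrightarrow> C t \<subseteq> E"
    "\<And>t u. 0 \<le> t \<Longrightarrow> t \<le> u \<Longrightarrow> u \<le> 1 \<Longrightarrow> C t \<subseteq> C u"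
    "\<And>t \<phi>. 0 \<le> t \<Longrightarrow> t \<le> 1 \<Longrightarrow> \<phi> \<in> \<Phi> \<Longrightarrow> (LINT s:C t|M. \<phi> s) = t * (LINT s:E|M. \<phi> s)"
    using splittable_chain[OF sp int E] by blast
  have ipsi: "integrable M \<psi>" by (rule integrable_const_bound[of _ K]) (use bd in auto)
  have sint: "set_integrable M A \<phi>" if "A \<in> sets M" "\<phi> \<in> insert \<psi> \<Phi>" for A \<phi>
    using int[of \<phi>] ipsi that unfolding set_integrable_def by (intro integrable_mult_indicator) auto
  have mC: "measure M (C t) = t * measure M E" if "0 \<le> t" "t \<le> 1" for t
    using C(4)[OF that one] C(1) E by (simp add: set_integral_const)
  have diff: "(LINT s:C u - C t|M. \<phi> s) = (LINT s:C u|M. \<phi> s) - (LINT s:C t|M. \<phi> s)"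
    if "0 \<le> t" "t \<le> u" "u \<le> 1" "\<phi> \<in> insert \<psi> \<Phi>" for t u \<phi>
  proof -
    have "(LINT s:C t \<union> (C u - C t)|M. \<phi> s) = (LINT s:C t|M. \<phi> s) + (LINT s:C u - C t|M. \<phi> s)"
      using C(1) sint[OF _ that(4)] by (intro set_integral_Un) auto
    moreover have "C t \<union> (C u - C t) = C u" using C(3)[OF that(1-3)] by auto
    ultimately show ?thesis by simp
  qed
  \<comment> \<open>The chain prescribes integrals for \<open>\<Phi>\<close> only. For
    \<open>\<psi>\<close> the two ends are settled through the constant 1 in \<open>\<Phi>\<close>,
    which makes \<open>C 0\<close> and \<open>E - C 1\<close> null sets.\<close>
  have all: "(LINT s:C 1|M. \<phi> s) = (LINT s:E|M. \<phi> s)" "(LINT s:C 0|M. \<phi> s) = 0" if "\<phi> \<in> insert \<psi> \<Phi>" for \<phi>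
  proof -
    have "measure M (E - C 1) = 0" using mC[of 1] E C(1) C(2)[of 1] by (simp add: finite_measure_Diff)
    then have n1: "E - C 1 \<in> null_sets M" using E C(1) by (intro null_setsI) (auto simp: emeasure_eq_measure)
    have m: "set_borel_measurable M A \<phi>" if "A \<in> sets M" for A
      using sint[OF that \<open>\<phi> \<in> insert \<psi> \<Phi>\<close>] unfolding set_integrable_def set_borel_measurable_def by auto
    have "AE s in M. s \<in> C 1 \<longleftrightarrow> s \<in> E"
      using AE_not_in[OF n1] C(2)[of 1] by (auto elim!: eventually_mono)
    then show "(LINT s:C 1|M. \<phi> s) = (LINT s:E|M. \<phi> s)"
      by (intro set_integral_cong_set m C(1) E) auto
    have n0: "C 0 \<in> null_sets M" using mC[of 0] C(1) by (intro null_setsI) (auto simp: emeasure_eq_measure)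
    have "AE s in M. s \<in> C 0 \<longleftrightarrow> s \<in> {}" using AE_not_in[OF n0] by (auto elim!: eventually_mono)
    then have "(LINT s:C 0|M. \<phi> s) = (LINT s:{}|M. \<phi> s)"
      by (intro set_integral_cong_set m C(1)) auto
    then show "(LINT s:C 0|M. \<phi> s) = 0" by (simp add: set_lebesgue_integral_def)
  qed
  define I where "I t = (LINT s:C t|M. \<psi> s)" for t
  \<comment> \<open>The constant 1 also makes the measure of \<open>C u - C t\<close> proportional
    to \<open>u - t\<close>; with the bound on \<open>\<psi>\<close> this gives continuity of
    \<open>I\<close>.\<close>
  have lip: "\<bar>I u - I t\<bar> \<le> (\<bar>K\<bar> * measure M E) * \<bar>u - t\<bar>" if "0 \<le> t" "t \<le> u" "u \<le> 1" for t u
  proof -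
    have "\<bar>I u - I t\<bar> = norm (LINT s:C u - C t|M. \<psi> s)" using diff[OF that, of \<psi>] by (simp add: I_def)
    also have "\<dots> \<le> (LINT s:C u - C t|M. norm (\<psi> s))"
      by (rule set_integral_norm_bound) (use sint C(1) in auto)
    also have "\<dots> \<le> (LINT s:C u - C t|M. \<bar>K\<bar>)"
    proof (rule set_integral_mono)
      show "set_integrable M (C u - C t) (\<lambda>s. norm (\<psi> s))"
        using sint[of "C u - C t" \<psi>] C(1) by (intro set_integrable_norm) auto
      show "set_integrable M (C u - C t) (\<lambda>s. \<bar>K\<bar>)"
        unfolding set_integrable_def using C(1) by (intro integrable_mult_indicator) auto
      show "norm (\<psi> s) \<le> \<bar>K\<bar>" if "s \<in> C u - C t" for s
        using bd[of s] that sets.sets_into_space[OF C(1)[of u]] by auto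
    qed
    also have "\<dots> = \<bar>K\<bar> * measure M (C u - C t)"
      using C(1) by (simp add: set_integral_const emeasure_eq_measure)
    also have "measure M (C u - C t) = (u - t) * measure M E"
      using finite_measure_Diff[OF C(1) C(1) C(3)[OF that]] mC[of u] mC[of t] that by (simp add: algebra_simps)
    finally show ?thesis using that by (simp add: mult_ac)
  qed
  have lip: "(\<bar>K\<bar> * measure M E)-lipschitz_on {0..1} I"
  proof (rule lipschitz_onI)
    fix x y :: real assume "x \<in> {0..1}" "y \<in> {0..1}"
    then show "dist (I x) (I y) \<le> (\<bar>K\<bar> * measure M E) * dist x y"
      using lip[of x y] lip[of y x] by (cases "x \<le> y") (auto simp: dist_real_def abs_minus_commute)
  qed auto
  then have cont: "continuous_on {0..1} I" by (rule lipschitz_on_continuous_on)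
  define J where "J t = I (t + 1/2) - I t" for t
  have "continuous_on {0..1/2} J" unfolding J_def
    by (intro continuous_intros continuous_on_compose2[OF cont]) auto
  \<comment> \<open>The windows starting at 0 and at 1/2 together exhaust the chain, so half of the
    full integral is the average of the two end values of \<open>J\<close>.\<close>
  moreover have sum: "J 0 + J (1/2) = (LINT s:E|M. \<psi> s)" using all[of \<psi>] by (simp add: J_def I_def)
  ultimately have "\<exists>t\<ge>0. t \<le> 1/2 \<and> J t = (LINT s:E|M. \<psi> s) / 2"
  proof (cases "J 0 \<le> (LINT s:E|M. \<psi> s) / 2")
    case True
    then show ?thesis using sum \<open>continuous_on {0..1/2} J\<close> by (intro IVT') auto
  next
    case False
    then show ?thesis using sum \<open>continuous_on {0..1/2} J\<close> by (intro IVT2') auto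
  qed
  then obtain t where t: "0 \<le> t" "t \<le> 1/2" "J t = (LINT s:E|M. \<psi> s) / 2" by blast
  show "\<exists>A\<in>sets M. A \<subseteq> E \<and> (\<forall>\<phi>\<in>insert \<psi> \<Phi>. 2 * (LINT s:A|M. \<phi> s) = (LINT s:E|M. \<phi> s))"
  proof (intro bexI conjI ballI)
    show "C (t + 1/2) - C t \<in> sets M" using C(1) by auto
    show "C (t + 1/2) - C t \<subseteq> E" using C(2)[of "t + 1/2"] t by auto
    fix \<phi> assume \<phi>: "\<phi> \<in> insert \<psi> \<Phi>"
    have d: "(LINT s:C (t + 1/2) - C t|M. \<phi> s) = (LINT s:C (t + 1/2)|M. \<phi> s) - (LINT s:C t|M. \<phi> s)"
      using t by (intro diff \<phi>) auto
    show "2 * (LINT s:C (t + 1/2) - C t|M. \<phi> s) = (LINT s:E|M. \<phi> s)"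
    proof (cases "\<phi> = \<psi>")
      case True
      then show ?thesis using d t by (simp add: J_def I_def)
    next
      case False
      then have "\<phi> \<in> \<Phi>" using \<phi> by auto
      then show ?thesis using d C(4)[of t \<phi>] C(4)[of "t + 1/2" \<phi>] t by (simp add: algebra_simps)
    qed
  qed
qed

text \<open>The induction starts from the constant 1, halved by a subset of prescribed measure. It
  has to stay in the family because \<open>splittable_insert\<close> relies on it.\<close>

lemma nonatomic_splittable:
  assumes na: "nonatomic M" and "finite \<Psi>"
    and "\<And>\<psi>. \<psi> \<in> \<Psi> \<Longrightarrow> \<psi> \<in> borel_measurable M"
    and "\<And>\<psi> s. \<psi> \<in> \<Psi> \<Longrightarrow> s \<in> space M \<Longrightarrow> \<bar>\<psi> s\<bar> \<le> K"
  shows "splittable (\<Psi> \<union> {\<lambda>_. 1})"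
  using assms(2-)
proof (induction \<Psi>)
  case empty
  show ?case unfolding splittable_def
  proof
    fix E assume E: "E \<in> sets M"
    obtain A where "A \<in> sets M" "A \<subseteq> E" "measure M A = measure M E / 2"
      using nonatomic_subset_of_measure[OF na E, of "measure M E / 2"] by auto
    then show "\<exists>A\<in>sets M. A \<subseteq> E \<and> (\<forall>\<phi>\<in>{} \<union> {\<lambda>_. 1::real}. 2 * (LINT s:A|M. \<phi> s) = (LINT s:E|M. \<phi> s))"
      using E by (intro bexI[of _ A]) (auto simp: set_integral_const emeasure_eq_measure)
  qed
next
  case (insert \<psi> \<Psi>)
  have "integrable M \<phi>" if "\<phi> \<in> \<Psi> \<union> {\<lambda>_. 1}" for \<phi>
  proof (cases "\<phi> \<in> \<Psi>")
    case True
    show ?thesis by (rule integrable_const_bound[of _ K]) (use True insert.prems in auto)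
  next
    case False
    then have "\<phi> = (\<lambda>_. 1)" using that by blast
    then show ?thesis by simp
  qed
  then have "splittable (insert \<psi> (\<Psi> \<union> {\<lambda>_. 1}))"
    using insert by (intro splittable_insert[where K = K]) auto
  then show ?case by (simp add: insert_commute)
qed

text \<open>The set is the member with parameter \<open>\<alpha>\<close> of a chain for all
  coordinates of \<open>h\<close>. This form of Lyapunov's theorem is applied to the difference of
  two selections.\<close>

lemma nonatomic_convex_split:
  fixes h :: "'a \<Rightarrow> 'b::euclidean_space"
  assumes na: "nonatomic M" and h: "h \<in> borel_measurable M" "\<And>s. s \<in> space M \<Longrightarrow> norm (h s) \<le> K"
    and \<alpha>: "0 \<le> \<alpha>" "\<alpha> \<le> 1"
  obtains A where "A \<in> sets M" "(LINT s:A|M. h s) = \<alpha> *\<^sub>R (LINT s|M. h s)"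
proof -
  define \<Psi> where "\<Psi> = (\<lambda>b s. h s \<bullet> b) ` (Basis :: 'b set)"
  have \<Psi>m: "\<psi> \<in> borel_measurable M" if "\<psi> \<in> \<Psi>" for \<psi> using that h(1) unfolding \<Psi>_def by auto
  have \<Psi>b: "\<bar>\<psi> s\<bar> \<le> K" if "\<psi> \<in> \<Psi>" "s \<in> space M" for \<psi> s
    using that h(2)[of s] unfolding \<Psi>_def by (auto intro: order_trans[OF Basis_le_norm])
  have sp: "splittable (\<Psi> \<union> {\<lambda>_. 1})"
    by (rule nonatomic_splittable[OF na, of _ K]) (use \<Psi>m \<Psi>b in \<open>auto simp: \<Psi>_def\<close>)
  have ih: "integrable M h" by (rule integrable_const_bound[of _ K]) (use h in auto)
  have "integrable M \<phi>" if "\<phi> \<in> \<Psi> \<union> {\<lambda>_. 1}" for \<phi>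
    using that ih by (auto simp: \<Psi>_def)
  from splittable_chain[OF sp this sets.top]
  obtain C where C: "\<And>t. C t \<in> sets M" "\<And>t. 0 \<le> t \<Longrightarrow> t \<le> 1 \<Longrightarrow> C t \<subseteq> space M"
    "\<And>t u. 0 \<le> t \<Longrightarrow> t \<le> u \<Longrightarrow> u \<le> 1 \<Longrightarrow> C t \<subseteq> C u"
    "\<And>t \<phi>. 0 \<le> t \<Longrightarrow> t \<le> 1 \<Longrightarrow> \<phi> \<in> \<Psi> \<union> {\<lambda>_. 1} \<Longrightarrow> (LINT s:C t|M. \<phi> s) = t * (LINT s:space M|M. \<phi> s)"
    by blast
  have "(LINT s:C \<alpha>|M. h s) = \<alpha> *\<^sub>R (LINT s|M. h s)"
  proof (rule euclidean_eqI)
    fix b :: 'b assume b: "b \<in> Basis"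
    have sh: "integrable M (\<lambda>s. indicat_real (C \<alpha>) s *\<^sub>R h s)"
      by (rule integrable_mult_indicator[OF C(1) ih])
    have "(LINT s:C \<alpha>|M. h s) \<bullet> b = (LINT s:C \<alpha>|M. h s \<bullet> b)"
      using integral_inner_left[OF sh, of b] unfolding set_lebesgue_integral_def by simp
    also have "\<dots> = \<alpha> * (LINT s:space M|M. h s \<bullet> b)"
      using b by (intro C(4) \<alpha>) (auto simp: \<Psi>_def)
    also have "(LINT s:space M|M. h s \<bullet> b) = (LINT s|M. h s \<bullet> b)"
      using ih by (intro set_integral_space) auto
    also have "\<dots> = (LINT s|M. h s) \<bullet> b" using ih by simp
    finally show "(LINT s:C \<alpha>|M. h s) \<bullet> b = (\<alpha> *\<^sub>R (LINT s|M. h s)) \<bullet> b" by simp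
  qed
  then show ?thesis using C(1) that by blast
qed

end

section \<open>Fatou's lemma in several dimensions\<close>

lemma cluster_point_norm_le:
  fixes X :: "nat \<Rightarrow> 'a::real_normed_vector"
  assumes "cluster_point X x" "\<And>k. norm (X k) \<le> K"
  shows "norm x \<le> K"
proof -
  obtain r where "(X \<circ> r) \<longlonglongrightarrow> x" using cluster_point_imp_subseq[OF assms(1)] .
  then show ?thesis
    by (rule Lim_bounded[where M = 0, OF tendsto_norm]) (simp add: assms(2))
qed

lemma norm_integral_le_integral:
  fixes f :: "'s \<Rightarrow> 'b::{banach,second_countable_topology}"
  assumes "integrable M f" "integrable M g" "\<And>s. s \<in> space M \<Longrightarrow> norm (f s) \<le> g s"
  shows "norm (LINT s|M. f s) \<le> (LINT s|M. g s)"
  using integral_norm_bound[of M f] integral_mono[OF integrable_norm[OF assms(1)] assms(2,3)]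
  by linarith

context finite_measure
begin

text \<open>The dimension of this set measures the progress of the induction in
  \<open>fatou_nonatomic\<close>.\<close>

definition convergence_directions :: "(nat \<Rightarrow> 'a \<Rightarrow> 'b::euclidean_space) \<Rightarrow> 'b set" where
  "convergence_directions u = {q. AE s in M. convergent (\<lambda>k. q \<bullet> u k s)}"

lemma subspace_convergence_directions: "subspace (convergence_directions u)"
  unfolding subspace_def convergence_directions_def
proof (intro conjI ballI allI)
  show "0 \<in> {q. AE s in M. convergent (\<lambda>k. q \<bullet> u k s)}" by (simp add: convergent_const)
next
  fix x y
  assume "x \<in> {q. AE s in M. convergent (\<lambda>k. q \<bullet> u k s)}" "y \<in> {q. AE s in M. convergent (\<lambda>k. q \<bullet> u k s)}"
  then have "AE s in M. convergent (\<lambda>k. x \<bullet> u k s)" "AE s in M. convergent (\<lambda>k. y \<bullet> u k s)" by auto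
  then have "AE s in M. convergent (\<lambda>k. (x + y) \<bullet> u k s)"
    by eventually_elim (simp add: inner_add_left convergent_add)
  then show "x + y \<in> {q. AE s in M. convergent (\<lambda>k. q \<bullet> u k s)}" by simp
next
  fix c :: real and x assume "x \<in> {q. AE s in M. convergent (\<lambda>k. q \<bullet> u k s)}"
  then have "AE s in M. convergent (\<lambda>k. x \<bullet> u k s)" by auto
  then have "AE s in M. convergent (\<lambda>k. (c *\<^sub>R x) \<bullet> u k s)"
    by eventually_elim (auto simp: convergent_def intro: tendsto_mult_left)
  then show "c *\<^sub>R x \<in> {q. AE s in M. convergent (\<lambda>k. q \<bullet> u k s)}" by simp
qed

lemma convergence_directions_subseq:
  assumes "strict_mono r"
  shows "convergence_directions u \<subseteq> convergence_directions (\<lambda>k. u (r k))"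
  unfolding convergence_directions_def
proof (rule Collect_mono, rule impI)
  fix q assume "AE s in M. convergent (\<lambda>k. q \<bullet> u k s)"
  then show "AE s in M. convergent (\<lambda>k. q \<bullet> u (r k) s)"
  proof eventually_elim
    case (elim s)
    from convergent_subseq_convergent[OF this assms] show ?case by (simp add: o_def)
  qed
qed

text \<open>The cluster property is only asked almost everywhere, since on an atom the functions are
  constant, and hence convergent along a subsequence, only up to null sets.\<close>

definition cluster_selection :: "(nat \<Rightarrow> 'a \<Rightarrow> 'b::euclidean_space) \<Rightarrow> real \<Rightarrow> ('a \<Rightarrow> 'b) \<Rightarrow> bool" where
  "cluster_selection u K w \<longleftrightarrow> w \<in> borel_measurable M \<and> (\<forall>s\<in>space M. norm (w s) \<le> K) \<and>
     (AE s in M. cluster_point (\<lambda>k. u k s) (w s))"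

lemma cluster_selectionD:
  assumes "cluster_selection u K w"
  shows "w \<in> borel_measurable M" "\<And>s. s \<in> space M \<Longrightarrow> norm (w s) \<le> K"
    "AE s in M. cluster_point (\<lambda>k. u k s) (w s)"
  using assms unfolding cluster_selection_def by auto

lemma cluster_selection_integrable: "cluster_selection u K w \<Longrightarrow> integrable M w"
  unfolding cluster_selection_def by (intro integrable_const_bound[of _ K]) auto

text \<open>Switching from one selection to the other on a measurable set stays among the cluster
  points, and Lyapunov's theorem for their difference finds the set that realizes a given convex
  combination.\<close>

lemma convex_cluster_selection_integrals:
  assumes na: "nonatomic M"
  shows "convex {LINT s|M. w s | w. cluster_selection u K w}"
proof (rule convexI)
  fix x y and a b :: real
  assume "x \<in> {LINT s|M. w s | w. cluster_selection u K w}" "y \<in> {LINT s|M. w s | w. cluster_selection u K w}"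
  then obtain v w where v: "cluster_selection u K v" "x = (LINT s|M. v s)"
    and w: "cluster_selection u K w" "y = (LINT s|M. w s)" by blast
  assume ab: "0 \<le> a" "0 \<le> b" "a + b = 1"
  note [measurable] = cluster_selectionD(1)[OF v(1)]
    cluster_selectionD(1)[OF w(1)]
  note iv = cluster_selection_integrable[OF v(1)] and iw = cluster_selection_integrable[OF w(1)]
  have "norm (v s - w s) \<le> K + K" if "s \<in> space M" for s
    using v(1) w(1) that unfolding cluster_selection_def
    by (intro norm_triangle_le_diff add_mono) auto
  then obtain A where A: "A \<in> sets M"
    "(LINT s:A|M. (v s - w s)) = a *\<^sub>R (LINT s|M. (v s - w s))"
    using nonatomic_convex_split[OF na, of "\<lambda>s. v s - w s" "K + K" a] ab by auto
  define x' where "x' s = (if s \<in> A then v s else w s)" for s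
  have [measurable]: "x' \<in> borel_measurable M" unfolding x'_def
    using A(1) by (intro measurable_If_set) auto
  have "AE s in M. cluster_point (\<lambda>k. u k s) (x' s)"
    using cluster_selectionD(3)[OF v(1)]
      cluster_selectionD(3)[OF w(1)]
    by eventually_elim (auto simp: x'_def)
  then have "cluster_selection u K x'"
    using v(1) w(1) unfolding cluster_selection_def by (auto simp: x'_def)
  moreover have "(LINT s|M. x' s) = a *\<^sub>R x + b *\<^sub>R y"
  proof -
    have "(LINT s|M. x' s) = (LINT s|M. indicat_real A s *\<^sub>R (v s - w s) + w s)"
      by (rule Bochner_Integration.integral_cong) (auto simp: x'_def indicator_def)
    also have "\<dots> = (LINT s:A|M. (v s - w s)) + (LINT s|M. w s)"
      unfolding set_lebesgue_integral_def
      using iv iw A(1) by (intro Bochner_Integration.integral_add integrable_mult_indicator) auto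
    also have "\<dots> = a *\<^sub>R (x - y) + y" using A(2) iv iw v(2) w(2) by simp
    also have "\<dots> = a *\<^sub>R x + (1 - a) *\<^sub>R y" by (simp add: algebra_simps)
    also have "1 - a = b" using ab by simp
    finally show ?thesis .
  qed
  ultimately show "a *\<^sub>R x + b *\<^sub>R y \<in> {LINT s|M. w s | w. cluster_selection u K w}"
    by (metis (mono_tags, lifting) mem_Collect_eq)
qed

text \<open>The positive part of \<open>a k - m\<close> tends to \<open>0\<close> boundedly, so that \<open>a k\<close> tends to \<open>m\<close> in \<open>L\<^sup>1\<close>.\<close>

lemma limsup_attained_subseq:
  fixes a :: "nat \<Rightarrow> 'a \<Rightarrow> real"
  assumes [measurable]: "\<And>k. a k \<in> borel_measurable M" "m \<in> borel_measurable M"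
    and bd: "\<And>k s. s \<in> space M \<Longrightarrow> \<bar>a k s\<bar> \<le> B" "\<And>s. s \<in> space M \<Longrightarrow> \<bar>m s\<bar> \<le> B"
    and ls: "\<And>s. s \<in> space M \<Longrightarrow> limsup (\<lambda>k. ereal (a k s)) = ereal (m s)"
    and lim: "(\<lambda>k. LINT s|M. a k s) \<longlonglongrightarrow> c" "(LINT s|M. m s) \<le> c"
  obtains r :: "nat \<Rightarrow> nat" where "strict_mono r" "AE s in M. (\<lambda>k. a (r k) s) \<longlonglongrightarrow> m s"
proof -
  have ia: "integrable M (a k)" for k by (rule integrable_const_bound[of _ B]) (use bd in auto)
  have im: "integrable M m" by (rule integrable_const_bound[of _ B]) (use bd in auto)
  have ip: "integrable M (\<lambda>s. max 0 (a k s - m s))" for k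
    using ia im by auto
  have pos: "(\<lambda>k. max 0 (a k s - m s)) \<longlonglongrightarrow> 0" if s: "s \<in> space M" for s
  proof (rule tendstoI)
    fix e :: real assume "e > 0"
    then have "limsup (\<lambda>k. ereal (a k s)) < ereal (m s + e)" using ls[OF s] by simp
    then have "\<forall>\<^sub>F k in sequentially. ereal (a k s) < ereal (m s + e)" by (rule Limsup_lessD)
    then show "\<forall>\<^sub>F k in sequentially. dist (max 0 (a k s - m s)) 0 < e"
      by eventually_elim (use \<open>e > 0\<close> in \<open>auto simp: dist_real_def\<close>)
  qed
  have "(\<lambda>k. LINT s|M. max 0 (a k s - m s)) \<longlonglongrightarrow> (LINT s|M. 0)"
  proof (rule integral_dominated_convergence[where w = "\<lambda>_. 2 * \<bar>B\<bar>"])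
    show "AE s in M. (\<lambda>k. max 0 (a k s - m s)) \<longlonglongrightarrow> 0" using pos by auto
    show "AE s in M. norm (max 0 (a k s - m s)) \<le> 2 * \<bar>B\<bar>" for k
    proof (rule AE_I2)
      fix s assume "s \<in> space M"
      from bd(1)[OF this, of k] bd(2)[OF this] show "norm (max 0 (a k s - m s)) \<le> 2 * \<bar>B\<bar>" by auto
    qed
  qed auto
  then have lp: "(\<lambda>k. LINT s|M. max 0 (a k s - m s)) \<longlonglongrightarrow> 0" by simp
  \<comment> \<open>This is \<open>\<bar>x\<bar> = 2 * max 0 x - x\<close> for
    \<open>x = a k s - m s\<close>. Once the positive part is gone, the bound of the integral of
    \<open>m\<close> by \<open>c\<close> forces the distance in the mean to 0.\<close>
  have eq: "(LINT s|M. norm (a k s - m s)) =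
      2 * (LINT s|M. max 0 (a k s - m s)) + (LINT s|M. m s) - (LINT s|M. a k s)" for k
  proof -
    have "(LINT s|M. norm (a k s - m s)) = (LINT s|M. 2 * max 0 (a k s - m s) + m s - a k s)"
      by (rule Bochner_Integration.integral_cong) (auto simp: max_def)
    also have "\<dots> = 2 * (LINT s|M. max 0 (a k s - m s)) + (LINT s|M. m s) - (LINT s|M. a k s)"
      using ip[of k] ia[of k] im by simp
    finally show ?thesis .
  qed
  have "(\<lambda>k. LINT s|M. norm (a k s - m s)) \<longlonglongrightarrow> 0"
  proof (rule tendsto_sandwich[of "\<lambda>_. 0"])
    show "\<forall>\<^sub>F k in sequentially. (LINT s|M. norm (a k s - m s))
        \<le> 2 * (LINT s|M. max 0 (a k s - m s)) + c - (LINT s|M. a k s)"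
      unfolding eq using lim(2) by simp
    have "(\<lambda>k. 2 * (LINT s|M. max 0 (a k s - m s)) + c - (LINT s|M. a k s)) \<longlonglongrightarrow> 2 * 0 + c - c"
      by (intro tendsto_intros lp lim)
    then show "(\<lambda>k. 2 * (LINT s|M. max 0 (a k s - m s)) + c - (LINT s|M. a k s)) \<longlonglongrightarrow> 0" by simp
  qed auto
  then obtain r :: "nat \<Rightarrow> nat" where r: "strict_mono r" "AE s in M. (\<lambda>k. a (r k) s - m s) \<longlonglongrightarrow> 0"
    using tendsto_L1_AE_subseq[of M "\<lambda>k s. a k s - m s"] ia im by auto
  have "AE s in M. (\<lambda>k. a (r k) s) \<longlonglongrightarrow> m s" using r(2) by eventually_elim (simp add: LIM_zero_iff)
  then show ?thesis using r(1) that by blast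
qed

text \<open>Aumann's argument: either the limit of the integrals is the integral of a cluster selection, or it is
  supported by a hyperplane of the convex set of these integrals; then the sequence converges almost everywhere
  in the normal direction, along a subsequence, and the dimension drops.\<close>

lemma fatou_nonatomic:
  fixes u :: "nat \<Rightarrow> 'a \<Rightarrow> 'b::euclidean_space"
  assumes na: "nonatomic M"
  assumes "\<And>k. u k \<in> borel_measurable M" "\<And>k s. s \<in> space M \<Longrightarrow> norm (u k s) \<le> K"
    and "(\<lambda>k. LINT s|M. u k s) \<longlonglongrightarrow> y"
  shows "\<exists>w. cluster_selection u K w \<and> (LINT s|M. w s) = y"
  using assms(2-)
proof (induction "DIM('b) - dim (convergence_directions u)" arbitrary: u rule: less_induct)
  case less
  note [measurable] = less.prems(1)
  note bd = less.prems(2)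
  define I where "I = {LINT s|M. w s | w. cluster_selection u K w}"
  define W where "W = convergence_directions u"
  have W: "subspace W" unfolding W_def by (rule subspace_convergence_directions)
  have iu: "integrable M (u k)" for k by (rule integrable_const_bound[of _ K]) (use bd in auto)
  have bdr: "bounded (range (\<lambda>k. u k s))" if "s \<in> space M" for s
    using bd[OF that] unfolding bounded_iff by auto
  have sel: "\<exists>w. cluster_selection u K w \<and>
      (\<forall>s\<in>space M. ereal (p \<bullet> w s) = limsup (\<lambda>k. ereal (p \<bullet> u k s)))" for p
  proof -
    obtain w where w: "w \<in> borel_measurable M"
      "\<And>s. s \<in> space M \<Longrightarrow> cluster_point (\<lambda>k. u k s) (w s)"
      "\<And>s. s \<in> space M \<Longrightarrow> ereal (p \<bullet> w s) = limsup (\<lambda>k. ereal (p \<bullet> u k s))"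
      using measurable_cluster_selection[of u M p] less.prems(1) bdr by blast
    moreover have "norm (w s) \<le> K" if "s \<in> space M" for s
      by (rule cluster_point_norm_le[OF w(2)[OF that] bd[OF that]])
    ultimately show ?thesis unfolding cluster_selection_def by (intro exI[of _ w]) auto
  qed
  show ?case
  proof (cases "y \<in> I")
    case True
    then show ?thesis unfolding I_def by blast
  next
    case False
    \<comment> \<open>In a direction where the sequence converges, a cluster point has no freedom:
      its component is the limit, and dominated convergence yields the component of \<open>y\<close>
      after integration.\<close>
    have perp: "q \<bullet> z = q \<bullet> y" if q: "q \<in> W" and z: "z \<in> I" for q z
    proof -
      obtain w where w: "cluster_selection u K w" "z = (LINT s|M. w s)" using z unfolding I_def by blast
      note [measurable] = cluster_selectionD(1)[OF w(1)]
      have lim: "AE s in M. (\<lambda>k. q \<bullet> u k s) \<longlonglongrightarrow> q \<bullet> w s"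
        using q[unfolded W_def convergence_directions_def, THEN CollectD]
          cluster_selectionD(3)[OF w(1)]
      proof eventually_elim
        case (elim s)
        obtain r where r: "strict_mono r" "((\<lambda>k. u k s) \<circ> r) \<longlonglongrightarrow> w s"
          using cluster_point_imp_subseq[OF elim(2)] .
        have "(\<lambda>k. q \<bullet> u (r k) s) \<longlonglongrightarrow> q \<bullet> w s" using r(2) by (auto simp: o_def intro!: tendsto_intros)
        moreover obtain l where l: "(\<lambda>k. q \<bullet> u k s) \<longlonglongrightarrow> l" using elim(1) by (auto simp: convergent_def)
        moreover have "(\<lambda>k. q \<bullet> u (r k) s) \<longlonglongrightarrow> l"
          using LIMSEQ_subseq_LIMSEQ[OF l r(1)] by (simp add: o_def)
        ultimately show ?case using LIMSEQ_unique by blast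
      qed
      have "(\<lambda>k. LINT s|M. q \<bullet> u k s) \<longlonglongrightarrow> (LINT s|M. q \<bullet> w s)"
      proof (rule integral_dominated_convergence[where w = "\<lambda>_. norm q * K"])
        show "AE s in M. norm (q \<bullet> u k s) \<le> norm q * K" for k
        proof (rule AE_I2)
          fix s assume "s \<in> space M"
          then show "norm (q \<bullet> u k s) \<le> norm q * K"
            using Cauchy_Schwarz_ineq2[of q "u k s"] mult_left_mono[OF bd[of s k] norm_ge_zero[of q]]
            by simp
        qed
      qed (use lim in auto)
      then have "(\<lambda>k. q \<bullet> (LINT s|M. u k s)) \<longlonglongrightarrow> q \<bullet> z"
        using iu cluster_selection_integrable[OF w(1)] w(2) by simp
      moreover have "(\<lambda>k. q \<bullet> (LINT s|M. u k s)) \<longlonglongrightarrow> q \<bullet> y"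
        by (intro tendsto_intros less.prems(3))
      ultimately show ?thesis by (rule LIMSEQ_unique)
    qed
    \<comment> \<open>Adding \<open>W\<close> to \<open>I\<close> before separating makes the normal
      \<open>p\<close> orthogonal to \<open>W\<close>, so that \<open>p\<close> is a new direction
      of convergence. By \<open>perp\<close>, the point \<open>y\<close> stays outside the enlarged
      set.\<close>
    define T where "T = (\<Union>z\<in>I. \<Union>q\<in>W. {z + q})"
    have "convex I" unfolding I_def by (rule convex_cluster_selection_integrals[OF na])
    then have T: "convex T" unfolding T_def by (intro convex_sums subspace_imp_convex[OF W])
    obtain z0 where z0: "z0 \<in> I" using sel[of 0] unfolding I_def by blast
    then have Tne: "T \<noteq> {}" using subspace_0[OF W] unfolding T_def by blast
    have "y \<notin> T"
    proof
      assume "y \<in> T"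
      then obtain z q where zq: "z \<in> I" "q \<in> W" "y = z + q" unfolding T_def by blast
      then have "q \<bullet> q = 0" using perp[OF zq(2,1)] by (simp add: inner_add_right)
      then show False using zq False by simp
    qed
    then obtain p b where p: "p \<noteq> 0" "\<And>x. x \<in> T \<Longrightarrow> p \<bullet> x \<le> b" "p \<bullet> y \<ge> b"
      using separating_hyperplane_sets[OF T convex_singleton[of y] Tne] by auto
    have sup: "p \<bullet> z + p \<bullet> q \<le> p \<bullet> y" if "z \<in> I" "q \<in> W" for z q
    proof -
      have "z + q \<in> T" using that unfolding T_def by blast
      from p(2)[OF this] p(3) show ?thesis by (simp add: inner_add_right)
    qed
    have pW: "p \<bullet> q = 0" if q: "q \<in> W" for q
    proof (rule ccontr)
      assume ne: "p \<bullet> q \<noteq> 0"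
      \<comment> \<open>Moving from \<open>z0\<close> by this multiple of \<open>q\<close> would
        give the value \<open>p \<bullet> y + 1\<close> in direction \<open>p\<close>, beyond the
        supporting bound.\<close>
      define c where "c = (p \<bullet> y - p \<bullet> z0 + 1) / (p \<bullet> q)"
      have "c *\<^sub>R q \<in> W" using W q by (simp add: subspace_scale)
      from sup[OF z0 this] show False using ne by (simp add: c_def)
    qed
    obtain w where w: "cluster_selection u K w"
      "\<And>s. s \<in> space M \<Longrightarrow> ereal (p \<bullet> w s) = limsup (\<lambda>k. ereal (p \<bullet> u k s))" using sel[of p] by blast
    note [measurable] = cluster_selectionD(1)[OF w(1)]
    have CS: "\<bar>p \<bullet> x\<bar> \<le> norm p * K" if "norm x \<le> K" for x
      using Cauchy_Schwarz_ineq2[of p x] mult_left_mono[OF that norm_ge_zero[of p]] by simp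
    obtain r :: "nat \<Rightarrow> nat" where r: "strict_mono r" "AE s in M. (\<lambda>k. p \<bullet> u (r k) s) \<longlonglongrightarrow> p \<bullet> w s"
    proof (rule limsup_attained_subseq[of "\<lambda>k s. p \<bullet> u k s" "\<lambda>s. p \<bullet> w s" "norm p * K" "p \<bullet> y"])
      show "\<bar>p \<bullet> u k s\<bar> \<le> norm p * K" if "s \<in> space M" for k s by (rule CS[OF bd[OF that]])
      show "\<bar>p \<bullet> w s\<bar> \<le> norm p * K" if "s \<in> space M" for s
        using CS w(1) that unfolding cluster_selection_def by blast
      have "(\<lambda>k. p \<bullet> (LINT s|M. u k s)) \<longlonglongrightarrow> p \<bullet> y" by (intro tendsto_intros less.prems(3))
      then show "(\<lambda>k. LINT s|M. p \<bullet> u k s) \<longlonglongrightarrow> p \<bullet> y" using iu by simp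
      have "(LINT s|M. w s) \<in> I" using w(1) unfolding I_def by blast
      from sup[OF this subspace_0[OF W]]
      show "(LINT s|M. p \<bullet> w s) \<le> p \<bullet> y" using cluster_selection_integrable[OF w(1)] by simp
    qed (use w(2) in auto)
    define W' where "W' = convergence_directions (\<lambda>k. u (r k))"
    have "W \<subseteq> W'" unfolding W_def W'_def by (rule convergence_directions_subseq[OF r(1)])
    moreover have "p \<in> W'" using r(2) unfolding W'_def convergence_directions_def convergent_def by auto
    moreover have "p \<notin> W" using pW[of p] p(1) by auto
    ultimately have "W \<subset> W'" by blast
    then have "dim W < dim W'"
      using W subspace_convergence_directions[of "\<lambda>k. u (r k)"] unfolding W'_def
      by (intro dim_psubset) (metis span_eq_iff)
    moreover have "dim W' \<le> DIM('b)" by (rule dim_subset_UNIV)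
    ultimately have "DIM('b) - dim W' < DIM('b) - dim W" by linarith
    moreover have "(\<lambda>k. LINT s|M. u (r k) s) \<longlonglongrightarrow> y"
      using LIMSEQ_subseq_LIMSEQ[OF less.prems(3) r(1)] by (simp add: o_def)
    ultimately obtain v where v: "cluster_selection (\<lambda>k. u (r k)) K v" "(LINT s|M. v s) = y"
      using less.hyps[of "\<lambda>k. u (r k)"] less.prems(1) bd unfolding W_def W'_def by blast
    have "AE s in M. cluster_point (\<lambda>k. u k s) (v s)"
      using cluster_selectionD(3)[OF v(1)]
      by eventually_elim (rule cluster_point_subseq[OF _ r(1)], simp add: o_def)
    then have "cluster_selection u K v" using v(1) unfolding cluster_selection_def by blast
    then show ?thesis using v(2) by blast
  qed
qed

end

section \<open>Atoms, and bounded sequences over an arbitrary finite measure\<close>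

context finite_measure
begin

definition atom :: "'a set \<Rightarrow> bool" where
  "atom A \<longleftrightarrow> A \<in> sets M \<and> 0 < measure M A \<and>
     (\<forall>B\<in>sets M. B \<subseteq> A \<longrightarrow> measure M B = 0 \<or> measure M B = measure M A)"

text \<open>Countable unions of atoms are closed under countable unions, so one of them has the
  largest measure; an atom in its complement would enlarge it. Empty members allow for finitely many
  atoms or none.\<close>

lemma nonatomic_part:
  obtains A :: "nat \<Rightarrow> 'a set" where "\<And>j. atom (A j) \<or> A j = {}"
    "nonatomic (restrict_space M (space M - (\<Union>j. A j)))"
proof -
  define \<U> where "\<U> = {(\<Union>j::nat. A j) | A. \<forall>j. atom (A j) \<or> A j = {}}"
  have \<U>_sets: "U \<in> sets M" if "U \<in> \<U>" for U
  proof -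
    from that obtain A where A: "U = (\<Union>j::nat. A j)" "\<forall>j. atom (A j) \<or> A j = {}" unfolding \<U>_def by (elim CollectE exE conjE)
    have "A j \<in> sets M" for j using A(2) unfolding atom_def by (metis sets.empty_sets)
    then show ?thesis unfolding A(1) by auto
  qed
  have \<U>_UN: "(\<Union>n::nat. U n) \<in> \<U>" if U: "\<And>n. U n \<in> \<U>" for U
  proof -
    from U have "\<forall>n. \<exists>A. U n = (\<Union>j::nat. A j) \<and> (\<forall>j. atom (A j) \<or> A j = {})" unfolding \<U>_def by blast
    from choice[OF this] obtain A :: "nat \<Rightarrow> nat \<Rightarrow> 'a set" where "\<forall>n. U n = (\<Union>j. A n j) \<and> (\<forall>j. atom (A n j) \<or> A n j = {})" ..
    then have A: "\<And>n. U n = (\<Union>j. A n j)" "\<And>n j. atom (A n j) \<or> A n j = {}" by blast+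
    have "(\<Union>n. U n) = (\<Union>i. case_prod A (prod_decode i))"
    proof -
      have "(\<Union>n. U n) = (\<Union>p. case_prod A p)" using A(1) by auto
      also have "\<dots> = (\<Union>i. case_prod A (prod_decode i))"
        by (metis (no_types, lifting) SUP_cong image_image surj_prod_decode)
      finally show ?thesis .
    qed
    moreover have "atom (case_prod A (prod_decode i)) \<or> case_prod A (prod_decode i) = {}" for i
      using A(2) by (cases "prod_decode i") auto
    ultimately show ?thesis unfolding \<U>_def by blast
  qed
  define c where "c = (SUP U\<in>\<U>. measure M U)"
  have bdd: "bdd_above (measure M ` \<U>)"
    by (rule bdd_aboveI[of _ "measure M (space M)"]) (auto intro: bounded_measure)
  have "{} \<in> \<U>" unfolding \<U>_def by (auto intro!: exI[of _ "\<lambda>_. {}"])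
  then have ne: "\<U> \<noteq> {}" by blast
  have "\<exists>U\<in>\<U>. c - 1 / real (Suc n) < measure M U" for n
  proof -
    have "c - 1 / real (Suc n) < c" by simp
    then show ?thesis unfolding c_def by (subst (asm) less_cSUP_iff[OF ne bdd]) auto
  qed
  then obtain U where U: "\<And>n. U n \<in> \<U>" "\<And>n. c - 1 / real (Suc n) < measure M (U n)" by metis
  define A0 where "A0 = (\<Union>n. U n)"
  have A0: "A0 \<in> \<U>" unfolding A0_def by (rule \<U>_UN[OF U(1)])
  then have A0s[measurable]: "A0 \<in> sets M" by (rule \<U>_sets)
  have "c \<le> measure M A0"
  proof (rule LIMSEQ_le_const2)
    have "(\<lambda>n. c - 1 / real (Suc n)) \<longlonglongrightarrow> c - 0"
      by (intro tendsto_diff tendsto_const lim_1_over_n[THEN LIMSEQ_Suc])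
    then show "(\<lambda>n. c - 1 / real (Suc n)) \<longlonglongrightarrow> c" by simp
    have "c - 1 / real (Suc n) \<le> measure M A0" for n
    proof -
      have "measure M (U n) \<le> measure M A0"
        by (rule finite_measure_mono) (auto simp: A0_def intro: A0s[unfolded A0_def])
      then show ?thesis using U(2)[of n] by linarith
    qed
    then show "\<exists>N. \<forall>n\<ge>N. c - 1 / real (Suc n) \<le> measure M A0" by blast
  qed
  obtain A where A: "A0 = (\<Union>j::nat. A j)" "\<And>j. atom (A j) \<or> A j = {}" using A0 unfolding \<U>_def by blast
  have "nonatomic (restrict_space M (space M - A0))"
    unfolding nonatomic_def
  proof (intro ballI impI, rule ccontr)
    fix E assume E: "E \<in> sets (restrict_space M (space M - A0))"
      and pos: "0 < measure (restrict_space M (space M - A0)) E"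
      and no: "\<not> (\<exists>B\<in>sets (restrict_space M (space M - A0)). B \<subseteq> E \<and>
        0 < measure (restrict_space M (space M - A0)) B \<and>
        measure (restrict_space M (space M - A0)) B < measure (restrict_space M (space M - A0)) E)"
    have Om: "(space M - A0) \<inter> space M \<in> sets M" by auto
    have E': "E \<in> sets M" "E \<subseteq> space M - A0" using E by (auto simp: sets_restrict_space_iff[OF Om])
    have ms: "measure (restrict_space M (space M - A0)) B = measure M B" if "B \<subseteq> E" for B
      using that E' by (intro measure_restrict_space[OF Om]) auto
    have "atom E" unfolding atom_def
    proof (intro conjI ballI impI)
      show "0 < measure M E" using pos ms[of E] by simp
      fix B assume B: "B \<in> sets M" "B \<subseteq> E"
      then have "B \<in> sets (restrict_space M (space M - A0))"
        using E' by (auto simp: sets_restrict_space_iff[OF Om])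
      then have "\<not> (0 < measure M B \<and> measure M B < measure M E)" using no ms B by force
      moreover have "measure M B \<le> measure M E" using B E' by (intro finite_measure_mono) auto
      ultimately show "measure M B = 0 \<or> measure M B = measure M E"
        using measure_nonneg[of M B] by linarith
    qed (rule E')
    then have "E \<in> \<U>" unfolding \<U>_def by (auto intro!: exI[of _ "\<lambda>_. E"])
    then have "(\<Union>n::nat. if n = 0 then A0 else E) \<in> \<U>" using A0 by (intro \<U>_UN) auto
    moreover have "(\<Union>n::nat. if n = 0 then A0 else E) = A0 \<union> E" by (auto split: if_splits)
    ultimately have "A0 \<union> E \<in> \<U>" by simp
    then have "measure M (A0 \<union> E) \<le> c" unfolding c_def by (rule cSUP_upper[OF _ bdd])
    moreover have "measure M (A0 \<union> E) = measure M A0 + measure M E"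
      using E' by (intro finite_measure_Union) auto
    ultimately show False using \<open>c \<le> measure M A0\<close> pos ms[of E] by simp
  qed
  then show ?thesis using A that by blast
qed

text \<open>The part of the atom where \<open>h\<close> exceeds its mean is null or has full measure
  in it. Either way, the mean minus \<open>h\<close> has one sign almost everywhere on the atom, and
  its integral is zero.\<close>

lemma atom_AE_const_real:
  fixes h :: "'a \<Rightarrow> real"
  assumes A: "atom A" and h: "integrable M h"
  shows "AE s in M. s \<in> A \<longrightarrow> h s = (LINT s:A|M. h s) / measure M A"
proof -
  define c where "c = (LINT s:A|M. h s) / measure M A"
  have As[measurable]: "A \<in> sets M" and pos: "0 < measure M A" using A unfolding atom_def by auto
  have [measurable]: "h \<in> borel_measurable M" using h by auto
  have ind: "integrable M (\<lambda>s. indicat_real A s *\<^sub>R h s)" by (rule integrable_mult_indicator[OF As h])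
  have i1: "integrable M (\<lambda>s. indicat_real A s *\<^sub>R (c - h s))"
    by (rule integrable_mult_indicator[OF As]) (use h in auto)
  have "(LINT s|M. indicat_real A s *\<^sub>R (c - h s)) =
      (LINT s|M. indicat_real A s * c - indicat_real A s *\<^sub>R h s)"
    by (rule Bochner_Integration.integral_cong) (auto simp: right_diff_distrib)
  also have "\<dots> = measure M A * c - (LINT s:A|M. h s)"
    using ind integrable_real_indicator[OF As] unfolding set_lebesgue_integral_def
    by (subst Bochner_Integration.integral_diff) (auto simp: emeasure_eq_measure)
  also have "\<dots> = 0" using pos by (simp add: c_def)
  finally have z: "(LINT s|M. indicat_real A s *\<^sub>R (c - h s)) = 0" .
  let ?B = "{s\<in>A. c < h s}"
  have B: "?B \<in> sets M" "?B \<subseteq> A"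
  proof -
    have "?B = A \<inter> {s\<in>space M. c < h s}" using sets.sets_into_space[OF As] by auto
    also have "\<dots> \<in> sets M" by measurable
    finally show "?B \<in> sets M" .
  qed auto
  have "AE s in M. indicat_real A s *\<^sub>R (c - h s) = 0"
  proof (cases "measure M ?B = 0")
    case True
    then have "?B \<in> null_sets M" using B by (intro null_setsI) (auto simp: emeasure_eq_measure)
    then have "AE s in M. 0 \<le> indicat_real A s *\<^sub>R (c - h s)"
      by (rule AE_I') (auto simp: indicator_def split: if_splits)
    then show ?thesis using integral_nonneg_eq_0_iff_AE[OF i1] z by simp
  next
    case False
    then have "measure M ?B = measure M A" using A B unfolding atom_def by blast
    then have "measure M (A - ?B) = 0" using B by (simp add: finite_measure_Diff)
    then have "A - ?B \<in> null_sets M" using B As by (intro null_setsI) (auto simp: emeasure_eq_measure)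
    then have nn: "AE s in M. 0 \<le> - (indicat_real A s *\<^sub>R (c - h s))"
      by (rule AE_I') (auto simp: indicator_def split: if_splits)
    have "integrable M (\<lambda>s. - (indicat_real A s *\<^sub>R (c - h s)))" using i1 by (rule integrable_minus)
    from integral_nonneg_eq_0_iff_AE[OF this nn] z show ?thesis by simp
  qed
  then show ?thesis by eventually_elim (auto simp: c_def)
qed

lemma atom_AE_const:
  fixes h :: "'a \<Rightarrow> 'b::euclidean_space"
  assumes A: "atom A" and h: "integrable M h"
  shows "AE s in M. s \<in> A \<longrightarrow> h s = (1 / measure M A) *\<^sub>R (LINT s:A|M. h s)"
proof -
  have "A \<in> sets M" using A unfolding atom_def by auto
  then have ind: "integrable M (\<lambda>s. indicat_real A s *\<^sub>R h s)" by (rule integrable_mult_indicator[OF _ h])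
  have "AE s in M. \<forall>b\<in>Basis. s \<in> A \<longrightarrow> h s \<bullet> b = ((1 / measure M A) *\<^sub>R (LINT s:A|M. h s)) \<bullet> b"
  proof (rule AE_finite_allI[OF finite_Basis])
    fix b :: 'b
    have "(LINT s:A|M. h s \<bullet> b) = (LINT s:A|M. h s) \<bullet> b"
      using integral_inner_left[OF ind, of b] unfolding set_lebesgue_integral_def by simp
    moreover have "integrable M (\<lambda>s. h s \<bullet> b)" using h by auto
    ultimately show "AE s in M. s \<in> A \<longrightarrow> h s \<bullet> b = ((1 / measure M A) *\<^sub>R (LINT s:A|M. h s)) \<bullet> b"
      using atom_AE_const_real[OF A, of "\<lambda>s. h s \<bullet> b"] by simp
  qed
  then show ?thesis by eventually_elim (auto intro: euclidean_eqI)
qed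

text \<open>Each \<open>u k\<close> is almost everywhere constant on each atom, so a diagonal
  subsequence of these bounded constants converges on all countably many atoms at once. What the
  limit leaves of \<open>y\<close> is the limit of the integrals over the nonatomic
  remainder.\<close>

lemma fatou_bounded:
  fixes u :: "nat \<Rightarrow> 'a \<Rightarrow> 'b::euclidean_space"
  assumes um[measurable]: "\<And>k. u k \<in> borel_measurable M"
    and bd: "\<And>k s. s \<in> space M \<Longrightarrow> norm (u k s) \<le> K"
    and lim: "(\<lambda>k. LINT s|M. u k s) \<longlonglongrightarrow> y"
  shows "\<exists>w. cluster_selection u K w \<and> (LINT s|M. w s) = y"
proof -
  have iu: "integrable M (u k)" for k by (rule integrable_const_bound[of _ K]) (use bd in auto)
  obtain A :: "nat \<Rightarrow> 'a set" where A: "\<And>j. atom (A j) \<or> A j = {}"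
    and na: "nonatomic (restrict_space M (space M - (\<Union>j. A j)))" by (rule nonatomic_part) blast
  define A0 where "A0 = (\<Union>j. A j)"
  have As: "A j \<in> sets M" for j using A[of j] unfolding atom_def by auto
  then have A0[measurable]: "A0 \<in> sets M" unfolding A0_def by auto
  define c where "c k j = (1 / measure M (A j)) *\<^sub>R (LINT s:A j|M. u k s)" for k j
  have cb: "norm (c k j) \<le> \<bar>K\<bar>" for k j
  proof (cases "measure M (A j) = 0")
    case False
    have "norm (LINT s:A j|M. u k s) \<le> (LINT s|M. indicat_real (A j) s * \<bar>K\<bar>)"
      unfolding set_lebesgue_integral_def
    proof (rule norm_integral_le_integral)
      fix s assume "s \<in> space M"
      from bd[OF this, of k] show "norm (indicat_real (A j) s *\<^sub>R u k s) \<le> indicat_real (A j) s * \<bar>K\<bar>"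
        by (auto simp: indicator_def)
    qed (use As iu integrable_real_indicator[OF As] in
        \<open>auto simp: emeasure_eq_measure intro!: integrable_mult_indicator\<close>)
    also have "\<dots> = measure M (A j) * \<bar>K\<bar>" using As by simp
    finally show ?thesis using False unfolding c_def
      by (simp add: field_simps zero_less_measure_iff)
  qed (simp add: c_def)
  obtain r :: "nat \<Rightarrow> nat" where r: "strict_mono r" and cr: "\<And>j. \<exists>l. (\<lambda>k. c (r k) j) \<longlonglongrightarrow> l"
    using function_convergent_subsequence[of "UNIV :: nat set" c "\<bar>K\<bar>"] cb by auto
  define L where "L s = lim (\<lambda>k. u (r k) s)" for s
  have [measurable]: "L \<in> borel_measurable M" unfolding L_def by measurable
  have "AE s in M. \<forall>j k. s \<in> A j \<longrightarrow> u k s = c k j"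
    unfolding AE_all_countable
  proof (intro allI)
    fix j k
    show "AE s in M. s \<in> A j \<longrightarrow> u k s = c k j"
      using A[of j] atom_AE_const[OF _ iu, of "A j" k] unfolding c_def by auto
  qed
  then have convA: "AE s in M. s \<in> A0 \<longrightarrow> (\<lambda>k. u (r k) s) \<longlonglongrightarrow> L s"
  proof eventually_elim
    case (elim s)
    show ?case
    proof
      assume "s \<in> A0"
      then obtain j where "s \<in> A j" unfolding A0_def by blast
      then have "(\<lambda>k. u (r k) s) = (\<lambda>k. c (r k) j)" using elim by auto
      then have "convergent (\<lambda>k. u (r k) s)" using cr[of j] by (simp add: convergent_def)
      then show "(\<lambda>k. u (r k) s) \<longlonglongrightarrow> L s" unfolding L_def by (simp add: convergent_LIMSEQ_iff)
    qed
  qed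
  define B where "B = space M - A0"
  have Bs[measurable]: "B \<in> sets M" unfolding B_def by auto
  have BO: "B \<inter> space M \<in> sets M" by auto
  define N where "N = restrict_space M B"
  interpret N: finite_measure N unfolding N_def by (rule finite_measure_restrict_space[OF finite_measure_axioms Bs])
  have spN: "space N = B" unfolding N_def space_restrict_space by (auto simp: B_def)
  have limA: "(\<lambda>k. LINT s|M. indicat_real A0 s *\<^sub>R u (r k) s) \<longlonglongrightarrow> (LINT s|M. indicat_real A0 s *\<^sub>R L s)"
    and iL: "integrable M (\<lambda>s. indicat_real A0 s *\<^sub>R L s)"
  proof -
    have 1: "AE s in M. (\<lambda>k. indicat_real A0 s *\<^sub>R u (r k) s) \<longlonglongrightarrow> indicat_real A0 s *\<^sub>R L s"
      using convA by eventually_elim (auto simp: indicator_def)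
    have 2: "AE s in M. norm (indicat_real A0 s *\<^sub>R u (r k) s) \<le> \<bar>K\<bar>" for k
    proof (rule AE_I2)
      fix s assume "s \<in> space M"
      from bd[OF this, of "r k"] show "norm (indicat_real A0 s *\<^sub>R u (r k) s) \<le> \<bar>K\<bar>"
        by (auto simp: indicator_def)
    qed
    show "(\<lambda>k. LINT s|M. indicat_real A0 s *\<^sub>R u (r k) s) \<longlonglongrightarrow> (LINT s|M. indicat_real A0 s *\<^sub>R L s)"
      by (rule integral_dominated_convergence[where w = "\<lambda>_. \<bar>K\<bar>", OF _ _ _ 1 2]) auto
    show "integrable M (\<lambda>s. indicat_real A0 s *\<^sub>R L s)"
      by (rule integrable_dominated_convergence[where w = "\<lambda>_. \<bar>K\<bar>", OF _ _ _ 1 2]) auto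
  qed
  define y' where "y' = y - (LINT s|M. indicat_real A0 s *\<^sub>R L s)"
  have "(\<lambda>k. LINT s|N. u (r k) s) \<longlonglongrightarrow> y'"
  proof -
    have "(LINT s|N. u (r k) s) = (LINT s|M. u (r k) s) - (LINT s|M. indicat_real A0 s *\<^sub>R u (r k) s)" for k
    proof -
      have "(LINT s|N. u (r k) s) = (LINT s|M. indicat_real B s *\<^sub>R u (r k) s)"
        unfolding N_def by (rule integral_restrict_space[OF BO])
      also have "\<dots> = (LINT s|M. u (r k) s - indicat_real A0 s *\<^sub>R u (r k) s)"
        by (rule Bochner_Integration.integral_cong) (auto simp: B_def indicator_def)
      also have "\<dots> = (LINT s|M. u (r k) s) - (LINT s|M. indicat_real A0 s *\<^sub>R u (r k) s)"
        using iu A0 by (intro Bochner_Integration.integral_diff integrable_mult_indicator) auto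
      finally show ?thesis .
    qed
    moreover have "(\<lambda>k. LINT s|M. u (r k) s) \<longlonglongrightarrow> y"
      using LIMSEQ_subseq_LIMSEQ[OF lim r] by (simp add: o_def)
    ultimately show ?thesis unfolding y'_def using limA by (auto intro: tendsto_diff)
  qed
  then obtain v where v: "N.cluster_selection (\<lambda>k. u (r k)) K v" "(LINT s|N. v s) = y'"
    using N.fatou_nonatomic[of "\<lambda>k. u (r k)" K y'] na bd
    by (auto simp: N_def B_def A0_def space_restrict_space measurable_restrict_space1)
  \<comment> \<open>Where the subsequence diverges, \<open>L s\<close> is an arbitrary value;
    \<open>u 0 s\<close> replaces it whenever it would violate the bound, which must hold
    everywhere.\<close>
  define w where "w s = (if s \<in> B then v s else if norm (L s) \<le> K then L s else u 0 s)" for s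
  have vm: "v \<in> borel_measurable (restrict_space M B)"
    using v(1)[unfolded N.cluster_selection_def] by (simp add: N_def)
  have vB: "(\<lambda>s. indicat_real B s *\<^sub>R v s) \<in> borel_measurable M"
    using vm by (subst (asm) borel_measurable_restrict_space_iff[OF BO])
  have [measurable]: "w \<in> borel_measurable M"
  proof -
    have "(\<lambda>s. if s \<in> B then indicat_real B s *\<^sub>R v s else if norm (L s) \<le> K then L s else u 0 s) \<in> borel_measurable M"
      using vB by measurable
    also have "(\<lambda>s. if s \<in> B then indicat_real B s *\<^sub>R v s else if norm (L s) \<le> K then L s else u 0 s) = w"
      by (auto simp: w_def)
    finally show ?thesis .
  qed
  have wb: "norm (w s) \<le> K" if "s \<in> space M" for s
    using v(1) bd[OF that] spN unfolding N.cluster_selection_def w_def by auto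
  have LK: "AE s in M. s \<in> A0 \<longrightarrow> norm (L s) \<le> K"
    using convA
  proof (rule AE_mp, intro AE_I2 impI)
    fix s assume s: "s \<in> space M" and c: "s \<in> A0 \<longrightarrow> (\<lambda>k. u (r k) s) \<longlonglongrightarrow> L s" and "s \<in> A0"
    then show "norm (L s) \<le> K"
      using bd[OF s] by (intro Lim_bounded[where M = 0, OF tendsto_norm]) auto
  qed
  have clN: "AE s in M. s \<in> B \<longrightarrow> cluster_point (\<lambda>k. u (r k) s) (v s)"
    using v(1)[unfolded N.cluster_selection_def] unfolding N_def by (simp add: AE_restrict_space_iff[OF BO])
  have "AE s in M. cluster_point (\<lambda>k. u k s) (w s)"
    using clN convA LK AE_space
  proof eventually_elim
    case (elim s)
    show ?case
    proof (cases "s \<in> A0")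
      case True
      then have "w s = L s" using elim by (auto simp: w_def B_def)
      then have "cluster_point ((\<lambda>k. u k s) \<circ> r) (w s)"
        using elim True by (simp add: cluster_point_LIMSEQ o_def)
      then show ?thesis by (rule cluster_point_subseq[OF _ r])
    next
      case False
      then have "cluster_point ((\<lambda>k. u k s) \<circ> r) (w s)" using elim by (simp add: w_def B_def o_def)
      then show ?thesis by (rule cluster_point_subseq[OF _ r])
    qed
  qed
  then have "cluster_selection u K w" using wb unfolding cluster_selection_def by auto
  moreover have "(LINT s|M. w s) = y"
  proof -
    have iv: "integrable M (\<lambda>s. indicat_real B s *\<^sub>R v s)"
      by (rule integrable_const_bound[of _ "\<bar>K\<bar>"])
         (use v(1) vB spN in \<open>auto simp: N.cluster_selection_def indicator_def intro!: AE_I2 intro: order_trans\<close>)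
    have "(LINT s|M. w s) = (LINT s|M. indicat_real B s *\<^sub>R v s + indicat_real A0 s *\<^sub>R L s)"
    proof (rule integral_cong_AE)
      show "AE s in M. w s = indicat_real B s *\<^sub>R v s + indicat_real A0 s *\<^sub>R L s"
        using LK AE_space by eventually_elim (auto simp: w_def B_def)
    qed (use vB in measurable)
    also have "\<dots> = (LINT s|M. indicat_real B s *\<^sub>R v s) + (LINT s|M. indicat_real A0 s *\<^sub>R L s)"
      using iv iL by simp
    also have "(LINT s|M. indicat_real B s *\<^sub>R v s) = y'"
      using v(2) unfolding N_def by (simp add: integral_restrict_space[OF BO])
    finally show ?thesis by (simp add: y'_def)
  qed
  ultimately show ?thesis by blast
qed

end

lemma finite_measure_density_integrable:
  assumes "integrable M \<kappa>" "\<And>s. s \<in> space M \<Longrightarrow> 0 \<le> \<kappa> s"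
  shows "finite_measure (density M (\<lambda>s. ennreal (\<kappa> s)))"
proof (rule finite_measureI)
  have "emeasure (density M (\<lambda>s. ennreal (\<kappa> s))) (space M) = (\<integral>\<^sup>+s. ennreal (\<kappa> s) \<partial>M)"
    using assms(1) by (simp add: emeasure_density cong: nn_integral_cong)
  also have "\<dots> < \<infinity>" using assms by (subst nn_integral_eq_integral) auto
  finally show "emeasure (density M (\<lambda>s. ennreal (\<kappa> s))) (space (density M (\<lambda>s. ennreal (\<kappa> s)))) \<noteq> \<infinity>" by simp
qed

text \<open>With respect to the finite measure \<open>density M \<kappa>\<close>, the functions \<open>v k / \<kappa>\<close> are bounded by \<open>1\<close>.\<close>

lemma fatou_dominated:
  fixes v :: "nat \<Rightarrow> 's \<Rightarrow> 'b::euclidean_space"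
  assumes \<kappa>: "integrable M \<kappa>" "\<And>s. s \<in> space M \<Longrightarrow> 0 \<le> \<kappa> s"
    and vm: "\<And>k. v k \<in> borel_measurable M"
    and bd: "\<And>k s. s \<in> space M \<Longrightarrow> norm (v k s) \<le> \<kappa> s"
    and lim: "(\<lambda>k. LINT s|M. v k s) \<longlonglongrightarrow> y"
  obtains w where "integrable M w" "AE s in M. cluster_point (\<lambda>k. v k s) (w s)" "(LINT s|M. w s) = y"
proof -
  have km[measurable]: "\<kappa> \<in> borel_measurable M" using \<kappa> by auto
  note [measurable] = vm
  define N where "N = density M (\<lambda>s. ennreal (\<kappa> s))"
  interpret N: finite_measure N unfolding N_def by (rule finite_measure_density_integrable[OF \<kappa>])
  define u where "u k s = (1 / \<kappa> s) *\<^sub>R v k s" for k s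
  \<comment> \<open>If \<open>\<kappa> s = 0\<close>, domination gives \<open>v k s = 0\<close>, so
    the division by zero in \<open>u\<close> does no harm.\<close>
  have ku: "\<kappa> s *\<^sub>R u k s = v k s" if "s \<in> space M" for k s
    using bd[OF that, of k] by (auto simp: u_def)
  have um: "u k \<in> borel_measurable N" for k unfolding u_def N_def by measurable
  have dens: "(LINT s|N. h s) = (LINT s|M. \<kappa> s *\<^sub>R h s)" if "h \<in> borel_measurable M" for h :: "'s \<Rightarrow> 'b"
    unfolding N_def using that \<kappa> by (intro integral_density) auto
  have iuv: "(LINT s|N. u k s) = (LINT s|M. v k s)" for k
  proof -
    have "(LINT s|N. u k s) = (LINT s|M. \<kappa> s *\<^sub>R u k s)"
      using um[of k] by (intro dens) (simp add: N_def)
    also have "\<dots> = (LINT s|M. v k s)" by (rule Bochner_Integration.integral_cong) (auto simp: ku)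
    finally show ?thesis .
  qed
  have ub: "norm (u k s) \<le> 1" if "s \<in> space N" for k s
    using bd[of s k] \<kappa>(2)[of s] that by (auto simp: u_def N_def divide_simps)
  obtain w where w: "N.cluster_selection u 1 w" "(LINT s|N. w s) = y"
    using N.fatou_bounded[where u = u and K = 1 and y = y, OF um ub] lim unfolding iuv by blast
  have wm[measurable]: "w \<in> borel_measurable M" using w(1)[unfolded N.cluster_selection_def] by (simp add: N_def)
  have clw: "AE s in M. 0 < \<kappa> s \<longrightarrow> cluster_point (\<lambda>k. u k s) (w s)"
    using w(1)[unfolded N.cluster_selection_def] unfolding N_def by (simp add: AE_density)
  have "AE s in M. cluster_point (\<lambda>k. v k s) (\<kappa> s *\<^sub>R w s)"
    using clw AE_space
  proof eventually_elim
    case (elim s)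
    obtain r where r: "strict_mono r" "(\<lambda>k. \<kappa> s *\<^sub>R u (r k) s) \<longlonglongrightarrow> \<kappa> s *\<^sub>R w s"
    proof (cases "0 < \<kappa> s")
      case True
      then obtain r where "strict_mono r" "((\<lambda>k. u k s) \<circ> r) \<longlonglongrightarrow> w s"
        using cluster_point_imp_subseq elim(1) by metis
      then show ?thesis by (intro that[of r] tendsto_scaleR tendsto_const) (auto simp: o_def)
    next
      case False
      then have "\<kappa> s = 0" using \<kappa>(2)[OF elim(2)] by simp
      then show ?thesis by (intro that[of id]) (auto simp: strict_mono_id)
    qed
    then have "cluster_point ((\<lambda>k. v k s) \<circ> r) (\<kappa> s *\<^sub>R w s)"
      by (simp add: cluster_point_LIMSEQ o_def ku[OF elim(2)])
    then show ?case by (rule cluster_point_subseq[OF _ r(1)])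
  qed
  moreover have "integrable M (\<lambda>s. \<kappa> s *\<^sub>R w s)"
  proof (rule Bochner_Integration.integrable_bound[OF \<kappa>(1)])
    show "AE s in M. norm (\<kappa> s *\<^sub>R w s) \<le> norm (\<kappa> s)"
      using w(1)[unfolded N.cluster_selection_def] \<kappa>(2)
      by (intro AE_I2) (auto simp: N_def intro: mult_left_le)
  qed auto
  moreover have "(LINT s|M. \<kappa> s *\<^sub>R w s) = y" using dens[OF wm] w(2) by simp
  ultimately show ?thesis by (intro that[of "\<lambda>s. \<kappa> s *\<^sub>R w s"])
qed

section \<open>Differentiability of monotone functions and of absolutely continuous curves\<close>

text \<open>Letting \<open>t\<close> lie anywhere in the interval produces a family suited to the
  Vitali covering theorem; ordinary difference quotients are the case of \<open>t\<close> as an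
  endpoint.\<close>

definition steep_above :: "(real \<Rightarrow> real) \<Rightarrow> real \<Rightarrow> real set" where
  "steep_above F v = {t. \<forall>\<delta>>0. \<exists>c d. c \<le> t \<and> t \<le> d \<and> c < d \<and> d - c < \<delta> \<and> v * (d - c) < F d - F c}"

definition steep_below :: "(real \<Rightarrow> real) \<Rightarrow> real \<Rightarrow> real set" where
  "steep_below F u = {t. \<forall>\<delta>>0. \<exists>c d. c \<le> t \<and> t \<le> d \<and> c < d \<and> d - c < \<delta> \<and> F d - F c < u * (d - c)}"

lemma vitali_intervals:
  fixes S U :: "real set"
  assumes "open U" "S \<subseteq> U"
    and fine: "\<And>t \<delta>. t \<in> S \<Longrightarrow> 0 < \<delta> \<Longrightarrow> \<exists>c d. c \<le> t \<and> t \<le> d \<and> c < d \<and> d - c < \<delta> \<and> P c d"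
  obtains C where "countable C" "\<And>c d. (c, d) \<in> C \<Longrightarrow> c < d \<and> P c d \<and> {c..d} \<subseteq> U"
    "disjoint_family_on (\<lambda>(c, d). {c..d}) C" "negligible (S - (\<Union>(c, d)\<in>C. {c..d}))"
proof -
  define K where "K = {(c, d). c < d \<and> P c d \<and> {c..d} \<subseteq> U}"
  define a where "a = (\<lambda>(c::real, d). (c + d) / 2)"
  define r where "r = (\<lambda>(c::real, d). (d - c) / 2)"
  have cb: "cball (a i) (r i) = (case i of (c, d) \<Rightarrow> {c..d})" for i
    by (cases i) (auto simp: a_def r_def cball_eq_atLeastAtMost field_simps)
  obtain C where C: "countable C" "C \<subseteq> K"
    "pairwise (\<lambda>i j. disjnt (cball (a i) (r i)) (cball (a j) (r j))) C"
    "negligible (S - (\<Union>i\<in>C. cball (a i) (r i)))"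
  proof (rule Vitali_covering_theorem_cballs[of K r S a])
    show "0 < r i" if "i \<in> K" for i using that by (auto simp: K_def r_def)
    fix t e assume t: "t \<in> S" "0 < (e::real)"
    then obtain \<epsilon> where \<epsilon>: "\<epsilon> > 0" "ball t \<epsilon> \<subseteq> U" using assms(1,2) by (meson openE subsetD)
    obtain c d where cd: "c \<le> t" "t \<le> d" "c < d" "d - c < min e \<epsilon>" "P c d"
      using fine[OF t(1), of "min e \<epsilon>"] \<epsilon> t by auto
    have "{c..d} \<subseteq> ball t \<epsilon>" using cd by (auto simp: dist_real_def)
    then have "(c, d) \<in> K" using cd \<epsilon> by (auto simp: K_def)
    then show "\<exists>i. i \<in> K \<and> t \<in> cball (a i) (r i) \<and> r i < e"
      unfolding cb using cd by (intro exI[of _ "(c, d)"]) (auto simp: r_def)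
  qed
  show ?thesis
  proof
    show "disjoint_family_on (\<lambda>(c, d). {c..d}) C"
      using C(3) by (auto simp: cb disjoint_family_on_def pairwise_def disjnt_def)
    show "negligible (S - (\<Union>(c, d)\<in>C. {c..d}))" using C(4) by (simp add: cb)
    show "c < d \<and> P c d \<and> {c..d} \<subseteq> U" if "(c, d) \<in> C" for c d using that C(2) by (auto simp: K_def)
  qed (rule C(1))
qed

lemma emeasure_lebesgue_borel: "S \<in> sets borel \<Longrightarrow> emeasure lebesgue S = emeasure lborel S"
  by simp

lemma emeasure_disjoint_intervals_le:
  fixes C :: "(real \<times> real) set"
  assumes C: "countable C" "disjoint_family_on (\<lambda>(c, d). {c..d}) C"
    and sets: "sets \<mu> = sets borel" "sets \<nu> = sets borel"
    and le: "\<And>c d. (c, d) \<in> C \<Longrightarrow> k * emeasure \<mu> {c..d} \<le> l * emeasure \<nu> {c..d}"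
  shows "k * emeasure \<mu> (\<Union>(c, d)\<in>C. {c..d}) \<le> l * emeasure \<nu> (\<Union>(c, d)\<in>C. {c..d})"
proof -
  have *: "k * emeasure \<mu> (\<Union>(c, d)\<in>C. {c..d})
      = (\<integral>\<^sup>+i. k * emeasure \<mu> (case i of (c, d) \<Rightarrow> {c..d}) \<partial>count_space C)"
    if "sets \<mu> = sets borel" for \<mu> and k :: ennreal
    by (subst emeasure_UN_countable[OF _ C]) (auto simp: that nn_integral_cmult)
  show ?thesis unfolding *[OF sets(1)] *[OF sets(2)]
    by (rule nn_integral_mono) (use le in auto)
qed

section \<open>Lebesgue's differentiation theorem for monotone continuous functions\<close>

context
  fixes F :: "real \<Rightarrow> real"
  assumes mono: "\<And>x y. x \<le> y \<Longrightarrow> F x \<le> F y" and cont: "continuous_on UNIV F"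
begin

lemma interval_measure_Icc: "c < d \<Longrightarrow> emeasure (interval_measure F) {c..d} = ennreal (F d - F c)"
  by (simp add: emeasure_interval_measure_Icc[OF _ mono cont])

text \<open>Growth over countably many disjoint intervals adds up because it is the Stieltjes
  measure of \<open>F\<close>; continuity makes endpoints weightless.\<close>

lemma interval_measure_ge_lborel:
  assumes "countable C" "disjoint_family_on (\<lambda>(c, d). {c..d}) C" and v: "0 \<le> v"
    and ge: "\<And>c d. (c, d) \<in> C \<Longrightarrow> c < d \<and> v * (d - c) \<le> F d - F c"
  shows "ennreal v * emeasure lborel (\<Union>(c, d)\<in>C. {c..d}) \<le> emeasure (interval_measure F) (\<Union>(c, d)\<in>C. {c..d})"
proof -
  have "ennreal v * emeasure lborel {c..d} \<le> 1 * emeasure (interval_measure F) {c..d}" if "(c, d) \<in> C" for c d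
    using ge[OF that] v by (simp add: interval_measure_Icc ennreal_mult[symmetric] ennreal_leI)
  from emeasure_disjoint_intervals_le[OF assms(1,2) _ _ this] show ?thesis by simp
qed

lemma interval_measure_le_lborel:
  assumes "countable C" "disjoint_family_on (\<lambda>(c, d). {c..d}) C" and v: "0 \<le> v"
    and le: "\<And>c d. (c, d) \<in> C \<Longrightarrow> c < d \<and> F d - F c \<le> v * (d - c)"
  shows "emeasure (interval_measure F) (\<Union>(c, d)\<in>C. {c..d}) \<le> ennreal v * emeasure lborel (\<Union>(c, d)\<in>C. {c..d})"
proof -
  have "1 * emeasure (interval_measure F) {c..d} \<le> ennreal v * emeasure lborel {c..d}" if "(c, d) \<in> C" for c d
    using le[OF that] v by (simp add: interval_measure_Icc ennreal_mult[symmetric] ennreal_leI)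
  from emeasure_disjoint_intervals_le[OF assms(1,2) _ _ this] show ?thesis by simp
qed

text \<open>Vitali twice: \<open>F\<close> grows by at most \<open>u\<close> times the length on a first family of intervals, and by at least
  \<open>v\<close> times the length on a second family nested in the first.\<close>

lemma steep_cover_shrinks:
  assumes uv: "0 \<le> u" "u < v" and T: "T \<in> lmeasurable" "steep_above F v \<inter> steep_below F u \<inter> {a<..<b} \<subseteq> T"
    and e: "0 < (e::real)"
  shows "\<exists>T'\<in>lmeasurable. steep_above F v \<inter> steep_below F u \<inter> {a<..<b} \<subseteq> T' \<and>
    v * measure lebesgue T' \<le> u * (measure lebesgue T + e)"
proof -
  define E where "E = steep_above F v \<inter> steep_below F u \<inter> {a<..<b}"
  obtain U where U: "open U" "T \<subseteq> U" "U - T \<in> lmeasurable" "emeasure lebesgue (U - T) < ennreal e"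
    using sets_lebesgue_outer_open[of T e] T(1) e by (auto simp: fmeasurable_def)
  have mU: "emeasure lborel U \<le> ennreal (measure lebesgue T + e)"
  proof -
    have "emeasure lborel U = emeasure lebesgue U" using U(1) by (intro emeasure_lebesgue_borel[symmetric]) auto
    also have "\<dots> = emeasure lebesgue (T \<union> (U - T))" using U(2) by (simp only: Un_Diff_cancel Un_absorb1)
    also have "emeasure lebesgue (T \<union> (U - T)) \<le> emeasure lebesgue T + emeasure lebesgue (U - T)"
      by (rule emeasure_subadditive) (rule fmeasurableD[OF T(1)], rule fmeasurableD[OF U(3)])
    also have "\<dots> \<le> ennreal (measure lebesgue T) + ennreal e"
      by (rule add_mono) (simp_all only: emeasure_eq_measure2[OF T(1)] order_refl less_imp_le[OF U(4)])
    also have "\<dots> = ennreal (measure lebesgue T + e)" using e by (simp add: ennreal_plus)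
    finally show ?thesis .
  qed
  obtain C1 where C1: "countable C1"
    "\<And>c d. (c, d) \<in> C1 \<Longrightarrow> c < d \<and> F d - F c < u * (d - c) \<and> {c..d} \<subseteq> U"
    "disjoint_family_on (\<lambda>(c, d). {c..d}) C1" "negligible (E - (\<Union>(c, d)\<in>C1. {c..d}))"
  proof (rule vitali_intervals[of U E "\<lambda>c d. F d - F c < u * (d - c)"])
    show "E \<subseteq> U" using T(2) U(2) by (auto simp: E_def)
  qed (use U(1) in \<open>auto simp: E_def steep_below_def\<close>)
  define W1 where "W1 = (\<Union>(c, d)\<in>C1. {c..d})"
  \<comment> \<open>The second covering has to stay inside an open set, so the closed intervals give
    way to their interiors; this loses only countably many endpoints.\<close>
  define G where "G = (\<Union>(c, d)\<in>C1. {c<..<d})"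
  have "open G" unfolding G_def by (intro open_UN) auto
  obtain C2 where C2: "countable C2"
    "\<And>c d. (c, d) \<in> C2 \<Longrightarrow> c < d \<and> v * (d - c) < F d - F c \<and> {c..d} \<subseteq> G"
    "disjoint_family_on (\<lambda>(c, d). {c..d}) C2" "negligible ((E \<inter> G) - (\<Union>(c, d)\<in>C2. {c..d}))"
    by (rule vitali_intervals[of G "E \<inter> G" "\<lambda>c d. v * (d - c) < F d - F c"])
       (use \<open>open G\<close> in \<open>auto simp: E_def steep_above_def\<close>)
  define W2 where "W2 = (\<Union>(c, d)\<in>C2. {c..d})"
  have W1s: "W1 \<in> sets borel" unfolding W1_def using C1(1) by (intro sets.countable_UN') auto
  have W2s: "W2 \<in> sets borel" unfolding W2_def using C2(1) by (intro sets.countable_UN') auto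
  have GW: "G \<subseteq> W1" unfolding G_def W1_def by (intro UN_mono) auto
  have "W2 \<subseteq> G" unfolding W2_def using C2(2) by (intro UN_least) auto
  then have W21: "W2 \<subseteq> W1" using GW by (rule order_trans)
  have W1U: "W1 \<subseteq> U" unfolding W1_def using C1(2) by (intro UN_least) auto
  have "ennreal v * emeasure lborel W2 \<le> emeasure (interval_measure F) W2"
    unfolding W2_def using uv C2(2) by (intro interval_measure_ge_lborel[OF C2(1,3)]) (auto intro: less_imp_le)
  also have "\<dots> \<le> emeasure (interval_measure F) W1" using W21 W1s by (intro emeasure_mono) auto
  also have "\<dots> \<le> ennreal u * emeasure lborel W1"
    unfolding W1_def using uv C1(2) by (intro interval_measure_le_lborel[OF C1(1,3)]) (auto intro: less_imp_le)
  also have "\<dots> \<le> ennreal u * emeasure lborel U"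
    using W1U U(1) by (intro mult_left_mono emeasure_mono) auto
  also have "\<dots> \<le> ennreal u * ennreal (measure lebesgue T + e)" using mU by (intro mult_left_mono) auto
  also have "\<dots> = ennreal (u * (measure lebesgue T + e))" using uv e by (intro ennreal_mult[symmetric]) auto
  finally have key: "ennreal v * emeasure lborel W2 \<le> ennreal (u * (measure lebesgue T + e))" .
  \<comment> \<open>Everything missed by the two coverings and by the passage to interiors; adding
    it restores the inclusion at no cost in measure.\<close>
  define Z where "Z = (E - W1) \<union> ((E \<inter> G) - W2) \<union> (W1 - G)"
  have "W1 - G \<subseteq> fst ` C1 \<union> snd ` C1"
  proof
    fix x assume "x \<in> W1 - G"
    then obtain c d where cd: "(c, d) \<in> C1" "c \<le> x" "x \<le> d" "x \<notin> G" unfolding W1_def by auto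
    then have "\<not> (c < x \<and> x < d)" unfolding G_def by auto
    then have "x = c \<or> x = d" using cd by auto
    then show "x \<in> fst ` C1 \<union> snd ` C1" using cd(1) by (metis UnI1 UnI2 fst_conv image_eqI snd_conv)
  qed
  then have "countable (W1 - G)" using C1(1) by (meson countable_Un countable_image countable_subset)
  then have "negligible (W1 - G)"
    by (simp add: negligible_iff_null_sets null_sets_completionI countable_imp_null_set_lborel)
  then have nZ: "negligible Z"
    unfolding Z_def using C1(4) C2(4) by (intro negligible_Un) (auto simp: W1_def W2_def)
  have fin: "emeasure lborel W2 < \<infinity>"
  proof -
    have "emeasure lborel W2 \<le> emeasure lborel U"
      using W1U W21 U(1) by (intro emeasure_mono) auto
    then show ?thesis using mU by (metis ennreal_less_top infinity_ennreal_def le_less_trans)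
  qed
  have W2l: "W2 \<in> lmeasurable"
    using W2s fin by (intro fmeasurableI) (simp_all only: emeasure_lebesgue_borel sets_completionI_sets sets_lborel)
  have T': "W2 \<union> Z \<in> lmeasurable" by (rule fmeasurable.Un[OF W2l negligible_imp_measurable[OF nZ]])
  have mT': "measure lebesgue (W2 \<union> Z) = measure lebesgue W2"
    by (rule measure_Un_null_set[OF fmeasurableD[OF W2l]]) (use nZ in \<open>simp only: negligible_iff_null_sets\<close>)
  have "emeasure lborel W2 = ennreal (measure lebesgue W2)"
    by (simp only: emeasure_eq_measure2[OF W2l, symmetric] emeasure_lebesgue_borel[OF W2s])
  then have "ennreal (v * measure lebesgue W2) \<le> ennreal (u * (measure lebesgue T + e))"
    using key uv by (simp add: ennreal_mult)
  then have "v * measure lebesgue W2 \<le> u * (measure lebesgue T + e)"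
    using uv e by (subst (asm) ennreal_le_iff) auto
  moreover have "E \<subseteq> W2 \<union> Z" by (auto simp: Z_def)
  ultimately show ?thesis using T' mT' unfolding E_def by (intro bexI[of _ "W2 \<union> Z"]) auto
qed

text \<open>\<open>Inf X\<close> is the outer measure, finite because of the bounded interval.
  Shrinking near-optimal covers by \<open>steep_cover_shrinks\<close> gives
  \<open>v * Inf X \<le> u * Inf X\<close>, impossible for a positive value.\<close>

lemma negligible_steep_above_below:
  assumes uv: "0 \<le> u" "u < v"
  shows "negligible (steep_above F v \<inter> steep_below F u \<inter> {a<..<b})"
proof -
  define E where "E = steep_above F v \<inter> steep_below F u \<inter> {a<..<b}"
  define X where "X = measure lebesgue ` {T \<in> lmeasurable. E \<subseteq> T}"
  have ne: "X \<noteq> {}" unfolding X_def E_def using lmeasurable_box[of a b] by (auto simp: box_real)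
  have bdd: "bdd_below X" unfolding X_def by (rule bdd_belowI[of _ 0]) auto
  have le: "v * Inf X \<le> u * (x + e)" if "x \<in> X" "e > 0" for x e
  proof -
    obtain T where T: "T \<in> lmeasurable" "E \<subseteq> T" "x = measure lebesgue T" using \<open>x \<in> X\<close> by (auto simp: X_def)
    obtain T' where T': "T' \<in> lmeasurable" "E \<subseteq> T'" "v * measure lebesgue T' \<le> u * (x + e)"
      using steep_cover_shrinks[OF uv T(1) _ \<open>e > 0\<close>, of a b] T unfolding E_def by blast
    then have "Inf X \<le> measure lebesgue T'" by (intro cInf_lower bdd) (auto simp: X_def)
    then have "v * Inf X \<le> v * measure lebesgue T'" using uv by (intro mult_left_mono) auto
    then show ?thesis using T'(3) by linarith
  qed
  have *: "v * Inf X \<le> u * x" if "x \<in> X" for x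
  proof -
    have "v * Inf X \<le> u * x + e" if "e > 0" for e
    proof (cases "u = 0")
      case True
      then show ?thesis using le[OF \<open>x \<in> X\<close> that] that by simp
    next
      case False
      then show ?thesis using le[OF \<open>x \<in> X\<close>, of "e / u"] that uv
        by (simp add: distrib_left)
    qed
    then show ?thesis by (rule field_le_epsilon)
  qed
  have "Inf X \<le> 0"
  proof (rule ccontr)
    assume "\<not> Inf X \<le> 0"
    then have pos: "0 < Inf X" by simp
    show False
    proof (cases "u = 0")
      case True
      obtain x where "x \<in> X" using ne by blast
      from *[OF this] True mult_pos_pos[OF _ pos, of v] uv show False by simp
    next
      case False
      then have "v * Inf X / u \<le> x" if "x \<in> X" for x using *[OF that] uv by (simp add: divide_le_eq mult.commute)
      then have "v * Inf X / u \<le> Inf X" by (intro cInf_greatest ne)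
      then have "v * Inf X \<le> u * Inf X" using False uv by (simp add: divide_le_eq mult.commute)
      then show False using uv pos by simp
    qed
  qed
  then have "\<exists>T\<in>lmeasurable. E \<subseteq> T \<and> measure lebesgue T \<le> e" if "e > 0" for e
  proof -
    have "Inf X < e" using \<open>Inf X \<le> 0\<close> that by simp
    then obtain x where "x \<in> X" "x < e" using cInf_less_iff[OF ne bdd] by blast
    then show ?thesis unfolding X_def using less_imp_le by blast
  qed
  then show ?thesis unfolding E_def[symmetric] negligible_outer_le by blast
qed

text \<open>Disjoint intervals of slope above \<open>n\<close> inside \<open>{a<..<b}\<close> have
  total length at most \<open>(F b - F a) / n\<close>.\<close>

lemma negligible_steep_above_all: "negligible ((\<Inter>n::nat. steep_above F n) \<inter> {a<..<b})"
proof (cases "a < b")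
  case ab: True
  define E where "E = (\<Inter>n::nat. steep_above F n) \<inter> {a<..<b}"
  show ?thesis unfolding E_def[symmetric] negligible_outer_le
  proof (intro allI impI)
    fix e :: real assume e: "e > 0"
    obtain n :: nat where n: "(F b - F a) / e < n" using reals_Archimedean2 by blast
    have n0: "0 < real n" using n mono[of a b] ab e by (smt (verit) divide_nonneg_pos)
    obtain C where C: "countable C"
      "\<And>c d. (c, d) \<in> C \<Longrightarrow> c < d \<and> real n * (d - c) < F d - F c \<and> {c..d} \<subseteq> {a<..<b}"
      "disjoint_family_on (\<lambda>(c, d). {c..d}) C" "negligible (E - (\<Union>(c, d)\<in>C. {c..d}))"
      by (rule vitali_intervals[of "{a<..<b}" E "\<lambda>c d. real n * (d - c) < F d - F c"])
         (auto simp: E_def steep_above_def)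
    define W where "W = (\<Union>(c, d)\<in>C. {c..d})"
    have Ws: "W \<in> sets borel" unfolding W_def using C(1) by (intro sets.countable_UN') auto
    have Wab: "W \<subseteq> {a..b}" unfolding W_def using C(2) by (intro UN_least) fastforce
    have "ennreal (real n) * emeasure lborel W \<le> emeasure (interval_measure F) W"
      unfolding W_def using C(2) by (intro interval_measure_ge_lborel[OF C(1,3)]) (auto intro: less_imp_le)
    also have "\<dots> \<le> emeasure (interval_measure F) {a..b}" using Wab by (intro emeasure_mono) auto
    also have "\<dots> = ennreal (F b - F a)" using ab by (intro emeasure_interval_measure_Icc mono cont) auto
    finally have key: "ennreal (real n) * emeasure lborel W \<le> ennreal (F b - F a)" .
    have Wl: "W \<in> lmeasurable"
      by (rule fmeasurableI2[of "{a..b}"]) (use Ws Wab in \<open>auto simp: sets_completionI_sets\<close>)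
    have "emeasure lborel W = ennreal (measure lebesgue W)"
      by (simp only: emeasure_eq_measure2[OF Wl, symmetric] emeasure_lebesgue_borel[OF Ws])
    then have "ennreal (real n * measure lebesgue W) \<le> ennreal (F b - F a)"
      using key by (simp add: ennreal_mult)
    then have "real n * measure lebesgue W \<le> F b - F a"
      using mono[of a b] ab by (subst (asm) ennreal_le_iff) auto
    also have "\<dots> \<le> real n * e" using n e by (simp add: divide_less_eq)
    finally have "measure lebesgue W \<le> e" using n0 by simp
    moreover have nZ: "negligible (E - W)" using C(4) by (simp add: W_def)
    moreover have "measure lebesgue (W \<union> (E - W)) = measure lebesgue W"
      by (rule measure_Un_null_set[OF fmeasurableD[OF Wl]]) (use nZ in \<open>simp only: negligible_iff_null_sets\<close>)
    moreover have "W \<union> (E - W) \<in> lmeasurable"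
      by (rule fmeasurable.Un[OF Wl negligible_imp_measurable[OF nZ]])
    ultimately show "\<exists>T. E \<subseteq> T \<and> T \<in> lmeasurable \<and> measure lebesgue T \<le> e"
      by (intro exI[of _ "W \<union> (E - W)"]) auto
  qed
qed simp

text \<open>The derivative is the supremum \<open>L\<close> of the slopes exceeded on arbitrarily
  short intervals around \<open>t\<close>. If slopes lower than \<open>L\<close> by a fixed margin
  recurred, two rationals in the gap would put \<open>t\<close> in an excluded set; they are
  rational because only countably many such sets can be discarded.\<close>

lemma differentiable_if_not_steep:
  assumes bd: "t \<notin> (\<Inter>n::nat. steep_above F n)"
    and sq: "\<And>u v. u \<in> \<rat> \<Longrightarrow> v \<in> \<rat> \<Longrightarrow> 0 \<le> u \<Longrightarrow> u < v \<Longrightarrow> t \<notin> steep_above F v \<inter> steep_below F u"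
  shows "\<exists>L. (F has_real_derivative L) (at t)"
proof -
  have anti: "t \<in> steep_above F v" if w: "t \<in> steep_above F w" "v \<le> w" for v w
    unfolding steep_above_def
  proof (intro CollectI allI impI)
    fix \<delta> :: real assume "\<delta> > 0"
    then obtain c d where "c \<le> t" "t \<le> d" "c < d" "d - c < \<delta>" "w * (d - c) < F d - F c"
      using w(1) unfolding steep_above_def by blast
    moreover from this have "v * (d - c) \<le> w * (d - c)" using w(2) by (intro mult_right_mono) auto
    ultimately show "\<exists>c d. c \<le> t \<and> t \<le> d \<and> c < d \<and> d - c < \<delta> \<and> v * (d - c) < F d - F c"
      by (intro exI[of _ c] exI[of _ d]) linarith
  qed
  obtain n :: nat where n: "t \<notin> steep_above F n" using bd by blast
  \<comment> \<open>The element 0 guards against the supremum of an empty set and is harmless, as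
    slopes of \<open>F\<close> are nonnegative.\<close>
  define S where "S = insert 0 {v. 0 \<le> v \<and> t \<in> steep_above F v}"
  have bddS: "bdd_above S"
  proof (rule bdd_aboveI)
    fix v assume "v \<in> S"
    then show "v \<le> real n" using n anti[of v "real n"] by (cases "v \<le> real n") (auto simp: S_def dest: anti[of _ "real n"])
  qed
  define L where "L = Sup S"
  have L0: "0 \<le> L" unfolding L_def by (rule cSup_upper[OF _ bddS]) (simp add: S_def)
  have up: "\<exists>\<delta>>0. \<forall>c d. c \<le> t \<and> t \<le> d \<and> c < d \<and> d - c < \<delta> \<longrightarrow> F d - F c \<le> (L + \<epsilon>) * (d - c)" if "\<epsilon> > 0" for \<epsilon>
  proof -
    have "L + \<epsilon> \<notin> S" using cSup_upper[OF _ bddS, of "L + \<epsilon>"] that unfolding L_def by auto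
    then have "t \<notin> steep_above F (L + \<epsilon>)" using L0 that by (auto simp: S_def)
    then obtain \<delta> where "\<delta> > 0" "\<not> (\<exists>c d. c \<le> t \<and> t \<le> d \<and> c < d \<and> d - c < \<delta> \<and> (L + \<epsilon>) * (d - c) < F d - F c)"
      unfolding steep_above_def by blast
    then show ?thesis by (intro exI[of _ \<delta>]) (meson not_less)
  qed
  have lo: "\<exists>\<delta>>0. \<forall>c d. c \<le> t \<and> t \<le> d \<and> c < d \<and> d - c < \<delta> \<longrightarrow> (L - \<epsilon>) * (d - c) \<le> F d - F c" if "\<epsilon> > 0" for \<epsilon>
  proof (cases "L - \<epsilon> < 0")
    case True
    then have "(L - \<epsilon>) * (d - c) \<le> F d - F c" if "c < d" for c d
      using that mono[of c d] by (smt (verit) mult_neg_pos)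
    then show ?thesis by (intro exI[of _ 1]) auto
  next
    case False
    have "S \<noteq> {}" by (simp add: S_def)
    moreover have "L - \<epsilon> < Sup S" using that by (simp add: L_def)
    ultimately obtain v where v: "v \<in> S" "L - \<epsilon> < v" using less_cSup_iff[OF _ bddS] by blast
    obtain w where w: "w \<in> \<rat>" "L - \<epsilon> < w" "w < v" using Rats_dense_in_real[OF v(2)] by blast
    obtain u where u: "u \<in> \<rat>" "L - \<epsilon> < u" "u < w" using Rats_dense_in_real[OF w(2)] by blast
    have "t \<in> steep_above F v" using v w u False by (auto simp: S_def)
    then have "t \<in> steep_above F w" by (rule anti) (use w in auto)
    then have "t \<notin> steep_below F u" using sq[OF u(1) w(1)] u False by auto
    then obtain \<delta> where \<delta>: "\<delta> > 0" "\<not> (\<exists>c d. c \<le> t \<and> t \<le> d \<and> c < d \<and> d - c < \<delta> \<and> F d - F c < u * (d - c))"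
      unfolding steep_below_def by blast
    have "(L - \<epsilon>) * (d - c) \<le> F d - F c" if "c \<le> t" "t \<le> d" "c < d" "d - c < \<delta>" for c d
    proof -
      have "(L - \<epsilon>) * (d - c) \<le> u * (d - c)" using u that by (intro mult_right_mono) auto
      moreover have "u * (d - c) \<le> F d - F c" using \<delta>(2) that by (meson not_less)
      ultimately show ?thesis by linarith
    qed
    then show ?thesis using \<delta>(1) by blast
  qed
  have "((\<lambda>y. (F y - F t) / (y - t)) \<longlongrightarrow> L) (at t)"
  proof (rule tendstoI)
    fix \<epsilon>' :: real assume e': "\<epsilon>' > 0"
    define \<epsilon> where "\<epsilon> = \<epsilon>' / 2"
    have e: "\<epsilon> > 0" "\<epsilon> < \<epsilon>'" using e' by (auto simp: \<epsilon>_def)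
    obtain \<delta>1 where \<delta>1: "\<delta>1 > 0" "\<And>c d. c \<le> t \<Longrightarrow> t \<le> d \<Longrightarrow> c < d \<Longrightarrow> d - c < \<delta>1 \<Longrightarrow> F d - F c \<le> (L + \<epsilon>) * (d - c)"
      using up[OF e(1)] by blast
    obtain \<delta>2 where \<delta>2: "\<delta>2 > 0" "\<And>c d. c \<le> t \<Longrightarrow> t \<le> d \<Longrightarrow> c < d \<Longrightarrow> d - c < \<delta>2 \<Longrightarrow> (L - \<epsilon>) * (d - c) \<le> F d - F c"
      using lo[OF e(1)] by blast
    have "dist ((F y - F t) / (y - t)) L < \<epsilon>'" if y: "y \<noteq> t" "dist y t < min \<delta>1 \<delta>2" for y
    proof (cases "t < y")
      case True
      then have "(F y - F t) / (y - t) \<le> L + \<epsilon>" "L - \<epsilon> \<le> (F y - F t) / (y - t)"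
        using \<delta>1(2)[of t y] \<delta>2(2)[of t y] y by (auto simp: dist_real_def divide_le_eq le_divide_eq)
      then show ?thesis using e by (auto simp: dist_real_def)
    next
      case False
      then have "(F t - F y) / (t - y) \<le> L + \<epsilon>" "L - \<epsilon> \<le> (F t - F y) / (t - y)"
        using \<delta>1(2)[of y t] \<delta>2(2)[of y t] y by (auto simp: dist_real_def divide_le_eq le_divide_eq)
      moreover have "(F t - F y) / (t - y) = (F y - F t) / (y - t)" by (metis minus_diff_eq minus_divide_divide)
      ultimately show ?thesis using e by (auto simp: dist_real_def)
    qed
    then show "\<forall>\<^sub>F y in at t. dist ((F y - F t) / (y - t)) L < \<epsilon>'"
      unfolding eventually_at using \<delta>1(1) \<delta>2(1) by (intro exI[of _ "min \<delta>1 \<delta>2"]) auto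
  qed
  then show ?thesis unfolding has_field_derivative_iff by blast
qed

theorem mono_continuous_differentiable_ae:
  "negligible {t \<in> {a<..<b}. \<not> (\<exists>L. (F has_real_derivative L) (at t))}"
proof (rule negligible_subset)
  let ?P = "{(u, v). u \<in> \<rat> \<and> v \<in> \<rat> \<and> 0 \<le> u \<and> u < (v::real)}"
  have "countable (\<rat> \<times> \<rat> :: (real \<times> real) set)" by (intro countable_SIGMA countable_rat)
  then have "countable ?P" by (rule countable_subset[rotated]) auto
  then have "negligible (\<Union>(u, v)\<in>?P. steep_above F v \<inter> steep_below F u \<inter> {a<..<b})"
    by (intro negligible_countable_Union[OF countable_image]) (auto intro: negligible_steep_above_below)
  then show "negligible ((\<Union>(u, v)\<in>?P. steep_above F v \<inter> steep_below F u \<inter> {a<..<b}) \<union>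
      ((\<Inter>n::nat. steep_above F n) \<inter> {a<..<b}))"
    by (intro negligible_Un negligible_steep_above_all)
  show "{t \<in> {a<..<b}. \<not> (\<exists>L. (F has_real_derivative L) (at t))} \<subseteq>
      (\<Union>(u, v)\<in>?P. steep_above F v \<inter> steep_below F u \<inter> {a<..<b}) \<union> ((\<Inter>n::nat. steep_above F n) \<inter> {a<..<b})"
  proof
    fix t assume t: "t \<in> {t \<in> {a<..<b}. \<not> (\<exists>L. (F has_real_derivative L) (at t))}"
    show "t \<in> (\<Union>(u, v)\<in>?P. steep_above F v \<inter> steep_below F u \<inter> {a<..<b}) \<union> ((\<Inter>n::nat. steep_above F n) \<inter> {a<..<b})"
    proof (rule ccontr)
      assume n: "\<not> ?thesis"
      have "\<exists>L. (F has_real_derivative L) (at t)"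
        by (rule differentiable_if_not_steep) (use n t in auto)
      then show False using t by blast
    qed
  qed
qed

end

section \<open>Total variation of absolutely continuous curves\<close>

definition interval_family :: "real \<Rightarrow> real \<Rightarrow> nat \<Rightarrow> (nat \<Rightarrow> real) \<Rightarrow> (nat \<Rightarrow> real) \<Rightarrow> bool" where
  "interval_family s t n a b \<longleftrightarrow> (\<forall>i<n. s \<le> a i \<and> a i \<le> b i \<and> b i \<le> t) \<and>
     disjoint_family_on (\<lambda>i. {a i<..<b i}) {..<n}"

text \<open>Disjoint families instead of ordered partitions match the definition of absolute
  continuity literally and need no sorting.\<close>

definition variation_sums :: "(real \<Rightarrow> 'a::real_normed_vector) \<Rightarrow> real \<Rightarrow> real \<Rightarrow> real set" where
  "variation_sums \<gamma> s t = {\<Sum>i<n. norm (\<gamma> (b i) - \<gamma> (a i)) | n a b. interval_family s t n a b}"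

lemma variation_sumsI:
  "interval_family s t n a b \<Longrightarrow> (\<Sum>i<n. norm (\<gamma> (b i) - \<gamma> (a i))) \<in> variation_sums \<gamma> s t"
  unfolding variation_sums_def by blast

text \<open>Disjoint subintervals of \<open>{s..t}\<close> have total length at most
  \<open>t - s\<close>, by additivity of Lebesgue measure, so a short \<open>{s..t}\<close> meets
  the length condition for every family.\<close>

lemma absolutely_continuous_curve_variation:
  assumes "absolutely_continuous_curve \<gamma>" "0 < \<epsilon>"
  obtains \<delta> where "0 < \<delta>"
    "\<And>s t x. 0 \<le> s \<Longrightarrow> s \<le> t \<Longrightarrow> t \<le> 1 \<Longrightarrow> t - s < \<delta> \<Longrightarrow> x \<in> variation_sums \<gamma> s t \<Longrightarrow> x < \<epsilon>"
proof -
  have "\<exists>\<delta>>0. \<forall>n a b. interval_family 0 1 n a b \<and> (\<Sum>i<n. b i - a i) < \<delta> \<longrightarrow>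
      (\<Sum>i<n. norm (\<gamma> (b i) - \<gamma> (a i))) < \<epsilon>"
    using assms(1)[unfolded absolutely_continuous_curve_def, THEN spec, THEN mp, OF assms(2)]
    unfolding interval_family_def conj_assoc .
  then obtain \<delta> where \<delta>: "\<delta> > 0" "\<And>n a b. interval_family 0 1 n a b \<Longrightarrow> (\<Sum>i<n. b i - a i) < \<delta> \<Longrightarrow>
      (\<Sum>i<n. norm (\<gamma> (b i) - \<gamma> (a i))) < \<epsilon>"
    by blast
  show ?thesis
  proof (rule that[OF \<delta>(1)])
    fix s t x assume st: "0 \<le> s" "s \<le> t" "t \<le> 1" "t - s < \<delta>" and "x \<in> variation_sums \<gamma> s t"
    then obtain n a b where x: "x = (\<Sum>i<n. norm (\<gamma> (b i) - \<gamma> (a i)))" and f: "interval_family s t n a b"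
      unfolding variation_sums_def by blast
    have "(\<Sum>i<n. b i - a i) = (\<Sum>i<n. measure lborel {a i<..<b i})"
      using f by (intro sum.cong) (auto simp: interval_family_def)
    also have "\<dots> = measure lborel (\<Union>i<n. {a i<..<b i})"
      using f by (intro measure_finite_Union[symmetric]) (auto simp: interval_family_def)
    also have "\<dots> \<le> measure lborel {s..t}"
    proof (rule measure_mono_fmeasurable)
      show "(\<Union>i<n. {a i<..<b i}) \<subseteq> {s..t}" using f by (fastforce simp: interval_family_def)
      show "{s..t} \<in> fmeasurable lborel" using fmeasurable_cbox[of s t] by simp
    qed auto
    also have "\<dots> = t - s" using st by simp
    finally have "(\<Sum>i<n. b i - a i) < \<delta>" using st by simp
    moreover have "interval_family 0 1 n a b" using f st unfolding interval_family_def by fastforce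
    ultimately show "x < \<epsilon>" unfolding x by (intro \<delta>(2))
  qed
qed

text \<open>Clipping all endpoints at \<open>s\<close> keeps the index set: an interval on the wrong
  side degenerates and contributes 0, and one across \<open>s\<close> is split by the triangle
  inequality.\<close>

lemma variation_sums_split:
  assumes "x \<in> variation_sums \<gamma> r t" "r \<le> s" "s \<le> t"
  obtains y z where "y \<in> variation_sums \<gamma> r s" "z \<in> variation_sums \<gamma> s t" "x \<le> y + z"
proof -
  obtain n a b where x: "x = (\<Sum>i<n. norm (\<gamma> (b i) - \<gamma> (a i)))" and f: "interval_family r t n a b"
    using assms(1) unfolding variation_sums_def by blast
  have ab: "r \<le> a i" "a i \<le> b i" "b i \<le> t" if "i < n" for i using f that unfolding interval_family_def by auto
  have disj: "{a i<..<b i} \<inter> {a j<..<b j} = {}" if "i < n" "j < n" "i \<noteq> j" for i j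
    using f that unfolding interval_family_def disjoint_family_on_def by auto
  define y where "y = (\<Sum>i<n. norm (\<gamma> (min (b i) s) - \<gamma> (min (a i) s)))"
  define z where "z = (\<Sum>i<n. norm (\<gamma> (max (b i) s) - \<gamma> (max (a i) s)))"
  have "interval_family r s n (\<lambda>i. min (a i) s) (\<lambda>i. min (b i) s)"
    unfolding interval_family_def disjoint_family_on_def
  proof (intro conjI allI impI ballI)
    fix i j assume ij: "i \<in> {..<n}" "j \<in> {..<n}" "i \<noteq> j"
    have "{min (a k) s<..<min (b k) s} \<subseteq> {a k<..<b k}" for k by auto
    then show "{min (a i) s<..<min (b i) s} \<inter> {min (a j) s<..<min (b j) s} = {}"
      using disj[of i j] ij by blast
  next
    fix i assume "i < n"
    from ab[OF this] show "r \<le> min (a i) s" "min (a i) s \<le> min (b i) s" "min (b i) s \<le> s"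
      using assms(2,3) by linarith+
  qed
  from variation_sumsI[OF this, of \<gamma>] have "y \<in> variation_sums \<gamma> r s" unfolding y_def .
  moreover have "interval_family s t n (\<lambda>i. max (a i) s) (\<lambda>i. max (b i) s)"
    unfolding interval_family_def disjoint_family_on_def
  proof (intro conjI allI impI ballI)
    fix i j assume ij: "i \<in> {..<n}" "j \<in> {..<n}" "i \<noteq> j"
    have "{max (a k) s<..<max (b k) s} \<subseteq> {a k<..<b k}" for k by auto
    then show "{max (a i) s<..<max (b i) s} \<inter> {max (a j) s<..<max (b j) s} = {}"
      using disj[of i j] ij by blast
  next
    fix i assume "i < n"
    from ab[OF this] show "s \<le> max (a i) s" "max (a i) s \<le> max (b i) s" "max (b i) s \<le> t"
      using assms(2,3) by linarith+
  qed
  from variation_sumsI[OF this, of \<gamma>] have "z \<in> variation_sums \<gamma> s t" unfolding z_def .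
  moreover have "x \<le> y + z"
    unfolding x y_def z_def sum.distrib[symmetric]
  proof (rule sum_mono)
    fix i assume "i \<in> {..<n}"
    then have i: "a i \<le> b i" using ab by auto
    show "norm (\<gamma> (b i) - \<gamma> (a i)) \<le> norm (\<gamma> (min (b i) s) - \<gamma> (min (a i) s)) + norm (\<gamma> (max (b i) s) - \<gamma> (max (a i) s))"
    proof -
      consider "b i \<le> s" | "s \<le> a i" | "a i < s" "s < b i" by linarith
      then show ?thesis
      proof cases
        case 3
        then show ?thesis using norm_triangle_ineq[of "\<gamma> s - \<gamma> (a i)" "\<gamma> (b i) - \<gamma> s"] by (simp add: min_def max_def)
      qed (use i in \<open>auto simp: min_def max_def\<close>)
    qed
  qed
  ultimately show ?thesis by (rule that)
qed

lemma variation_sums_append: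
  assumes "x \<in> variation_sums \<gamma> r s" "r \<le> s" "s \<le> t"
  shows "x + norm (\<gamma> t - \<gamma> s) \<in> variation_sums \<gamma> r t"
proof -
  obtain n a b where x: "x = (\<Sum>i<n. norm (\<gamma> (b i) - \<gamma> (a i)))" and f: "interval_family r s n a b"
    using assms(1) unfolding variation_sums_def by blast
  define a' where "a' = a(n := s)"
  define b' where "b' = b(n := t)"
  have "interval_family r t (Suc n) a' b'"
    unfolding interval_family_def
  proof
    show "\<forall>i<Suc n. r \<le> a' i \<and> a' i \<le> b' i \<and> b' i \<le> t"
      using f assms(2,3) unfolding interval_family_def a'_def b'_def by (fastforce simp: less_Suc_eq)
    show "disjoint_family_on (\<lambda>i. {a' i<..<b' i}) {..<Suc n}"
      unfolding disjoint_family_on_def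
    proof (intro ballI impI)
      fix i j assume ij: "i \<in> {..<Suc n}" "j \<in> {..<Suc n}" "i \<noteq> j"
      have old: "b k \<le> s" if "k < n" for k using f that unfolding interval_family_def by blast
      consider "i = n" "j < n" | "j = n" "i < n" | "i < n" "j < n" using ij by force
      then show "{a' i<..<b' i} \<inter> {a' j<..<b' j} = {}"
      proof cases
        case 1 then show ?thesis using old[of j] by (auto simp: a'_def b'_def)
      next
        case 2 then show ?thesis using old[of i] by (auto simp: a'_def b'_def)
      next
        case 3 then show ?thesis using f ij unfolding interval_family_def disjoint_family_on_def by (simp add: a'_def b'_def)
      qed
    qed
  qed
  moreover have "x + norm (\<gamma> t - \<gamma> s) = (\<Sum>i<Suc n. norm (\<gamma> (b' i) - \<gamma> (a' i)))"
    by (simp add: x a'_def b'_def)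
  ultimately show ?thesis using variation_sumsI by metis
qed

text \<open>For the tolerance 1, each further piece of length \<open>\<delta> / 2\<close> adds at
  most 1 to the sums.\<close>

lemma absolutely_continuous_curve_bounded_variation:
  assumes "absolutely_continuous_curve \<gamma>" "t \<le> 1"
  shows "bdd_above (variation_sums \<gamma> 0 t)"
proof -
  obtain \<delta> where \<delta>: "0 < \<delta>"
    "\<And>s t x. 0 \<le> s \<Longrightarrow> s \<le> t \<Longrightarrow> t \<le> 1 \<Longrightarrow> t - s < \<delta> \<Longrightarrow> x \<in> variation_sums \<gamma> s t \<Longrightarrow> x < 1"
    using absolutely_continuous_curve_variation[OF assms(1), of 1] by auto
  have "\<forall>x\<in>variation_sums \<gamma> 0 t. x \<le> real n" if "t \<le> 1" "t \<le> real n * (\<delta> / 2)" for n t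
    using that
  proof (induction n arbitrary: t)
    case 0
    show ?case
    proof
      fix x assume "x \<in> variation_sums \<gamma> 0 t"
      then obtain n a b where x: "x = (\<Sum>i<n. norm (\<gamma> (b i) - \<gamma> (a i)))" and f: "interval_family 0 t n a b"
        unfolding variation_sums_def by blast
      have "b i = a i" if "i < n" for i using f that 0 unfolding interval_family_def by fastforce
      then show "x \<le> real 0" unfolding x by (simp add: sum_nonpos)
    qed
  next
    case (Suc n)
    define s where "s = real n * (\<delta> / 2)"
    have s: "0 \<le> s" using \<delta>(1) by (simp add: s_def)
    show ?case
    proof (cases "t \<le> s")
      case True
      then show ?thesis using Suc by (fastforce simp: s_def)
    next
      case False
      show ?thesis
      proof
        fix x assume x: "x \<in> variation_sums \<gamma> 0 t"
        obtain y z where yz: "y \<in> variation_sums \<gamma> 0 s" "z \<in> variation_sums \<gamma> s t" "x \<le> y + z"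
          using variation_sums_split[OF x s] False by auto
        have "t - s < \<delta>" using Suc.prems \<delta>(1) by (simp add: s_def algebra_simps)
        then have "z < 1" using \<delta>(2)[OF s _ Suc.prems(1) _ yz(2)] False by simp
        moreover have "y \<le> real n" using Suc.IH[of s] yz(1) False Suc.prems(1) by (auto simp: s_def)
        ultimately show "x \<le> real (Suc n)" using yz(3) by simp
      qed
    qed
  qed
  moreover obtain n :: nat where "t / (\<delta> / 2) < real n" using reals_Archimedean2 by blast
  ultimately show ?thesis using \<delta>(1) assms(2) by (intro bdd_aboveI[of _ "real n"]) (simp add: divide_less_eq)
qed

text \<open>Extended by its end values, \<open>\<phi>\<close> becomes monotone and continuous on the
  line, and the extension agrees with it near every interior point.\<close>

lemma mono_continuous_on_unit_differentiable_ae: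
  fixes \<phi> :: "real \<Rightarrow> real"
  assumes mono: "\<And>s t. 0 \<le> s \<Longrightarrow> s \<le> t \<Longrightarrow> t \<le> 1 \<Longrightarrow> \<phi> s \<le> \<phi> t" and cont: "continuous_on {0..1} \<phi>"
  shows "negligible {t \<in> {0<..<1}. \<not> (\<exists>L. (\<phi> has_real_derivative L) (at t))}"
proof -
  define F where "F t = \<phi> (max 0 (min 1 t))" for t
  have "continuous_on UNIV F" unfolding F_def
  proof (rule continuous_on_compose2[OF cont])
    show "continuous_on UNIV (\<lambda>t::real. max 0 (min 1 t))" by (intro continuous_intros)
  qed auto
  moreover have "F x \<le> F y" if "x \<le> y" for x y unfolding F_def by (rule mono) (use that in auto)
  ultimately have "negligible {t \<in> {0<..<1}. \<not> (\<exists>L. (F has_real_derivative L) (at t))}"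
    by (rule mono_continuous_differentiable_ae[rotated])
  moreover have "(\<phi> has_real_derivative L) (at t)" if "(F has_real_derivative L) (at t)" "t \<in> {0<..<1}" for L t
    by (rule has_field_derivative_transform_within_open[OF that(1) open_greaterThanLessThan that(2)]) (auto simp: F_def)
  ultimately show ?thesis by (elim negligible_subset) blast
qed

text \<open>The variation \<open>V\<close> grows at least as much as the curve moves, so adding
  \<open>\<gamma> \<bullet> b\<close> keeps it monotone when \<open>norm b \<le> 1\<close>. The
  choice \<open>b = 0\<close> settles \<open>V\<close> itself, and subtracting it leaves the
  coordinates.\<close>

theorem absolutely_continuous_curve_differentiable_ae:
  fixes \<gamma> :: "real \<Rightarrow> 'a::euclidean_space"
  assumes ac: "absolutely_continuous_curve \<gamma>"
  shows "negligible {t \<in> {0<..<1}. \<not> (\<exists>v. (\<gamma> has_vector_derivative v) (at t))}"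
proof -
  define V where "V t = Sup (variation_sums \<gamma> 0 t)" for t
  note bdd = absolutely_continuous_curve_bounded_variation[OF ac]
  have ne: "variation_sums \<gamma> s t \<noteq> {}" for s t
  proof -
    have "interval_family s t 0 (\<lambda>_. 0) (\<lambda>_. 0)" by (simp add: interval_family_def disjoint_family_on_def)
    then show ?thesis unfolding variation_sums_def by blast
  qed
  have incr: "V s + norm (\<gamma> t - \<gamma> s) \<le> V t" if "0 \<le> s" "s \<le> t" "t \<le> 1" for s t
  proof -
    have "x + norm (\<gamma> t - \<gamma> s) \<le> V t" if "x \<in> variation_sums \<gamma> 0 s" for x
      unfolding V_def using variation_sums_append[OF that] \<open>0 \<le> s\<close> \<open>s \<le> t\<close> bdd[OF \<open>t \<le> 1\<close>] by (intro cSup_upper)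
    then have "V s \<le> V t - norm (\<gamma> t - \<gamma> s)" unfolding V_def by (intro cSup_least ne) (simp add: le_diff_eq)
    then show ?thesis by simp
  qed
  have small: "\<exists>\<delta>>0. \<forall>s t. 0 \<le> s \<longrightarrow> s \<le> t \<longrightarrow> t \<le> 1 \<longrightarrow> t - s < \<delta> \<longrightarrow> V t \<le> V s + \<epsilon>" if \<epsilon>: "\<epsilon> > 0" for \<epsilon>
  proof -
    obtain \<delta> where \<delta>: "0 < \<delta>"
      "\<And>s t x. 0 \<le> s \<Longrightarrow> s \<le> t \<Longrightarrow> t \<le> 1 \<Longrightarrow> t - s < \<delta> \<Longrightarrow> x \<in> variation_sums \<gamma> s t \<Longrightarrow> x < \<epsilon>"
      using absolutely_continuous_curve_variation[OF ac \<epsilon>] by blast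
    have "V t \<le> V s + \<epsilon>" if st: "0 \<le> s" "s \<le> t" "t \<le> 1" "t - s < \<delta>" for s t
      unfolding V_def
    proof (intro cSup_least ne)
      fix x assume x: "x \<in> variation_sums \<gamma> 0 t"
      obtain y z where yz: "y \<in> variation_sums \<gamma> 0 s" "z \<in> variation_sums \<gamma> s t" "x \<le> y + z"
        using variation_sums_split[OF x st(1,2)] .
      have "y \<le> Sup (variation_sums \<gamma> 0 s)" using yz(1) bdd[of s] st by (intro cSup_upper) auto
      then show "x \<le> Sup (variation_sums \<gamma> 0 s) + \<epsilon>" using \<delta>(2)[OF st yz(2)] yz(3) by simp
    qed
    then show ?thesis using \<delta>(1) by blast
  qed
  have contV: "continuous_on {0..1} V"
    unfolding continuous_on_iff
  proof (intro ballI allI impI)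
    fix t e :: real assume t: "t \<in> {0..1}" and e: "0 < e"
    then obtain \<delta> where \<delta>: "\<delta> > 0" "\<And>s t. 0 \<le> s \<Longrightarrow> s \<le> t \<Longrightarrow> t \<le> 1 \<Longrightarrow> t - s < \<delta> \<Longrightarrow> V t \<le> V s + e / 2"
      using small[of "e / 2"] by auto
    have mV: "V s \<le> V t" if "0 \<le> s" "s \<le> t" "t \<le> 1" for s t
      using incr[OF that] norm_ge_zero[of "\<gamma> t - \<gamma> s"] by linarith
    have "dist (V s) (V t) < e" if s: "s \<in> {0..1}" "dist s t < \<delta>" for s
    proof (cases "s \<le> t")
      case True
      then show ?thesis using \<delta>(2)[of s t] mV[of s t] s t e unfolding dist_real_def by fastforce
    next
      case False
      then show ?thesis using \<delta>(2)[of t s] mV[of t s] s t e unfolding dist_real_def by fastforce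
    qed
    then show "\<exists>d>0. \<forall>s\<in>{0..1}. dist s t < d \<longrightarrow> dist (V s) (V t) < e" using \<delta>(1) by blast
  qed
  have contg: "continuous_on {0..1} \<gamma>"
    unfolding continuous_on_iff
  proof (intro ballI allI impI)
    fix t e :: real assume t: "t \<in> {0..1}" and e: "0 < e"
    then obtain \<delta> where \<delta>: "\<delta> > 0" "\<And>s. s \<in> {0..1} \<Longrightarrow> dist s t < \<delta> \<Longrightarrow> dist (V s) (V t) < e"
      using contV unfolding continuous_on_iff by blast
    have "dist (\<gamma> s) (\<gamma> t) \<le> dist (V s) (V t)" if "s \<in> {0..1}" for s
      using incr[of s t] incr[of t s] that t by (cases "s \<le> t") (auto simp: dist_norm norm_minus_commute)
    then show "\<exists>d>0. \<forall>s\<in>{0..1}. dist s t < d \<longrightarrow> dist (\<gamma> s) (\<gamma> t) < e" using \<delta> by (meson le_less_trans)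
  qed
  define B where "B b = {t \<in> {0<..<1}. \<not> (\<exists>L. ((\<lambda>s. V s + \<gamma> s \<bullet> b) has_real_derivative L) (at t))}" for b
  have nB: "negligible (B b)" if "norm b \<le> 1" for b
    unfolding B_def
  proof (rule mono_continuous_on_unit_differentiable_ae)
    show "continuous_on {0..1} (\<lambda>s. V s + \<gamma> s \<bullet> b)" by (intro continuous_intros contV contg)
    fix s t :: real assume st: "0 \<le> s" "s \<le> t" "t \<le> 1"
    have "\<bar>(\<gamma> s - \<gamma> t) \<bullet> b\<bar> \<le> norm (\<gamma> s - \<gamma> t)"
      using Cauchy_Schwarz_ineq2[of "\<gamma> s - \<gamma> t" b] mult_left_mono[OF that norm_ge_zero[of "\<gamma> s - \<gamma> t"]] by simp
    then show "V s + \<gamma> s \<bullet> b \<le> V t + \<gamma> t \<bullet> b"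
      using incr[OF st] by (simp add: inner_diff_left norm_minus_commute abs_le_iff)
  qed
  have "negligible (B 0 \<union> (\<Union>b\<in>Basis. B b))"
    using nB by (intro negligible_Un negligible_Union finite_imageI) auto
  then show ?thesis
  proof (rule negligible_subset, safe)
    fix t :: real assume t: "t \<in> {0<..<1}" "\<nexists>v. (\<gamma> has_vector_derivative v) (at t)" "t \<notin> \<Union> (B ` Basis)"
    show "t \<in> B 0"
    proof (rule ccontr)
      assume "t \<notin> B 0"
      then obtain L0 where L0: "((\<lambda>s. V s + \<gamma> s \<bullet> 0) has_real_derivative L0) (at t)" using t unfolding B_def by blast
      have "\<exists>L. ((\<lambda>s. V s + \<gamma> s \<bullet> b) has_real_derivative L) (at t)" if "b \<in> Basis" for b
        using t that unfolding B_def by blast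
      then obtain L where L: "\<And>b. b \<in> Basis \<Longrightarrow> ((\<lambda>s. V s + \<gamma> s \<bullet> b) has_real_derivative L b) (at t)" by metis
      have "((\<lambda>s. \<gamma> s \<bullet> b) has_real_derivative (L b - L0)) (at t)" if "b \<in> Basis" for b
        using DERIV_diff[OF L[OF that] L0] by simp
      then have "((\<lambda>s. \<gamma> s \<bullet> b) has_vector_derivative (\<Sum>c\<in>Basis. (L c - L0) *\<^sub>R c) \<bullet> b) (at t)" if "b \<in> Basis" for b
        using that by (simp add: has_real_derivative_iff_has_vector_derivative)
      then have "(\<gamma> has_vector_derivative (\<Sum>c\<in>Basis. (L c - L0) *\<^sub>R c)) (at t)"
        unfolding has_vector_derivative_def by (subst has_derivative_componentwise_within) simp
      then show False using t(2) by blast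
    qed
  qed
qed

section \<open>Increments and almost everywhere derivatives\<close>

text \<open>Zahorski's argument: a level \<open>y\<close> avoided by the image of the exceptional null set is crossed upwards for
  the last time at a point of differentiability.\<close>

lemma lipschitz_increment_le_ae_derivative:
  fixes \<phi> :: "real \<Rightarrow> real"
  assumes lip: "L-lipschitz_on {a..b} \<phi>" and ab: "a \<le> b" and N: "negligible N"
    and der: "\<And>t. t \<in> {a<..<b} - N \<Longrightarrow> \<exists>d\<le>c. (\<phi> has_real_derivative d) (at t)"
  shows "\<phi> b - \<phi> a \<le> c * (b - a)"
proof (rule ccontr)
  assume "\<not> ?thesis"
  then have gt: "c * (b - a) < \<phi> b - \<phi> a" by simp
  then have "a < b" using ab by (cases "a = b") auto
  have "c < (\<phi> b - \<phi> a) / (b - a)" using gt \<open>a < b\<close> by (simp add: less_divide_eq)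
  \<comment> \<open>A slope strictly between \<open>c\<close> and the mean slope makes the tilted
    function \<open>\<psi>\<close> larger at \<open>b\<close> than at \<open>a\<close>, although its
    derivative is negative at the interior points outside \<open>N\<close>.\<close>
  then obtain c' where c': "c < c'" "c' < (\<phi> b - \<phi> a) / (b - a)" using dense by blast
  define \<psi> where "\<psi> t = \<phi> t - c' * t" for t
  have \<psi>ab: "\<psi> a < \<psi> b" using c'(2) \<open>a < b\<close> by (simp add: \<psi>_def less_divide_eq algebra_simps)
  have cont: "continuous_on {a..b} \<psi>"
    unfolding \<psi>_def by (intro continuous_intros lipschitz_on_continuous_on[OF lip])
  \<comment> \<open>Lipschitz functions on the line map null sets to null sets, so some level
    between \<open>\<psi> a\<close> and \<open>\<psi> b\<close> avoids the image.\<close>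
  have "negligible (\<psi> ` (N \<inter> {a..b}))"
  proof (rule negligible_locally_Lipschitz_image)
    show "negligible (N \<inter> {a..b})" using N by (rule negligible_subset) auto
    fix x assume x: "x \<in> N \<inter> {a..b}"
    have "norm (\<psi> y - \<psi> x) \<le> (L + \<bar>c'\<bar>) * norm (y - x)" if y: "y \<in> N \<inter> {a..b}" for y
    proof -
      have "\<bar>\<phi> y - \<phi> x\<bar> \<le> L * \<bar>y - x\<bar>" using lipschitz_onD[OF lip, of y x] x y by (auto simp: dist_real_def)
      moreover have "\<bar>c' * y - c' * x\<bar> = \<bar>c'\<bar> * \<bar>y - x\<bar>" by (simp add: abs_mult flip: right_diff_distrib)
      ultimately show ?thesis unfolding \<psi>_def by (simp add: distrib_right)
    qed
    then show "\<exists>T B. open T \<and> x \<in> T \<and> (\<forall>y\<in>N \<inter> {a..b} \<inter> T. norm (\<psi> y - \<psi> x) \<le> B * norm (y - x))"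
      by (intro exI[of _ UNIV] exI[of _ "L + \<bar>c'\<bar>"]) auto
  qed simp
  moreover have "\<not> negligible {\<psi> a<..<\<psi> b}"
    using negligible_interval(2)[of "\<psi> a" "\<psi> b"] \<psi>ab by (simp add: box_real)
  ultimately have "\<not> {\<psi> a<..<\<psi> b} \<subseteq> \<psi> ` (N \<inter> {a..b})" using negligible_subset by blast
  then obtain y where "y \<in> {\<psi> a<..<\<psi> b}" "y \<notin> \<psi> ` (N \<inter> {a..b})" by blast
  then have y: "\<psi> a < y" "y < \<psi> b" "y \<notin> \<psi> ` (N \<inter> {a..b})" by simp_all
  define S where "S = {t \<in> {a..b}. \<psi> t \<le> y}"
  have "closed S" unfolding S_def
    by (rule continuous_on_closed_Collect_le[OF cont]) (auto intro: continuous_on_const)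
  moreover have "S \<subseteq> {a..b}" by (auto simp: S_def)
  ultimately have "compact S" by (metis bounded_closed_interval bounded_subset compact_eq_bounded_closed)
  moreover have "a \<in> S" using y \<open>a < b\<close> by (simp add: S_def)
  ultimately obtain t where t: "t \<in> S" "\<And>s. s \<in> S \<Longrightarrow> s \<le> t" using compact_attains_sup[of S] by blast
  have tb: "t < b" using t(1) y(2) by (cases "t = b") (auto simp: S_def)
  have above: "y < \<psi> s" if "t < s" "s \<le> b" for s
  proof (rule ccontr)
    assume "\<not> y < \<psi> s"
    then have "s \<in> S" using t(1) that by (simp add: S_def)
    then show False using t(2)[of s] that by simp
  qed
  have "\<psi> t = y"
  proof (rule antisym)
    show "\<psi> t \<le> y" using t(1) by (simp add: S_def)
    have "(\<psi> \<longlongrightarrow> \<psi> t) (at t within {t<..<b})"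
    proof (rule tendsto_within_subset)
      show "(\<psi> \<longlongrightarrow> \<psi> t) (at t within {a..b})" using cont t(1) by (auto simp: S_def continuous_on)
    qed (use t(1) in \<open>auto simp: S_def\<close>)
    moreover have "\<forall>\<^sub>F s in at t within {t<..<b}. y \<le> \<psi> s"
      using above by (auto simp: eventually_at intro!: exI[of _ 1] less_imp_le)
    moreover have "at t within {t<..<b} \<noteq> bot" using tb by (simp add: at_within_eq_bot_iff)
    ultimately show "y \<le> \<psi> t" by (rule tendsto_lowerbound)
  qed
  then have "t \<noteq> a" "t \<notin> N" using y t(1) by (auto simp: S_def)
  then have "t \<in> {a<..<b} - N" using t(1) tb by (auto simp: S_def)
  then obtain d where d: "d \<le> c" "(\<phi> has_real_derivative d) (at t)" using der by blast
  have "(\<psi> has_real_derivative (d - c')) (at t)"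
    unfolding \<psi>_def by (auto intro!: derivative_eq_intros d(2))
  then obtain e where e: "e > 0" "\<And>h. 0 < h \<Longrightarrow> h < e \<Longrightarrow> \<psi> (t + h) < \<psi> t"
    using DERIV_neg_dec_right[of \<psi> "d - c'" t] d(1) c'(1) by auto
  define h where "h = min (e / 2) (b - t)"
  have "0 < h" "h < e" "t + h \<le> b" using e(1) tb by (auto simp: h_def)
  then show False using e(2)[of h] above[of "t + h"] \<open>\<psi> t = y\<close> by simp
qed

lemma lipschitz_abs_increment_le_ae_derivative:
  fixes \<phi> :: "real \<Rightarrow> real"
  assumes lip: "L-lipschitz_on {a..b} \<phi>" and ab: "a \<le> b" and N: "negligible N"
    and der: "\<And>t. t \<in> {a<..<b} - N \<Longrightarrow> \<exists>d. \<bar>d\<bar> \<le> c \<and> (\<phi> has_real_derivative d) (at t)"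
  shows "\<bar>\<phi> b - \<phi> a\<bar> \<le> c * (b - a)"
proof -
  have "\<phi> b - \<phi> a \<le> c * (b - a)"
    by (rule lipschitz_increment_le_ae_derivative[OF lip ab N]) (use der abs_le_D1 in blast)
  moreover have "(- \<phi> b) - (- \<phi> a) \<le> c * (b - a)"
  proof (rule lipschitz_increment_le_ae_derivative[OF _ ab N])
    show "L-lipschitz_on {a..b} (\<lambda>t. - \<phi> t)" using lip by (simp add: lipschitz_on_def dist_minus)
    fix t assume "t \<in> {a<..<b} - N"
    then obtain d where "\<bar>d\<bar> \<le> c" "(\<phi> has_real_derivative d) (at t)" using der by blast
    then show "\<exists>d\<le>c. ((\<lambda>t. - \<phi> t) has_real_derivative d) (at t)"
      by (intro exI[of _ "-d"]) (auto intro: DERIV_minus)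
  qed
  ultimately show ?thesis by (auto simp: abs_le_iff)
qed

section \<open>Measurability with respect to the Hausdorff distance\<close>

text \<open>A Lipschitz bound makes preimages of open sets open for the Hausdorff distance; the
  one-sided form suffices because the distance is symmetric.\<close>

lemma borel_measurable_hausdorff_lipschitz:
  fixes \<phi> :: "'a::metric_space set \<Rightarrow> real"
  assumes lip: "\<And>A B. compact A \<Longrightarrow> A \<noteq> {} \<Longrightarrow> compact B \<Longrightarrow> B \<noteq> {} \<Longrightarrow>
    \<phi> A \<le> \<phi> B + c * hausdorff_distance A B"
  shows "\<phi> \<in> borel_measurable hausdorff_borel"
proof (rule borel_measurableI)
  fix S :: "real set" assume S: "open S"
  let ?X = "{K :: 'a set. compact K \<and> K \<noteq> {}}"
  have lip': "\<bar>\<phi> A - \<phi> B\<bar> \<le> \<bar>c\<bar> * hausdorff_distance A B" if "A \<in> ?X" "B \<in> ?X" for A B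
  proof -
    have "c * hausdorff_distance A B \<le> \<bar>c\<bar> * hausdorff_distance A B"
      by (rule mult_right_mono) (auto intro: Hausdorff.nonneg)
    moreover have "hausdorff_distance B A = hausdorff_distance A B" by (rule Hausdorff.commute)
    ultimately show ?thesis using lip[of A B] lip[of B A] that by auto
  qed
  have "openin Hausdorff.mtopology (\<phi> -` S \<inter> ?X)"
    unfolding Hausdorff.openin_mtopology
  proof (intro conjI allI impI)
    fix A assume A: "A \<in> \<phi> -` S \<inter> ?X"
    then obtain e where e: "e > 0" "\<And>y. dist y (\<phi> A) < e \<Longrightarrow> y \<in> S" using S by (auto simp: open_dist)
    have "Hausdorff.mball A (e / (\<bar>c\<bar> + 1)) \<subseteq> \<phi> -` S \<inter> ?X"
    proof
      fix B assume "B \<in> Hausdorff.mball A (e / (\<bar>c\<bar> + 1))"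
      then have B: "B \<in> ?X" "hausdorff_distance A B < e / (\<bar>c\<bar> + 1)" by auto
      have "\<bar>\<phi> A - \<phi> B\<bar> \<le> \<bar>c\<bar> * hausdorff_distance A B" using A B by (intro lip') auto
      also have "\<dots> \<le> (\<bar>c\<bar> + 1) * hausdorff_distance A B"
        by (rule mult_right_mono) (auto intro: Hausdorff.nonneg)
      also have "\<dots> < e" using B(2) by (simp add: less_divide_eq mult.commute add_nonneg_pos)
      finally show "B \<in> \<phi> -` S \<inter> ?X" using B(1) e(2)[of "\<phi> B"] by (simp add: dist_real_def abs_minus_commute)
    qed
    then show "\<exists>r>0. Hausdorff.mball A r \<subseteq> \<phi> -` S \<inter> ?X"
      using e(1) by (intro exI[of _ "e / (\<bar>c\<bar> + 1)"]) (auto intro!: divide_pos_pos add_nonneg_pos)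
  qed auto
  then show "\<phi> -` S \<inter> space hausdorff_borel \<in> sets hausdorff_borel"
    unfolding space_hausdorff_borel sets_hausdorff_borel by (intro sigma_sets.Basic) simp
qed

lemma infdist_le_hausdorff_distance:
  assumes "compact A" "compact B" "B \<noteq> {}" "x \<in> A"
  shows "infdist x B \<le> hausdorff_distance A B"
  using hausdorff_distance_le_iff[of A B "hausdorff_distance A B"] assms by (auto simp: compact_imp_bounded)

lemma borel_measurable_infdist_hausdorff: "infdist q \<in> borel_measurable hausdorff_borel"
proof (rule borel_measurable_hausdorff_lipschitz)
  fix A B :: "'a set" assume AB: "compact A" "A \<noteq> {}" "compact B" "B \<noteq> {}"
  have "infdist b A \<le> hausdorff_distance A B" if "b \<in> B" for b
    using infdist_le_hausdorff_distance[OF AB(3,1,2) that] by (simp add: Hausdorff.commute)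
  then show "infdist q A \<le> infdist q B + 1 * hausdorff_distance A B"
    using infdist_le_add[OF AB(4)] by simp
qed

text \<open>It turns a condition on all elements of \<open>K\<close> into one inequality whose left
  side is measurable in \<open>K\<close> and continuous in \<open>p\<close>, as
  \<open>caratheodory_compose\<close> requires.\<close>

definition support_function :: "'a::real_inner set \<Rightarrow> 'a \<Rightarrow> real" where
  "support_function K p = (SUP w\<in>K. p \<bullet> w)"

lemma bdd_above_inner: "bounded K \<Longrightarrow> bdd_above ((\<lambda>w. p \<bullet> w) ` K)"
  by (intro bounded_imp_bdd_above bounded_linear_image bounded_linear_inner_right)

lemma support_function_le_iff:
  assumes "bounded K" "K \<noteq> {}"
  shows "support_function K p \<le> a \<longleftrightarrow> (\<forall>w\<in>K. p \<bullet> w \<le> a)"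
  unfolding support_function_def using assms by (intro cSUP_le_iff bdd_above_inner)

lemma support_function_ge: "bounded K \<Longrightarrow> w \<in> K \<Longrightarrow> p \<bullet> w \<le> support_function K p"
  unfolding support_function_def by (intro cSUP_upper bdd_above_inner)

lemma continuous_support_function:
  assumes "bounded K" "K \<noteq> {}"
  shows "continuous_on UNIV (support_function K)"
proof -
  obtain B where B: "\<And>w. w \<in> K \<Longrightarrow> norm w \<le> B" using assms(1) unfolding bounded_iff by blast
  have le: "support_function K p \<le> support_function K q + B * dist p q" for p q
    unfolding support_function_le_iff[OF assms]
  proof
    fix w assume w: "w \<in> K"
    have "p \<bullet> w = q \<bullet> w + (p - q) \<bullet> w" by (simp add: inner_diff_left)
    also have "\<dots> \<le> support_function K q + norm (p - q) * norm w"
      by (intro add_mono support_function_ge assms w norm_cauchy_schwarz)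
    also have "\<dots> \<le> support_function K q + B * dist p q"
      using mult_left_mono[OF B[OF w] norm_ge_zero[of "p - q"]] by (simp add: dist_norm mult.commute)
    finally show "p \<bullet> w \<le> support_function K q + B * dist p q" .
  qed
  have "0 \<le> B" using B assms(2) norm_ge_zero by (meson all_not_in_conv order_trans)
  moreover have "dist (support_function K p) (support_function K q) \<le> B * dist p q" for p q
    using le[of p q] le[of q p] by (simp add: dist_real_def dist_commute abs_le_iff)
  ultimately have "B-lipschitz_on UNIV (support_function K)" by (intro lipschitz_onI) auto
  then show ?thesis by (rule lipschitz_on_continuous_on)
qed

lemma borel_measurable_support_function:
  fixes p :: "'a::euclidean_space"
  shows "(\<lambda>K. support_function K p) \<in> borel_measurable hausdorff_borel"
proof (rule borel_measurable_hausdorff_lipschitz)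
  fix A B :: "'a set" assume AB: "compact A" "A \<noteq> {}" "compact B" "B \<noteq> {}"
  show "support_function A p \<le> support_function B p + norm p * hausdorff_distance A B"
    unfolding support_function_le_iff[OF compact_imp_bounded[OF AB(1)] AB(2)]
  proof
    fix w assume w: "w \<in> A"
    obtain v where v: "v \<in> B" "infdist w B = dist w v"
      using infdist_attains_inf[OF compact_imp_closed[OF AB(3)] AB(4)] by blast
    have "p \<bullet> w = p \<bullet> v + p \<bullet> (w - v)" by (simp add: inner_diff_right)
    also have "\<dots> \<le> support_function B p + norm p * norm (w - v)"
      by (intro add_mono support_function_ge compact_imp_bounded AB v norm_cauchy_schwarz)
    also have "norm (w - v) \<le> hausdorff_distance A B"
      using infdist_le_hausdorff_distance[OF AB(1,3,4) w] v(2) by (simp add: dist_norm)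
    finally show "p \<bullet> w \<le> support_function B p + norm p * hausdorff_distance A B"
      by (simp add: mult_left_mono)
  qed
qed

lemma dense_sequence:
  obtains q :: "nat \<Rightarrow> 'a::{metric_space, second_countable_topology}"
  where "\<And>x e. 0 < e \<Longrightarrow> \<exists>i. dist (q i) x < e"
proof -
  obtain Q :: "'a set" where Q: "countable Q" "\<And>X. open X \<Longrightarrow> X \<noteq> {} \<Longrightarrow> \<exists>d\<in>Q. d \<in> X"
    using countable_dense_exists by blast
  have "Q \<noteq> {}" using Q(2)[of UNIV] by auto
  show ?thesis
  proof (rule that[of "from_nat_into Q"])
    fix x :: 'a and e :: real assume "0 < e"
    then obtain d where "d \<in> Q" "d \<in> ball x e" using Q(2)[of "ball x e"] by auto
    moreover from from_nat_into_surj[OF Q(1) \<open>d \<in> Q\<close>] obtain i where "from_nat_into Q i = d" ..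
    ultimately show "\<exists>i. dist (from_nat_into Q i) x < e" by (auto simp: dist_commute)
  qed
qed

text \<open>\<open>X\<close> is a limit of measurable functions with values in a dense sequence. For
  those the composition is measurable piece by piece, and continuity in \<open>x\<close> passes to
  the limit.\<close>

lemma caratheodory_compose:
  fixes g :: "'x::{metric_space, second_countable_topology} \<Rightarrow> 's \<Rightarrow> real"
  assumes g: "\<And>x. g x \<in> borel_measurable M"
    and cont: "\<And>s. s \<in> space M \<Longrightarrow> continuous_on UNIV (\<lambda>x. g x s)"
    and X[measurable]: "X \<in> borel_measurable M"
  shows "(\<lambda>s. g (X s) s) \<in> borel_measurable M"
proof -
  obtain q :: "nat \<Rightarrow> 'x" where q: "\<And>x e. 0 < e \<Longrightarrow> \<exists>i. dist (q i) x < e" using dense_sequence by blast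
  define N where "N k s = (LEAST i. dist (q i) (X s) < 1 / Suc k)" for k :: nat and s
  have N: "dist (q (N k s)) (X s) < 1 / Suc k" for k s
    unfolding N_def by (rule LeastI_ex) (rule q, simp)
  have Nm: "N k \<in> M \<rightarrow>\<^sub>M count_space UNIV" for k unfolding N_def by measurable
  show ?thesis
  proof (rule borel_measurable_LIMSEQ_real)
    show "(\<lambda>s. g (q (N k s)) s) \<in> borel_measurable M" for k
      by (rule measurable_compose_countable'[OF g Nm]) auto
    fix s assume s: "s \<in> space M"
    have "(\<lambda>k. q (N k s)) \<longlonglongrightarrow> X s" by (rule LIMSEQ_dist_less_inverse) (rule N)
    then show "(\<lambda>k. g (q (N k s)) s) \<longlonglongrightarrow> g (X s) s"
      by (rule continuous_on_tendsto_compose[OF cont[OF s]]) auto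
  qed
qed

text \<open>Members of a dense sequence within \<open>1 / Suc k\<close> of \<open>F s\<close>,
  chosen by least index, form a bounded measurable sequence. Its cluster points lie in the closed
  set \<open>F s\<close>, and any of them will do, hence the direction 0 in the cluster
  selection.\<close>

lemma hausdorff_measurable_selection:
  fixes F :: "'s \<Rightarrow> 'a::euclidean_space set"
  assumes F: "F \<in> M \<rightarrow>\<^sub>M hausdorff_borel"
  obtains w where "w \<in> borel_measurable M" "\<And>s. s \<in> space M \<Longrightarrow> w s \<in> F s"
proof -
  have "F s \<in> {K. compact K \<and> K \<noteq> {}}" if "s \<in> space M" for s
    using measurable_space[OF F that] unfolding space_hausdorff_borel .
  then have K: "compact (F s)" "F s \<noteq> {}" if "s \<in> space M" for s using that by blast+
  have [measurable]: "(\<lambda>s. infdist x (F s)) \<in> borel_measurable M" for x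
    using measurable_compose[OF F borel_measurable_infdist_hausdorff] .
  obtain q :: "nat \<Rightarrow> 'a" where q: "\<And>x e. 0 < e \<Longrightarrow> \<exists>i. dist (q i) x < e" using dense_sequence by blast
  define N where "N k s = (LEAST i. infdist (q i) (F s) < 1 / Suc k)" for k :: nat and s
  have N: "infdist (q (N k s)) (F s) < 1 / Suc k" if s: "s \<in> space M" for k s
    unfolding N_def
  proof (rule LeastI_ex)
    obtain y where y: "y \<in> F s" using K[OF s] by blast
    obtain i where "dist (q i) y < 1 / Suc k" using q[of "1 / Suc k" y] by auto
    then show "\<exists>i. infdist (q i) (F s) < 1 / Suc k" using infdist_le[OF y, of "q i"] by (intro exI[of _ i]) simp
  qed
  have Nm: "N k \<in> M \<rightarrow>\<^sub>M count_space UNIV" for k unfolding N_def by measurable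
  define u where "u k s = q (N k s)" for k s
  have um: "u k \<in> borel_measurable M" for k
    unfolding u_def by (rule measurable_compose_countable'[OF _ Nm]) auto
  have bd: "bounded (range (\<lambda>k. u k s))" if s: "s \<in> space M" for s
  proof -
    obtain B where B: "\<And>y. y \<in> F s \<Longrightarrow> norm y \<le> B" using compact_imp_bounded[OF K(1)[OF s]] unfolding bounded_iff by blast
    have "norm (u k s) \<le> B + 1" for k
    proof -
      obtain y where y: "y \<in> F s" "infdist (u k s) (F s) = dist (u k s) y"
        using infdist_attains_inf[OF compact_imp_closed[OF K(1)[OF s]] K(2)[OF s]] by blast
      have "dist (u k s) y < 1 / Suc k" using N[OF s, of k] y(2) by (simp add: u_def)
      also have "\<dots> \<le> 1" by simp
      finally have "norm (u k s - y) < 1" by (simp add: dist_norm)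
      then show ?thesis using B[OF y(1)] norm_triangle_sub[of "u k s" y] by simp
    qed
    then show ?thesis unfolding bounded_iff by auto
  qed
  obtain w where w: "w \<in> borel_measurable M" "\<And>s. s \<in> space M \<Longrightarrow> cluster_point (\<lambda>k. u k s) (w s)"
    by (rule measurable_cluster_selection[of u M 0, OF um bd]) (assumption, rule that)
  have "w s \<in> F s" if s: "s \<in> space M" for s
  proof -
    obtain r where r: "strict_mono r" "((\<lambda>k. u k s) \<circ> r) \<longlonglongrightarrow> w s"
      using cluster_point_imp_subseq[OF w(2)[OF s]] .
    have "(\<lambda>k. infdist (u k s) (F s)) \<longlonglongrightarrow> 0"
      by (rule LIMSEQ_dist_less_inverse) (use N[OF s] in \<open>simp add: u_def dist_real_def infdist_nonneg\<close>)
    from LIMSEQ_subseq_LIMSEQ[OF this r(1)] have "(\<lambda>k. infdist (u (r k) s) (F s)) \<longlonglongrightarrow> 0" by (simp add: o_def)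
    moreover have "(\<lambda>k. infdist (u (r k) s) (F s)) \<longlonglongrightarrow> infdist (w s) (F s)"
      using r(2) by (intro tendsto_infdist) (simp add: o_def)
    ultimately have "infdist (w s) (F s) = 0" using LIMSEQ_unique by blast
    then show ?thesis using in_closed_iff_infdist_zero[OF compact_imp_closed[OF K(1)[OF s]] K(2)[OF s]] by simp
  qed
  then show ?thesis using w(1) that by blast
qed

section \<open>Conservative gradients of integrals\<close>

lemma AE_lborel_iff_negligible: "(AE t in lborel. P t) \<longleftrightarrow> negligible {t. \<not> P t}"
proof -
  have "(AE t in lborel. P t) \<longleftrightarrow> (AE t in lebesgue. P t)" by (simp add: AE_completion_iff)
  also have "\<dots> \<longleftrightarrow> (\<exists>N\<in>null_sets lebesgue. {t. \<not> P t} \<subseteq> N)" by (simp add: eventually_ae_filter)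
  also have "\<dots> \<longleftrightarrow> negligible {t. \<not> P t}"
    unfolding negligible_iff_null_sets[symmetric] using negligible_subset by (metis (no_types, lifting) mem_Collect_eq negligible_iff_null_sets order_refl)
  finally show ?thesis .
qed

text \<open>On the open interval the derivatives within \<open>{0..1}\<close> become two-sided, and
  \<open>lborel\<close> is the form in which Lebesgue measure enters the product for Fubini's
  theorem.\<close>

lemma AE_unit_interval_iff:
  "(AE t in lebesgue_on {0..1}. P t) \<longleftrightarrow> (AE t in lborel. t \<in> {0<..<1::real} \<longrightarrow> P t)"
proof -
  have "(AE t in lebesgue_on {0..1}. P t) \<longleftrightarrow> (AE t in lborel. t \<in> {0..1} \<longrightarrow> P t)"
    by (subst AE_restrict_space_iff) (auto simp: AE_completion_iff)
  also have "\<dots> \<longleftrightarrow> (AE t in lborel. t \<in> {0<..<1::real} \<longrightarrow> P t)"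
  proof
    assume "AE t in lborel. t \<in> {0<..<1::real} \<longrightarrow> P t"
    then show "AE t in lborel. t \<in> {0..1::real} \<longrightarrow> P t"
      using AE_lborel_singleton[of "0::real"] AE_lborel_singleton[of "1::real"] by eventually_elim auto
  qed (auto elim!: eventually_mono)
  finally show ?thesis .
qed

lemma has_vector_derivative_imp_quotient_tendsto:
  assumes "(\<gamma> has_vector_derivative v) (at t within S)"
  shows "((\<lambda>y. (1 / (y - t)) *\<^sub>R (\<gamma> y - \<gamma> t)) \<longlongrightarrow> v) (at t within S)"
proof (rule LIM_zero_cancel, rule tendsto_norm_zero_cancel)
  have lim: "((\<lambda>y. norm ((\<gamma> y - \<gamma> t) - (y - t) *\<^sub>R v) / norm (y - t)) \<longlongrightarrow> 0) (at t within S)"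
    using assms unfolding has_vector_derivative_def has_derivative_iff_norm by simp
  show "((\<lambda>y. norm ((1 / (y - t)) *\<^sub>R (\<gamma> y - \<gamma> t) - v)) \<longlongrightarrow> 0) (at t within S)"
  proof (rule Lim_transform_eventually[OF lim])
    show "\<forall>\<^sub>F y in at t within S. norm ((\<gamma> y - \<gamma> t) - (y - t) *\<^sub>R v) / norm (y - t)
        = norm ((1 / (y - t)) *\<^sub>R (\<gamma> y - \<gamma> t) - v)"
      unfolding eventually_at_filter
    proof (rule always_eventually, intro allI impI)
      fix y assume "y \<noteq> t"
      then have "(1 / (y - t)) *\<^sub>R (\<gamma> y - \<gamma> t) - v = (1 / (y - t)) *\<^sub>R ((\<gamma> y - \<gamma> t) - (y - t) *\<^sub>R v)"
        by (simp add: scaleR_diff_right)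
      then show "norm ((\<gamma> y - \<gamma> t) - (y - t) *\<^sub>R v) / norm (y - t) = norm ((1 / (y - t)) *\<^sub>R (\<gamma> y - \<gamma> t) - v)"
        by (simp add: divide_inverse mult.commute)
    qed
  qed
qed

lemma absolutely_continuous_curve_continuous:
  assumes "absolutely_continuous_curve \<gamma>"
  shows "continuous_on {0..1} \<gamma>"
  unfolding continuous_on_iff
proof (intro ballI allI impI)
  fix t e :: real assume t: "t \<in> {0..1}" and e: "0 < e"
  obtain \<delta> where \<delta>: "0 < \<delta>"
    "\<And>s t x. 0 \<le> s \<Longrightarrow> s \<le> t \<Longrightarrow> t \<le> 1 \<Longrightarrow> t - s < \<delta> \<Longrightarrow> x \<in> variation_sums \<gamma> s t \<Longrightarrow> x < e"
    using absolutely_continuous_curve_variation[OF assms e] by blast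
  have lt: "norm (\<gamma> s' - \<gamma> s) < e" if "0 \<le> s" "s \<le> s'" "s' \<le> 1" "s' - s < \<delta>" for s s'
  proof -
    have "interval_family s s' 1 (\<lambda>_. s) (\<lambda>_. s')"
      using that by (auto simp: interval_family_def disjoint_family_on_def)
    from variation_sumsI[OF this, of \<gamma>] show ?thesis using \<delta>(2)[OF that] by simp
  qed
  have "dist (\<gamma> s) (\<gamma> t) < e" if "s \<in> {0..1}" "dist s t < \<delta>" for s
    using lt[of s t] lt[of t s] that t
    by (cases "s \<le> t") (auto simp: dist_norm norm_minus_commute)
  then show "\<exists>d>0. \<forall>s\<in>{0..1}. dist s t < d \<longrightarrow> dist (\<gamma> s) (\<gamma> t) < e" using \<delta>(1) by blast
qed

lemma absolutely_continuous_segment: "absolutely_continuous_curve (\<lambda>t. x + t *\<^sub>R d)"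
  unfolding absolutely_continuous_curve_def
proof (intro allI impI)
  fix \<epsilon> :: real assume \<epsilon>: "\<epsilon> > 0"
  show "\<exists>\<delta>>0. \<forall>(n::nat) a b. (\<forall>i<n. 0 \<le> a i \<and> a i \<le> b i \<and> b i \<le> 1) \<and>
      disjoint_family_on (\<lambda>i. {a i<..<b i}) {..<n} \<and> (\<Sum>i<n. b i - a i) < \<delta> \<longrightarrow>
      (\<Sum>i<n. norm (x + b i *\<^sub>R d - (x + a i *\<^sub>R d))) < \<epsilon>"
  proof (intro exI[of _ "\<epsilon> / (norm d + 1)"] conjI allI impI)
    show "0 < \<epsilon> / (norm d + 1)" using \<epsilon> by (simp add: add_nonneg_pos)
    fix n :: nat and a b :: "nat \<Rightarrow> real"
    assume h: "(\<forall>i<n. 0 \<le> a i \<and> a i \<le> b i \<and> b i \<le> 1) \<and>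
      disjoint_family_on (\<lambda>i. {a i<..<b i}) {..<n} \<and> (\<Sum>i<n. b i - a i) < \<epsilon> / (norm d + 1)"
    have "(\<Sum>i<n. norm (x + b i *\<^sub>R d - (x + a i *\<^sub>R d))) = (\<Sum>i<n. (b i - a i) * norm d)"
      using h by (intro sum.cong) (auto simp flip: scaleR_diff_left)
    also have "\<dots> = (\<Sum>i<n. b i - a i) * norm d" by (simp add: sum_distrib_right)
    also have "\<dots> \<le> (\<Sum>i<n. b i - a i) * (norm d + 1)"
      using h by (intro mult_left_mono sum_nonneg) auto
    also have "\<dots> < \<epsilon>" using h by (simp add: less_divide_eq add_nonneg_pos)
    finally show "(\<Sum>i<n. norm (x + b i *\<^sub>R d - (x + a i *\<^sub>R d))) < \<epsilon>" .
  qed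
qed

lemma locally_lipschitz_compact:
  assumes "locally_lipschitz g" "compact X"
  obtains L where "L-lipschitz_on X g"
proof -
  have "local_lipschitz (UNIV :: real set) UNIV (\<lambda>_. g)"
    using assms(1) by (simp add: locally_lipschitz_iff_local_lipschitz)
  then have ll: "local_lipschitz {0::real} X (\<lambda>_. g)" by (rule local_lipschitz_subset) auto
  obtain L where "\<And>t. t \<in> {0::real} \<Longrightarrow> L-lipschitz_on X g"
    using local_lipschitz_compact_implies_lipschitz[OF ll assms(2)] by auto
  then show ?thesis using that by blast
qed

lemma locally_lipschitz_continuous:
  assumes "locally_lipschitz g"
  shows "continuous_on UNIV g"
proof (rule continuous_at_imp_continuous_on, rule ballI)
  fix x
  obtain u L where u: "u > 0" "L-lipschitz_on (cball x u) g" using assms unfolding locally_lipschitz_def by blast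
  have "continuous_on (ball x u) g"
    by (rule continuous_on_subset[OF lipschitz_on_continuous_on[OF u(2)]]) auto
  then show "isCont g x" using u(1) by (simp add: continuous_on_eq_continuous_at)
qed

text \<open>The segment from \<open>x\<close> to \<open>y\<close> stays in the ball by convexity,
  and the chain rule bounds almost every derivative of \<open>g\<close> along it by
  \<open>k * norm (y - x)\<close>. Later \<open>k\<close> is \<open>\<kappa> s\<close>, whereas the
  local Lipschitz constants of \<open>g\<close> come without any control in
  \<open>s\<close>.\<close>

lemma conservative_gradient_increment_bound:
  assumes ll: "locally_lipschitz g" and cg: "conservative_gradient g E"
    and bd: "\<And>z w. z \<in> cball 0 R \<Longrightarrow> w \<in> E z \<Longrightarrow> norm w \<le> k"
    and xy: "x \<in> cball 0 R" "y \<in> cball 0 R"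
  shows "\<bar>g y - g x\<bar> \<le> k * dist y x"
proof -
  define \<gamma> where "\<gamma> t = x + t *\<^sub>R (y - x)" for t
  have \<gamma>R: "\<gamma> t \<in> cball 0 R" if "t \<in> {0..1}" for t
  proof -
    have "\<gamma> t = (1 - t) *\<^sub>R x + t *\<^sub>R y" by (simp add: \<gamma>_def algebra_simps)
    then show ?thesis using convexD[OF convex_cball xy, of "1 - t" t] that by auto
  qed
  obtain L where L: "L-lipschitz_on (cball 0 R) g" using locally_lipschitz_compact[OF ll compact_cball] .
  have lip: "(L * norm (y - x))-lipschitz_on {0..1} (g \<circ> \<gamma>)"
  proof (rule lipschitz_onI)
    fix s t :: real assume st: "s \<in> {0..1}" "t \<in> {0..1}"
    have "\<gamma> s - \<gamma> t = (s - t) *\<^sub>R (y - x)" by (simp add: \<gamma>_def scaleR_diff_left)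
    then have "dist (\<gamma> s) (\<gamma> t) = norm (y - x) * dist s t" by (simp add: dist_norm)
    then show "dist ((g \<circ> \<gamma>) s) ((g \<circ> \<gamma>) t) \<le> L * norm (y - x) * dist s t"
      using lipschitz_onD[OF L \<gamma>R[OF st(1)] \<gamma>R[OF st(2)]] by (simp add: mult.assoc)
  qed (use lipschitz_on_nonneg[OF L] in auto)
  let ?P = "\<lambda>t. \<exists>\<gamma>'. (\<gamma> has_vector_derivative \<gamma>') (at t within {0..1}) \<and>
      (\<forall>v\<in>E (\<gamma> t). ((g \<circ> \<gamma>) has_real_derivative v \<bullet> \<gamma>') (at t within {0..1}))"
  have "absolutely_continuous_curve \<gamma>" unfolding \<gamma>_def by (rule absolutely_continuous_segment)
  then have "AE t in lebesgue_on {0..1}. ?P t"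
    using cg unfolding conservative_gradient_def by blast
  then have neg: "negligible {t. \<not> (t \<in> {0<..<1} \<longrightarrow> ?P t)}"
    unfolding AE_unit_interval_iff AE_lborel_iff_negligible .
  have "\<bar>(g \<circ> \<gamma>) 1 - (g \<circ> \<gamma>) 0\<bar> \<le> k * norm (y - x) * (1 - 0)"
  proof (rule lipschitz_abs_increment_le_ae_derivative[OF lip _ neg])
    fix t assume t: "t \<in> {0<..<1::real} - {t. \<not> (t \<in> {0<..<1} \<longrightarrow> ?P t)}"
    then have within: "at t within {0..1} = at t" by (intro at_within_interior) auto
    from t have "?P t" by blast
    then obtain \<gamma>' where \<gamma>': "(\<gamma> has_vector_derivative \<gamma>') (at t)"
      "\<And>v. v \<in> E (\<gamma> t) \<Longrightarrow> ((g \<circ> \<gamma>) has_real_derivative v \<bullet> \<gamma>') (at t)"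
      unfolding within by blast
    have "(\<gamma> has_vector_derivative (y - x)) (at t)"
      unfolding \<gamma>_def by (auto intro!: derivative_eq_intros)
    then have eq: "\<gamma>' = y - x" using \<gamma>'(1) vector_derivative_unique_at by blast
    obtain v where v: "v \<in> E (\<gamma> t)" using cg unfolding conservative_gradient_def by blast
    have "norm v \<le> k" by (rule bd[OF \<gamma>R v]) (use t in auto)
    then have "\<bar>v \<bullet> (y - x)\<bar> \<le> k * norm (y - x)"
      using Cauchy_Schwarz_ineq2[of v "y - x"] mult_right_mono[of "norm v" k "norm (y - x)"] by simp
    then show "\<exists>d. \<bar>d\<bar> \<le> k * norm (y - x) \<and> ((g \<circ> \<gamma>) has_real_derivative d) (at t)"
      using \<gamma>'(2)[OF v] eq by blast
  qed simp
  then show ?thesis by (simp add: \<gamma>_def dist_norm)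
qed

section \<open>The integrated map: Lipschitz bound, nonempty values, closed graph\<close>

locale conservative_integrand =
  fixes M :: "'s measure" and f :: "'a::euclidean_space \<Rightarrow> 's \<Rightarrow> real" and D :: "'a \<Rightarrow> 's \<Rightarrow> 'a set"
  assumes D_compact: "\<And>x s. s \<in> space M \<Longrightarrow> D x s \<noteq> {} \<and> compact (D x s)"
    and f_integrable: "\<And>x. integrable M (f x)"
    and f_conservative: "AE s in M. locally_lipschitz (\<lambda>x. f x s) \<and>
      conservative_gradient (\<lambda>x. f x s) (\<lambda>x. D x s)"
    and D_measurable: "(\<lambda>(x, s). D x s) \<in> borel \<Otimes>\<^sub>M M \<rightarrow>\<^sub>M hausdorff_borel"
    and D_dominated: "\<And>C. compact C \<Longrightarrow> \<exists>\<kappa> :: 's \<Rightarrow> real. integrable M \<kappa> \<and>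
      (\<forall>s\<in>space M. 0 \<le> \<kappa> s) \<and> (\<forall>x\<in>C. \<forall>s\<in>space M. set_norm (D x s) \<le> \<kappa> s)"
begin

lemma D_bound:
  obtains \<kappa> where "integrable M \<kappa>" "\<And>s. s \<in> space M \<Longrightarrow> 0 \<le> \<kappa> s"
    "\<And>x s y. x \<in> cball 0 R \<Longrightarrow> s \<in> space M \<Longrightarrow> y \<in> D x s \<Longrightarrow> norm y \<le> \<kappa> s"
proof -
  obtain \<kappa> where \<kappa>: "integrable M \<kappa>" "\<And>s. s \<in> space M \<Longrightarrow> 0 \<le> \<kappa> s"
    "\<And>x s. x \<in> cball 0 R \<Longrightarrow> s \<in> space M \<Longrightarrow> set_norm (D x s) \<le> \<kappa> s"
    using D_dominated[OF compact_cball[of "0::'a" R]] by blast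
  have "norm y \<le> \<kappa> s" if "x \<in> cball 0 R" "s \<in> space M" "y \<in> D x s" for x s y
  proof -
    have "bounded (D x s)" using D_compact[OF that(2)] compact_imp_bounded by blast
    then have "bdd_above (norm ` D x s)" by (auto simp: bounded_iff intro: bdd_aboveI)
    then have "norm y \<le> set_norm (D x s)" unfolding set_norm_def using that(3) by (rule cSUP_upper[rotated])
    then show ?thesis using \<kappa>(3)[OF that(1,2)] by linarith
  qed
  then show ?thesis using \<kappa>(1,2) that by blast
qed

lemma D_section_measurable: "D x \<in> M \<rightarrow>\<^sub>M hausdorff_borel"
proof -
  have "(\<lambda>s. (x, s)) \<in> M \<rightarrow>\<^sub>M borel \<Otimes>\<^sub>M M" by simp
  from measurable_compose[OF this D_measurable] show ?thesis by simp
qed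

lemma D_selection:
  obtains w where "integrable M w" "\<And>s. s \<in> space M \<Longrightarrow> w s \<in> D x s"
proof -
  obtain w where w: "w \<in> borel_measurable M" "\<And>s. s \<in> space M \<Longrightarrow> w s \<in> D x s"
    using hausdorff_measurable_selection[OF D_section_measurable] by blast
  obtain \<kappa> where \<kappa>: "integrable M \<kappa>" "\<And>s. s \<in> space M \<Longrightarrow> 0 \<le> \<kappa> s"
    "\<And>z s y. z \<in> cball 0 (norm x) \<Longrightarrow> s \<in> space M \<Longrightarrow> y \<in> D z s \<Longrightarrow> norm y \<le> \<kappa> s"
    using D_bound[of "norm x"] by blast
  have "integrable M w"
  proof (rule Bochner_Integration.integrable_bound[OF \<kappa>(1) w(1)], rule AE_I2)
    fix s assume s: "s \<in> space M"
    show "norm (w s) \<le> norm (\<kappa> s)" using \<kappa>(2)[OF s] \<kappa>(3)[of x s "w s"] w(2)[OF s] s by simp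
  qed
  then show ?thesis using w(2) that by blast
qed

text \<open>All \<open>x\<close> and \<open>y\<close> share the exceptional null set of
  \<open>f_conservative\<close>, so their quantifiers may stand inside.\<close>

lemma increment_bound:
  assumes bd: "\<And>x s y. x \<in> cball 0 R \<Longrightarrow> s \<in> space M \<Longrightarrow> y \<in> D x s \<Longrightarrow> norm y \<le> \<kappa> s"
  shows "AE s in M. \<forall>x\<in>cball 0 R. \<forall>y\<in>cball 0 R. \<bar>f y s - f x s\<bar> \<le> \<kappa> s * dist y x"
  using f_conservative AE_space
proof eventually_elim
  case (elim s)
  show ?case
  proof (intro ballI)
    fix x y :: 'a assume xy: "x \<in> cball 0 R" "y \<in> cball 0 R"
    show "\<bar>f y s - f x s\<bar> \<le> \<kappa> s * dist y x"
      by (rule conservative_gradient_increment_bound[where g = "\<lambda>x. f x s" and E = "\<lambda>x. D x s", OF _ _ bd[OF _ elim(2)] xy])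
         (use elim in auto)
  qed
qed

lemma locally_lipschitz_integral: "locally_lipschitz (\<lambda>x. LINT s|M. f x s)"
  unfolding locally_lipschitz_def
proof
  fix x0 :: 'a
  obtain \<kappa> where \<kappa>: "integrable M \<kappa>" "\<And>s. s \<in> space M \<Longrightarrow> 0 \<le> \<kappa> s"
    "\<And>z s y. z \<in> cball 0 (norm x0 + 1) \<Longrightarrow> s \<in> space M \<Longrightarrow> y \<in> D z s \<Longrightarrow> norm y \<le> \<kappa> s"
    using D_bound[of "norm x0 + 1"] by blast
  have inc: "AE s in M. \<forall>x\<in>cball 0 (norm x0 + 1). \<forall>y\<in>cball 0 (norm x0 + 1). \<bar>f y s - f x s\<bar> \<le> \<kappa> s * dist y x"
    by (rule increment_bound) (rule \<kappa>(3))
  have sub: "x \<in> cball 0 (norm x0 + 1)" if "x \<in> cball x0 1" for x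
    using that norm_triangle_sub[of x x0] by (simp add: dist_norm norm_minus_commute)
  have "(LINT s|M. \<kappa> s)-lipschitz_on (cball x0 1) (\<lambda>x. LINT s|M. f x s)"
  proof (rule lipschitz_onI)
    show "0 \<le> (LINT s|M. \<kappa> s)" by (rule integral_nonneg_AE) (use \<kappa>(2) in auto)
    fix x y assume xy: "x \<in> cball x0 1" "y \<in> cball x0 1"
    have "dist (LINT s|M. f x s) (LINT s|M. f y s) = norm (LINT s|M. f x s - f y s)"
      using f_integrable by (simp add: dist_norm)
    also have "\<dots> \<le> (LINT s|M. norm (f x s - f y s))" by (rule integral_norm_bound)
    also have "\<dots> \<le> (LINT s|M. \<kappa> s * dist x y)"
    proof (rule integral_mono_AE)
      show "AE s in M. norm (f x s - f y s) \<le> \<kappa> s * dist x y"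
        using inc by eventually_elim (use sub[OF xy(1)] sub[OF xy(2)] in auto)
    qed (use f_integrable \<kappa>(1) in auto)
    also have "\<dots> = (LINT s|M. \<kappa> s) * dist x y" by simp
    finally show "dist (LINT s|M. f x s) (LINT s|M. f y s) \<le> (LINT s|M. \<kappa> s) * dist x y" .
  qed
  then show "\<exists>u>0. \<exists>L. L-lipschitz_on (cball x0 u) (\<lambda>x. LINT s|M. f x s)"
    by (intro exI[of _ 1]) auto
qed

lemma aumann_integral_nonempty: "aumann_integral M (D x) \<noteq> {}"
proof -
  obtain w where "integrable M w" "\<And>s. s \<in> space M \<Longrightarrow> w s \<in> D x s" by (rule D_selection[of x]) (rule that)
  then have "(LINT s|M. w s) \<in> aumann_integral M (D x)" unfolding aumann_integral_def by blast
  then show ?thesis by blast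
qed

lemma locally_bounded_aumann_integral: "locally_bounded_map (\<lambda>x. aumann_integral M (D x))"
  unfolding locally_bounded_map_def
proof
  fix x0 :: 'a
  obtain \<kappa> where \<kappa>: "integrable M \<kappa>" "\<And>s. s \<in> space M \<Longrightarrow> 0 \<le> \<kappa> s"
    "\<And>z s y. z \<in> cball 0 (norm x0 + 1) \<Longrightarrow> s \<in> space M \<Longrightarrow> y \<in> D z s \<Longrightarrow> norm y \<le> \<kappa> s"
    using D_bound[of "norm x0 + 1"] by blast
  have "norm y \<le> (LINT s|M. \<kappa> s)" if x: "x \<in> ball x0 1" and y: "y \<in> aumann_integral M (D x)" for x y
  proof -
    obtain v where v: "y = (LINT s|M. v s)" "integrable M v" "\<And>s. s \<in> space M \<Longrightarrow> v s \<in> D x s"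
      using y unfolding aumann_integral_def by blast
    have "x \<in> cball 0 (norm x0 + 1)"
      using x norm_triangle_sub[of x x0] by (simp add: dist_norm norm_minus_commute)
    then show ?thesis unfolding v(1)
      by (intro norm_integral_le_integral v \<kappa>(1)) (use v(3) \<kappa>(3) in blast)
  qed
  then show "\<exists>U. open U \<and> x0 \<in> U \<and> (\<exists>B. \<forall>x'\<in>U. \<forall>y\<in>aumann_integral M (D x'). norm y \<le> B)"
    by (intro exI[of _ "ball x0 1"] conjI exI[of _ "LINT s|M. \<kappa> s"]) auto
qed

text \<open>\<open>fatou_dominated\<close> turns selections along convergent points into one limit
  function made of cluster points, and the closed graph of \<open>D\<close> at fixed
  \<open>s\<close> places its values in \<open>D x s\<close>.\<close>

lemma closed_graph_aumann_integral: "closed {(x, y). y \<in> aumann_integral M (D x)}"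
  unfolding closed_sequential_limits
proof (intro allI impI, elim conjE)
  fix X :: "nat \<Rightarrow> 'a \<times> 'a" and l :: "'a \<times> 'a"
  assume mem: "\<forall>n. X n \<in> {(x, y). y \<in> aumann_integral M (D x)}" and lim: "X \<longlonglongrightarrow> l"
  obtain x y where l: "l = (x, y)" by (cases l)
  define xs where "xs n = fst (X n)" for n
  define ys where "ys n = snd (X n)" for n
  have xlim: "xs \<longlonglongrightarrow> x" and ylim: "ys \<longlonglongrightarrow> y"
    using tendsto_fst[OF lim] tendsto_snd[OF lim] by (simp_all add: l xs_def[abs_def] ys_def[abs_def])
  have "\<exists>v. integrable M v \<and> (\<forall>s\<in>space M. v s \<in> D (xs n) s) \<and> (LINT s|M. v s) = ys n" for n
  proof -
    have "ys n \<in> aumann_integral M (D (xs n))" using mem[rule_format, of n] by (auto simp: xs_def ys_def)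
    then show ?thesis unfolding aumann_integral_def mem_Collect_eq
      by (elim exE conjE) (intro exI conjI, assumption, assumption, rule sym)
  qed
  then have "\<forall>n. \<exists>v. integrable M v \<and> (\<forall>s\<in>space M. v s \<in> D (xs n) s) \<and> (LINT s|M. v s) = ys n" ..
  from choice[OF this] obtain v where v: "\<And>n. integrable M (v n)" "\<And>n s. s \<in> space M \<Longrightarrow> v n s \<in> D (xs n) s"
    "\<And>n. (LINT s|M. v n s) = ys n" by blast
  obtain R where R: "\<And>n. norm (xs n) \<le> R"
    using convergent_imp_bounded[OF xlim] unfolding bounded_iff by auto
  obtain \<kappa> where \<kappa>: "integrable M \<kappa>" "\<And>s. s \<in> space M \<Longrightarrow> 0 \<le> \<kappa> s"
    "\<And>z s y. z \<in> cball 0 R \<Longrightarrow> s \<in> space M \<Longrightarrow> y \<in> D z s \<Longrightarrow> norm y \<le> \<kappa> s"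
    using D_bound[of R] by blast
  have bd: "norm (v n s) \<le> \<kappa> s" if "s \<in> space M" for n s
    by (rule \<kappa>(3)[of "xs n"]) (use R[of n] v(2) that in auto)
  have vm: "v n \<in> borel_measurable M" for n using v(1) by (rule borel_measurable_integrable)
  have vlim: "(\<lambda>n. LINT s|M. v n s) \<longlonglongrightarrow> y" using ylim v(3) by simp
  obtain w where w: "integrable M w" "AE s in M. cluster_point (\<lambda>n. v n s) (w s)" "(LINT s|M. w s) = y"
    by (rule fatou_dominated[OF \<kappa>(1,2) vm bd vlim])
  have wD: "AE s in M. w s \<in> D x s"
    using w(2) f_conservative AE_space
  proof eventually_elim
    case (elim s)
    obtain r where r: "strict_mono r" "((\<lambda>n. v n s) \<circ> r) \<longlonglongrightarrow> w s"
      using cluster_point_imp_subseq[OF elim(1)] .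
    have lim: "(\<lambda>n. (xs (r n), v (r n) s)) \<longlonglongrightarrow> (x, w s)"
      using r(2) LIMSEQ_subseq_LIMSEQ[OF xlim r(1)] by (intro tendsto_Pair) (auto simp: o_def)
    have closed: "closed {(x, y). y \<in> D x s}" using elim(2) unfolding conservative_gradient_def by blast
    have mem: "(xs (r n), v (r n) s) \<in> {(x, y). y \<in> D x s}" for n using v(2)[OF elim(3)] by simp
    have "(x, w s) \<in> {(x, y). y \<in> D x s}" by (rule closed_sequentially[OF closed mem lim])
    then show ?case by simp
  qed
  obtain N where N: "{s\<in>space M. w s \<notin> D x s} \<subseteq> N" "emeasure M N = 0" "N \<in> sets M" using AE_E[OF wD] by blast
  obtain w0 where w0: "integrable M w0" "\<And>s. s \<in> space M \<Longrightarrow> w0 s \<in> D x s" by (rule D_selection[of x]) (rule that)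
  \<comment> \<open>On the exceptional null set a measurable selection of \<open>D x\<close> steps
    in; membership then holds at every \<open>s\<close> and the integral is unchanged.\<close>
  define w' where "w' s = (if s \<in> N then w0 s else w s)" for s
  have w'm: "w' \<in> borel_measurable M" unfolding w'_def using w(1) w0(1) N(3) by (intro measurable_If_set) auto
  have "AE s in M. s \<notin> N" using N(2,3) by (intro AE_not_in null_setsI)
  then have ae: "AE s in M. w s = w' s" by eventually_elim (simp add: w'_def)
  have "integrable M w'" using integrable_cong_AE_imp[OF w(1) w'm] ae by (auto elim: eventually_mono)
  moreover have "w' s \<in> D x s" if "s \<in> space M" for s using that N(1) w0(2) by (auto simp: w'_def)
  moreover have "(LINT s|M. w' s) = y"
    using integral_cong_AE[OF _ w'm ae] w(1,3) by auto
  ultimately show "l \<in> {(x, y). y \<in> aumann_integral M (D x)}"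
    unfolding l aumann_integral_def by (auto intro!: exI[of _ w'])
qed

end

section \<open>A measurable form of the chain rule along a curve\<close>

definition clamp_unit :: "real \<Rightarrow> real" where
  "clamp_unit t = max 0 (min 1 t)"

lemma clamp_unit_range: "clamp_unit t \<in> {0..1}"
  by (simp add: clamp_unit_def)

lemma clamp_unit_id: "t \<in> {0..1} \<Longrightarrow> clamp_unit t = t"
  by (simp add: clamp_unit_def)

lemma continuous_clamp_unit: "continuous_on UNIV clamp_unit"
  unfolding clamp_unit_def by (intro continuous_intros)

text \<open>For continuous \<open>\<phi>\<close> and nonempty compact \<open>K\<close> this says \<open>\<forall>w\<in>K. (\<phi> has_real_derivative p \<bullet> w) (at t)\<close>; the
  increments are rational and the elements of \<open>K\<close> enter through the support function so that the condition is
  measurable in all parameters.\<close>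

definition uniform_rational_derivative ::
    "(real \<Rightarrow> real) \<Rightarrow> 'a::euclidean_space set \<Rightarrow> 'a \<Rightarrow> real \<Rightarrow> bool" where
  "uniform_rational_derivative \<phi> K p t \<longleftrightarrow> (\<forall>j::nat. \<exists>m::nat. \<forall>r::rat.
     0 < \<bar>of_rat r :: real\<bar> \<and> \<bar>of_rat r :: real\<bar> < 1 / Suc m \<longrightarrow>
     support_function K (of_rat r *\<^sub>R p) \<le> \<phi> (t + of_rat r) - \<phi> t + \<bar>of_rat r\<bar> / Suc j \<and>
     support_function K ((- of_rat r) *\<^sub>R p) \<le> \<bar>of_rat r\<bar> / Suc j - (\<phi> (t + of_rat r) - \<phi> t))"

text \<open>Derivatives are unique, so \<open>p \<bullet> w\<close> is constant on \<open>K\<close>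
  and both support functions become multiples of one number.\<close>

lemma uniform_rational_derivativeI:
  assumes K: "compact K" "K \<noteq> {}"
    and der: "\<And>w. w \<in> K \<Longrightarrow> (\<phi> has_real_derivative p \<bullet> w) (at t)"
  shows "uniform_rational_derivative \<phi> K p t"
  unfolding uniform_rational_derivative_def
proof
  fix j :: nat
  obtain w0 where w0: "w0 \<in> K" using K(2) by blast
  define d where "d = p \<bullet> w0"
  have eq: "p \<bullet> w = d" if "w \<in> K" for w
    unfolding d_def by (rule DERIV_unique[OF der[OF that] der[OF w0]])
  have "((\<lambda>h. (\<phi> (t + h) - \<phi> t) / h) \<longlongrightarrow> d) (at 0)"
    using der[OF w0] unfolding d_def DERIV_def .
  then have "\<forall>\<^sub>F h in at 0. dist ((\<phi> (t + h) - \<phi> t) / h) d < 1 / Suc j" by (rule tendstoD) simp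
  then obtain \<delta> where \<delta>: "\<delta> > 0"
    "\<And>h. h \<noteq> 0 \<Longrightarrow> \<bar>h\<bar> < \<delta> \<Longrightarrow> dist ((\<phi> (t + h) - \<phi> t) / h) d < 1 / Suc j"
    unfolding eventually_at by (auto simp: dist_real_def)
  have inc: "\<bar>\<phi> (t + h) - \<phi> t - h * d\<bar> \<le> \<bar>h\<bar> / Suc j" if "h \<noteq> 0" "\<bar>h\<bar> < \<delta>" for h
  proof -
    have "\<phi> (t + h) - \<phi> t - h * d = h * ((\<phi> (t + h) - \<phi> t) / h - d)" using that(1) by (simp add: field_simps)
    then have "\<bar>\<phi> (t + h) - \<phi> t - h * d\<bar> = \<bar>h\<bar> * \<bar>(\<phi> (t + h) - \<phi> t) / h - d\<bar>" by (simp add: abs_mult)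
    also have "\<dots> \<le> \<bar>h\<bar> * (1 / Suc j)"
      using \<delta>(2)[OF that] by (intro mult_left_mono) (auto simp: dist_real_def)
    finally show ?thesis by simp
  qed
  obtain m :: nat where m: "1 / Suc m < \<delta>" using \<delta>(1) nat_approx_posE by blast
  have sup: "support_function K (c *\<^sub>R p) \<le> a \<longleftrightarrow> c * d \<le> a" for c a
    unfolding support_function_le_iff[OF compact_imp_bounded[OF K(1)] K(2)] using eq w0 by auto
  show "\<exists>m::nat. \<forall>r::rat. 0 < \<bar>of_rat r :: real\<bar> \<and> \<bar>of_rat r :: real\<bar> < 1 / Suc m \<longrightarrow>
     support_function K (of_rat r *\<^sub>R p) \<le> \<phi> (t + of_rat r) - \<phi> t + \<bar>of_rat r\<bar> / Suc j \<and>
     support_function K ((- of_rat r) *\<^sub>R p) \<le> \<bar>of_rat r\<bar> / Suc j - (\<phi> (t + of_rat r) - \<phi> t)"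
    unfolding sup
  proof (intro exI[of _ m] allI impI)
    fix r :: rat assume r: "0 < \<bar>of_rat r :: real\<bar> \<and> \<bar>of_rat r :: real\<bar> < 1 / Suc m"
    then have "\<bar>\<phi> (t + of_rat r) - \<phi> t - of_rat r * d\<bar> \<le> \<bar>of_rat r\<bar> / Suc j"
      using m by (intro inc) auto
    then show "of_rat r * d \<le> \<phi> (t + of_rat r) - \<phi> t + \<bar>of_rat r\<bar> / Suc j \<and>
       - of_rat r * d \<le> \<bar>of_rat r\<bar> / Suc j - (\<phi> (t + of_rat r) - \<phi> t)"
      unfolding abs_le_iff by simp
  qed
qed

text \<open>Support functions in two opposite directions bound \<open>p \<bullet> w\<close> from
  both sides at rational increments. Failure of the estimate is an open condition on the increment,
  by continuity of \<open>\<phi>\<close>, and would therefore show at a rational one.\<close>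

lemma uniform_rational_derivativeD:
  assumes u: "uniform_rational_derivative \<phi> K p t" and K: "compact K" "w \<in> K"
    and cont: "continuous_on UNIV \<phi>"
  shows "(\<phi> has_real_derivative p \<bullet> w) (at t)"
proof -
  define d where "d = p \<bullet> w"
  have "((\<lambda>h. (\<phi> (t + h) - \<phi> t) / h) \<longlongrightarrow> d) (at 0)"
  proof (rule tendstoI)
    fix e :: real assume e: "e > 0"
    obtain j :: nat where j: "1 / Suc j < e" using e nat_approx_posE by blast
    obtain m :: nat where m: "\<And>r::rat. 0 < \<bar>of_rat r :: real\<bar> \<Longrightarrow> \<bar>of_rat r :: real\<bar> < 1 / Suc m \<Longrightarrow>
       support_function K (of_rat r *\<^sub>R p) \<le> \<phi> (t + of_rat r) - \<phi> t + \<bar>of_rat r\<bar> / Suc j \<and>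
       support_function K ((- of_rat r) *\<^sub>R p) \<le> \<bar>of_rat r\<bar> / Suc j - (\<phi> (t + of_rat r) - \<phi> t)"
      using u unfolding uniform_rational_derivative_def by blast
    have rat: "\<bar>\<phi> (t + h) - \<phi> t - h * d\<bar> \<le> \<bar>h\<bar> / Suc j" if h: "h \<in> \<rat>" "h \<noteq> 0" "\<bar>h\<bar> < 1 / Suc m" for h
    proof -
      obtain r :: rat where r: "h = of_rat r" using h(1) by (rule Rats_cases)
      have sup: "c * d \<le> support_function K (c *\<^sub>R p)" for c
        using support_function_ge[OF compact_imp_bounded[OF K(1)] K(2), of "c *\<^sub>R p"] by (simp add: d_def)
      have "support_function K (h *\<^sub>R p) \<le> \<phi> (t + h) - \<phi> t + \<bar>h\<bar> / Suc j"
        "support_function K ((- h) *\<^sub>R p) \<le> \<bar>h\<bar> / Suc j - (\<phi> (t + h) - \<phi> t)"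
        using m[of r] h unfolding r by auto
      with sup[of h] sup[of "- h"] show ?thesis unfolding abs_le_iff by simp
    qed
    have real: "\<bar>\<phi> (t + h) - \<phi> t - h * d\<bar> \<le> \<bar>h\<bar> / Suc j" if h: "h \<noteq> 0" "\<bar>h\<bar> < 1 / Suc m" for h
    proof (rule ccontr)
      assume neg: "\<not> ?thesis"
      define G where "G = {h. \<bar>h\<bar> / Suc j < \<bar>\<phi> (t + h) - \<phi> t - h * d\<bar>} \<inter> {h. h \<noteq> 0} \<inter> {h. \<bar>h\<bar> < 1 / Suc m}"
      have c: "continuous_on UNIV (\<lambda>h. \<phi> (t + h))"
        by (rule continuous_on_compose2[OF cont]) (auto intro!: continuous_intros)
      have "open G" unfolding G_def
        by (intro open_Int open_Collect_less open_Collect_neq continuous_intros c) auto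
      moreover have "h \<in> G" using neg h by (simp add: G_def)
      ultimately obtain \<eta> where \<eta>: "\<eta> > 0" "ball h \<eta> \<subseteq> G" using openE by blast
      obtain q where q: "q \<in> \<rat>" "h - \<eta> < q" "q < h" using Rats_dense_in_real[of "h - \<eta>" h] \<eta>(1) by auto
      then have "q \<in> G" using \<eta>(2) by (auto simp: subset_iff dist_real_def)
      then show False using rat[OF q(1)] by (auto simp: G_def)
    qed
    show "\<forall>\<^sub>F h in at 0. dist ((\<phi> (t + h) - \<phi> t) / h) d < e"
      unfolding eventually_at
    proof (intro exI[of _ "1 / Suc m"] conjI ballI impI)
      fix h :: real assume h: "h \<noteq> 0 \<and> dist h 0 < 1 / Suc m"
      have "(\<phi> (t + h) - \<phi> t) / h - d = (\<phi> (t + h) - \<phi> t - h * d) / h" using h by (simp add: field_simps)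
      then have "\<bar>(\<phi> (t + h) - \<phi> t) / h - d\<bar> = \<bar>\<phi> (t + h) - \<phi> t - h * d\<bar> / \<bar>h\<bar>" by (simp add: abs_divide)
      also have "\<dots> \<le> (\<bar>h\<bar> / Suc j) / \<bar>h\<bar>" using real[of h] h by (intro divide_right_mono) auto
      also have "\<dots> = 1 / Suc j" using h by simp
      finally show "dist ((\<phi> (t + h) - \<phi> t) / h) d < e" using j by (simp add: dist_real_def)
    qed simp
  qed
  then show ?thesis unfolding DERIV_def d_def .
qed

context conservative_integrand
begin

lemma integral_derivative:
  assumes \<kappa>: "integrable M \<kappa>" "\<And>s. s \<in> space M \<Longrightarrow> 0 \<le> \<kappa> s"
    and inc: "AE s in M. \<forall>x\<in>cball 0 R. \<forall>y\<in>cball 0 R. \<bar>f y s - f x s\<bar> \<le> \<kappa> s * dist y x"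
    and \<gamma>R: "\<And>t. t \<in> {0..1} \<Longrightarrow> \<gamma> t \<in> cball 0 R"
    and t: "t \<in> {0..1}" and \<gamma>': "(\<gamma> has_vector_derivative \<gamma>') (at t within {0..1})"
    and w: "integrable M w"
    and der: "AE s in M. ((\<lambda>\<tau>. f (\<gamma> \<tau>) s) has_real_derivative w s \<bullet> \<gamma>') (at t within {0..1})"
  shows "((\<lambda>\<tau>. LINT s|M. f (\<gamma> \<tau>) s) has_real_derivative (LINT s|M. w s) \<bullet> \<gamma>') (at t within {0..1})"
  unfolding has_field_derivative_iff tendsto_at_iff_sequentially
proof (intro allI impI)
  fix X :: "nat \<Rightarrow> real" assume X: "\<forall>i. X i \<in> {0..1} - {t}" "X \<longlonglongrightarrow> t"
  have Xi: "X i \<in> {0..1}" "X i \<noteq> t" for i using X(1) by auto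
  have "(\<lambda>i. (1 / (X i - t)) *\<^sub>R (\<gamma> (X i) - \<gamma> t)) \<longlonglongrightarrow> \<gamma>'"
    using has_vector_derivative_imp_quotient_tendsto[OF \<gamma>'] X
    unfolding tendsto_at_iff_sequentially by (auto simp: o_def)
  \<comment> \<open>The quotients of \<open>\<gamma>\<close> along \<open>X\<close> are bounded
    because they converge; this is the source of the integrable majorant
    \<open>\<kappa> s * B\<close>.\<close>
  from convergent_imp_bounded[OF this]
  obtain B where B: "\<And>i. norm ((1 / (X i - t)) *\<^sub>R (\<gamma> (X i) - \<gamma> t)) \<le> B"
    unfolding bounded_iff by blast
  define q where "q i s = (f (\<gamma> (X i)) s - f (\<gamma> t) s) / (X i - t)" for i s
  have "(\<lambda>i. LINT s|M. q i s) \<longlonglongrightarrow> (LINT s|M. w s \<bullet> \<gamma>')"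
  proof (rule integral_dominated_convergence[where w = "\<lambda>s. \<kappa> s * B"])
    show "AE s in M. (\<lambda>i. q i s) \<longlonglongrightarrow> w s \<bullet> \<gamma>'"
      using der
    proof eventually_elim
      case (elim s)
      then show ?case
        unfolding has_field_derivative_iff tendsto_at_iff_sequentially using X
        by (auto simp: q_def o_def)
    qed
    show "AE s in M. norm (q i s) \<le> \<kappa> s * B" for i
      using inc AE_space
    proof eventually_elim
      case (elim s)
      have "\<bar>f (\<gamma> (X i)) s - f (\<gamma> t) s\<bar> \<le> \<kappa> s * dist (\<gamma> (X i)) (\<gamma> t)"
        using elim \<gamma>R[OF Xi(1)] \<gamma>R[OF t] by blast
      then have "\<bar>q i s\<bar> \<le> \<kappa> s * (dist (\<gamma> (X i)) (\<gamma> t) / \<bar>X i - t\<bar>)"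
        unfolding q_def by (simp add: abs_divide divide_right_mono)
      also have "dist (\<gamma> (X i)) (\<gamma> t) / \<bar>X i - t\<bar> = norm ((1 / (X i - t)) *\<^sub>R (\<gamma> (X i) - \<gamma> t))"
        by (simp add: dist_norm)
      also have "\<kappa> s * norm ((1 / (X i - t)) *\<^sub>R (\<gamma> (X i) - \<gamma> t)) \<le> \<kappa> s * B"
        by (rule mult_left_mono[OF B \<kappa>(2)[OF elim(2)]])
      finally show "norm (q i s) \<le> \<kappa> s * B" by simp
    qed
  qed (use f_integrable w \<kappa> in \<open>auto simp: q_def\<close>)
  moreover have "(LINT s|M. q i s) = ((LINT s|M. f (\<gamma> (X i)) s) - (LINT s|M. f (\<gamma> t) s)) / (X i - t)" for i
    unfolding q_def using f_integrable by simp
  moreover have "(LINT s|M. w s \<bullet> \<gamma>') = (LINT s|M. w s) \<bullet> \<gamma>'" using w by simp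
  ultimately show "((\<lambda>y. ((LINT s|M. f (\<gamma> y) s) - (LINT s|M. f (\<gamma> t) s)) / (y - t)) \<circ> X) \<longlonglongrightarrow> (LINT s|M. w s) \<bullet> \<gamma>'"
    by (simp add: o_def)
qed

end

context conservative_integrand
begin

lemma chain_rule_aumann_integral:
  assumes ac: "absolutely_continuous_curve \<gamma>"
  shows "AE t in lebesgue_on {0..1}. \<exists>\<gamma>'. (\<gamma> has_vector_derivative \<gamma>') (at t within {0..1}) \<and>
    (\<forall>v\<in>aumann_integral M (D (\<gamma> t)).
      (((\<lambda>x. LINT s|M. f x s) \<circ> \<gamma>) has_real_derivative v \<bullet> \<gamma>') (at t within {0..1}))"
proof -
  \<comment> \<open>The values of \<open>\<gamma>\<close> outside \<open>{0..1}\<close> are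
    arbitrary; the clamped curve is continuous on the line, so its quotients are Borel measurable in
    \<open>t\<close> for every increment.\<close>
  define \<beta> where "\<beta> t = \<gamma> (clamp_unit t)" for t
  have \<beta>\<gamma>: "\<beta> t = \<gamma> t" if "t \<in> {0<..<1}" for t using that clamp_unit_id[of t] by (simp add: \<beta>_def)
  have cg: "continuous_on {0..1} \<gamma>" by (rule absolutely_continuous_curve_continuous[OF ac])
  have c\<beta>: "continuous_on UNIV \<beta>" unfolding \<beta>_def
    by (rule continuous_on_compose2[OF cg continuous_clamp_unit]) (use clamp_unit_range in blast)
  have [measurable]: "\<beta> \<in> borel_measurable borel" by (rule borel_measurable_continuous_onI[OF c\<beta>])
  have "bounded (\<gamma> ` {0..1})" by (intro compact_imp_bounded compact_continuous_image cg) simp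
  then obtain R where "\<forall>x\<in>\<gamma> ` {0..1}. norm x \<le> R" unfolding bounded_iff by blast
  then have R: "\<gamma> t \<in> cball 0 R" if "t \<in> {0..1}" for t using that by simp
  obtain \<kappa> where \<kappa>: "integrable M \<kappa>" "\<And>s. s \<in> space M \<Longrightarrow> 0 \<le> \<kappa> s"
    and \<kappa>D: "\<And>x s y. x \<in> cball 0 R \<Longrightarrow> s \<in> space M \<Longrightarrow> y \<in> D x s \<Longrightarrow> norm y \<le> \<kappa> s"
    by (rule D_bound[of R]) (rule that)
  have inc: "AE s in M. \<forall>x\<in>cball 0 R. \<forall>y\<in>cball 0 R. \<bar>f y s - f x s\<bar> \<le> \<kappa> s * dist y x"
    by (rule increment_bound) (rule \<kappa>D)
  have [measurable]: "\<kappa> \<in> borel_measurable M" using \<kappa>(1) by (rule borel_measurable_integrable)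

  \<comment> \<open>A Borel function equal to the derivative of the curve wherever that exists in
    the open interval, and meaningless elsewhere. It replaces the derivatives that the chain rule
    provides separately for each \<open>s\<close>.\<close>
  define d where "d t = lim (\<lambda>n. real (Suc n) *\<^sub>R (\<beta> (t + 1 / Suc n) - \<beta> t))" for t
  have [measurable]: "d \<in> borel_measurable borel" unfolding d_def by measurable
  have d: "d t = v" if t: "t \<in> {0<..<1}" and v: "(\<gamma> has_vector_derivative v) (at t)" for t v
  proof -
    have "(\<beta> has_vector_derivative v) (at t)"
      by (rule has_vector_derivative_transform_within_open[OF v open_greaterThanLessThan t]) (simp add: \<beta>\<gamma>)
    from has_vector_derivative_imp_quotient_tendsto[OF this]
    have "((\<lambda>y. (1 / (y - t)) *\<^sub>R (\<beta> y - \<beta> t)) \<circ> (\<lambda>n. t + 1 / Suc n)) \<longlonglongrightarrow> v"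
      unfolding tendsto_at_iff_sequentially
    proof (elim allE impE)
      have "(\<lambda>n. t + 1 / Suc n) \<longlonglongrightarrow> t + 0"
        by (intro tendsto_intros lim_1_over_n[THEN LIMSEQ_Suc])
      then show "(\<lambda>n. t + 1 / Suc n) \<longlonglongrightarrow> t" by simp
    qed auto
    then show ?thesis unfolding d_def by (intro limI) (simp add: o_def)
  qed

  obtain N where N: "{s\<in>space M. \<not> (locally_lipschitz (\<lambda>x. f x s) \<and>
      conservative_gradient (\<lambda>x. f x s) (\<lambda>x. D x s))} \<subseteq> N" "emeasure M N = 0" "N \<in> sets M"
    using AE_E[OF f_conservative] .
  have good: "locally_lipschitz (\<lambda>x. f x s)" "conservative_gradient (\<lambda>x. f x s) (\<lambda>x. D x s)"
    if "s \<in> space M" "s \<notin> N" for s using that N(1) by blast+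
  have AEN: "AE s in M. s \<notin> N" using N(2,3) by (intro AE_not_in null_setsI)
  \<comment> \<open>The value 0 on the null set \<open>N\<close> makes continuity in
    \<open>x\<close> hold for every \<open>s\<close>, as joint measurability requires.\<close>
  define f' where "f' x s = (if s \<in> N then 0 else f x s)" for x s
  have f'm: "f' x \<in> borel_measurable M" for x
    unfolding f'_def using f_integrable[of x] N(3) by (intro measurable_If_set) auto
  have f'c: "continuous_on UNIV (\<lambda>x. f' x s)" if "s \<in> space M" for s
    using locally_lipschitz_continuous[OF good(1)[OF that]] by (cases "s \<in> N") (auto simp: f'_def)
  define Q where "Q t s \<longleftrightarrow> uniform_rational_derivative (\<lambda>\<tau>. f' (\<beta> \<tau>) s) (D (\<beta> t) s) (d t) t" for t s

  \<comment> \<open>Only countable quantifiers occur in \<open>Q\<close>, so measurability reduces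
    to its terms; the values of \<open>f'\<close> along the curve and the support functions are both
    Caratheodory compositions.\<close>
  have "{z \<in> space (borel \<Otimes>\<^sub>M M). fst z \<in> {0<..<1::real} \<longrightarrow> Q (fst z) (snd z)} \<in> sets (borel \<Otimes>\<^sub>M M)"
  proof -
    have m1[measurable]: "(\<lambda>z. f' (\<beta> (fst z + h)) (snd z)) \<in> borel_measurable (borel \<Otimes>\<^sub>M M)" for h
    proof (rule caratheodory_compose[where g = "\<lambda>x z. f' x (snd z)" and X = "\<lambda>z. \<beta> (fst z + h)"])
      show "(\<lambda>z. f' x (snd z)) \<in> borel_measurable (borel \<Otimes>\<^sub>M M)" for x
        using f'm by (rule measurable_compose[OF measurable_snd])
    qed (auto simp: space_pair_measure intro: f'c)
    have m0[measurable]: "(\<lambda>z. f' (\<beta> (fst z)) (snd z)) \<in> borel_measurable (borel \<Otimes>\<^sub>M M)"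
      using m1[of 0] by simp
    have m2: "(\<lambda>z. D (\<beta> (fst z)) (snd z)) \<in> borel \<Otimes>\<^sub>M M \<rightarrow>\<^sub>M hausdorff_borel"
    proof -
      have "(\<lambda>z. (\<beta> (fst z), snd z)) \<in> borel \<Otimes>\<^sub>M M \<rightarrow>\<^sub>M borel \<Otimes>\<^sub>M M" by measurable
      from measurable_compose[OF this D_measurable] show ?thesis by simp
    qed
    have m3[measurable]: "(\<lambda>z. support_function (D (\<beta> (fst z)) (snd z)) (c *\<^sub>R d (fst z)))
        \<in> borel_measurable (borel \<Otimes>\<^sub>M M)" for c
    proof (rule caratheodory_compose[where g = "\<lambda>p z. support_function (D (\<beta> (fst z)) (snd z)) p"
          and X = "\<lambda>z. c *\<^sub>R d (fst z)"])
      show "(\<lambda>z. support_function (D (\<beta> (fst z)) (snd z)) p) \<in> borel_measurable (borel \<Otimes>\<^sub>M M)" for p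
        by (rule measurable_compose[OF m2 borel_measurable_support_function])
      fix z assume "z \<in> space (borel \<Otimes>\<^sub>M M :: (real \<times> 's) measure)"
      then have "snd z \<in> space M" by (auto simp: space_pair_measure)
      then show "continuous_on UNIV (\<lambda>p. support_function (D (\<beta> (fst z)) (snd z)) p)"
        using D_compact by (intro continuous_support_function compact_imp_bounded) auto
    qed simp
    show ?thesis unfolding Q_def uniform_rational_derivative_def by measurable
  qed
  moreover define \<nu> where "\<nu> = density M (\<lambda>s. ennreal (\<kappa> s))"
  have sets\<nu>: "sets (lborel \<Otimes>\<^sub>M \<nu>) = sets (borel \<Otimes>\<^sub>M M)"
    unfolding \<nu>_def by (intro sets_pair_measure_cong) auto
  ultimately have Qm: "{z \<in> space (lborel \<Otimes>\<^sub>M \<nu>). fst z \<in> {0<..<1::real} \<longrightarrow> Q (fst z) (snd z)} \<in> sets (lborel \<Otimes>\<^sub>M \<nu>)"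
    unfolding sets\<nu> sets_eq_imp_space_eq[OF sets\<nu>] by blast
  interpret \<nu>: finite_measure \<nu> unfolding \<nu>_def by (rule finite_measure_density_integrable[OF \<kappa>])
  interpret P: pair_sigma_finite lborel \<nu> ..
  have AE\<nu>: "(AE s in \<nu>. P s) \<longleftrightarrow> (AE s in M. 0 < \<kappa> s \<longrightarrow> P s)" for P
    unfolding \<nu>_def by (simp add: AE_density)

  have ae_t: "AE t in lborel. t \<in> {0<..<1} \<longrightarrow> Q t s" if s: "s \<in> space M" "s \<notin> N" for s
  proof -
    have "AE t in lebesgue_on {0..1}. \<exists>\<gamma>'. (\<gamma> has_vector_derivative \<gamma>') (at t within {0..1}) \<and>
        (\<forall>v\<in>D (\<gamma> t) s. (((\<lambda>x. f x s) \<circ> \<gamma>) has_real_derivative v \<bullet> \<gamma>') (at t within {0..1}))"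
      using good(2)[OF s] ac unfolding conservative_gradient_def by blast
    then show ?thesis unfolding AE_unit_interval_iff
    proof (rule AE_mp, intro AE_I2 impI)
      fix t :: real
      assume h: "t \<in> {0<..<1} \<longrightarrow> (\<exists>\<gamma>'. (\<gamma> has_vector_derivative \<gamma>') (at t within {0..1}) \<and>
        (\<forall>v\<in>D (\<gamma> t) s. (((\<lambda>x. f x s) \<circ> \<gamma>) has_real_derivative v \<bullet> \<gamma>') (at t within {0..1})))"
        and t: "t \<in> {0<..<1}"
      have within: "at t within {0..1} = at t" using t by (intro at_within_interior) auto
      obtain \<gamma>' where \<gamma>': "(\<gamma> has_vector_derivative \<gamma>') (at t)"
        "\<And>v. v \<in> D (\<gamma> t) s \<Longrightarrow> (((\<lambda>x. f x s) \<circ> \<gamma>) has_real_derivative v \<bullet> \<gamma>') (at t)"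
        using h t unfolding within by blast
      show "Q t s" unfolding Q_def
      proof (rule uniform_rational_derivativeI)
        show "compact (D (\<beta> t) s)" "D (\<beta> t) s \<noteq> {}" using D_compact[OF s(1)] by auto
        fix w assume "w \<in> D (\<beta> t) s"
        then have "(((\<lambda>x. f x s) \<circ> \<gamma>) has_real_derivative d t \<bullet> w) (at t)"
          using \<gamma>'(2)[of w] d[OF t \<gamma>'(1)] \<beta>\<gamma>[OF t] by (simp add: inner_commute)
        then show "((\<lambda>\<tau>. f' (\<beta> \<tau>) s) has_real_derivative d t \<bullet> w) (at t)"
          by (rule has_field_derivative_transform_within_open[OF _ open_greaterThanLessThan t])
             (simp add: f'_def s \<beta>\<gamma>)
      qed
    qed
  qed
  have "AE s in \<nu>. AE t in lborel. t \<in> {0<..<1} \<longrightarrow> Q t s"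
    unfolding AE\<nu> using AEN AE_space by eventually_elim (use ae_t in blast)
  then have "AE t in lborel. AE s in \<nu>. t \<in> {0<..<1} \<longrightarrow> Q t s"
    using P.AE_commute[where P = "\<lambda>t s. t \<in> {0<..<1} \<longrightarrow> Q t s", OF Qm] by simp
  moreover have "AE t in lborel. t \<in> {0<..<1} \<longrightarrow> (\<exists>v. (\<gamma> has_vector_derivative v) (at t))"
    unfolding AE_lborel_iff_negligible
    using absolutely_continuous_curve_differentiable_ae[OF ac] by (rule negligible_subset) auto
  ultimately show ?thesis
    unfolding AE_unit_interval_iff
  proof eventually_elim
    case (elim t)
    show ?case
    proof
      assume t: "t \<in> {0<..<1}"
      then have t01: "t \<in> {0..1}" by auto
      have within: "at t within {0..1} = at t" using t by (intro at_within_interior) auto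
      obtain \<gamma>' where \<gamma>': "(\<gamma> has_vector_derivative \<gamma>') (at t)" using elim(2) t by blast
      have Qs: "AE s in M. 0 < \<kappa> s \<longrightarrow> Q t s" using elim(1) t unfolding AE\<nu> by simp
      have "(((\<lambda>x. LINT s|M. f x s) \<circ> \<gamma>) has_real_derivative v \<bullet> \<gamma>') (at t)"
        if v: "v \<in> aumann_integral M (D (\<gamma> t))" for v
      proof -
        obtain w where w: "v = (LINT s|M. w s)" "integrable M w" "\<And>s. s \<in> space M \<Longrightarrow> w s \<in> D (\<gamma> t) s"
          using v unfolding aumann_integral_def by blast
        have der: "AE s in M. ((\<lambda>\<tau>. f (\<gamma> \<tau>) s) has_real_derivative w s \<bullet> \<gamma>') (at t)"
          using Qs AEN inc AE_space
        proof eventually_elim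
          case (elim s)
          show ?case
          proof (cases "0 < \<kappa> s")
            case True
            then have "Q t s" using elim by blast
            moreover have "continuous_on UNIV (\<lambda>\<tau>. f' (\<beta> \<tau>) s)"
              by (rule continuous_on_compose2[OF f'c[OF elim(4)] c\<beta>]) simp
            ultimately have "((\<lambda>\<tau>. f' (\<beta> \<tau>) s) has_real_derivative d t \<bullet> w s) (at t)"
              unfolding Q_def using D_compact[OF elim(4)] w(3)[OF elim(4)] \<beta>\<gamma>[OF t]
              by (intro uniform_rational_derivativeD) auto
            then have "((\<lambda>\<tau>. f (\<gamma> \<tau>) s) has_real_derivative d t \<bullet> w s) (at t)"
              by (rule has_field_derivative_transform_within_open[OF _ open_greaterThanLessThan t])
                 (simp add: f'_def elim \<beta>\<gamma>)
            then show ?thesis using d[OF t \<gamma>'] by (simp add: inner_commute)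
          next
            case False
            \<comment> \<open>The measure \<open>\<nu>\<close> does not see these \<open>s\<close>.
              Here domination leaves only 0 in \<open>D (\<gamma> t) s\<close>, and the increment
              bound makes \<open>f\<close> constant along the curve.\<close>
            then have k0: "\<kappa> s = 0" using \<kappa>(2)[OF elim(4)] by simp
            then have w0: "w s = 0" using \<kappa>D[OF R[OF t01] elim(4) w(3)[OF elim(4)]] by simp
            have "((\<lambda>\<tau>. f (\<gamma> t) s) has_real_derivative 0) (at t)" by simp
            then have "((\<lambda>\<tau>. f (\<gamma> \<tau>) s) has_real_derivative 0) (at t)"
            proof (rule has_field_derivative_transform_within_open[OF _ open_greaterThanLessThan t])
              fix \<tau> :: real assume "\<tau> \<in> {0<..<1}"
              then have "\<tau> \<in> {0..1}" by auto
              then have "\<bar>f (\<gamma> t) s - f (\<gamma> \<tau>) s\<bar> \<le> \<kappa> s * dist (\<gamma> t) (\<gamma> \<tau>)"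
                using elim(3) R[OF t01] R[of \<tau>] by blast
              then show "f (\<gamma> t) s = f (\<gamma> \<tau>) s" using k0 by simp
            qed
            then show ?thesis using w0 by simp
          qed
        qed
        have "((\<lambda>\<tau>. LINT s|M. f (\<gamma> \<tau>) s) has_real_derivative (LINT s|M. w s) \<bullet> \<gamma>') (at t within {0..1})"
          by (rule integral_derivative[OF \<kappa> inc R t01 _ w(2)]) (use \<gamma>' der within in auto)
        then show ?thesis using within w(1) by (simp add: o_def)
      qed
      then show "\<exists>\<gamma>'. (\<gamma> has_vector_derivative \<gamma>') (at t within {0..1}) \<and>
          (\<forall>v\<in>aumann_integral M (D (\<gamma> t)).
            (((\<lambda>x. LINT s|M. f x s) \<circ> \<gamma>) has_real_derivative v \<bullet> \<gamma>') (at t within {0..1}))"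
        unfolding within using \<gamma>' by blast
    qed
  qed
qed

lemma conservative_gradient_integral:
  "conservative_gradient (\<lambda>x. LINT s|M. f x s) (\<lambda>x. aumann_integral M (D x))"
  unfolding conservative_gradient_def
  using aumann_integral_nonempty locally_bounded_aumann_integral closed_graph_aumann_integral
    chain_rule_aumann_integral by blast

end

theorem theorem4:
  fixes M :: "'s measure"
    and f :: "real ^ 'p \<Rightarrow> 's \<Rightarrow> real"
    and D :: "real ^ 'p \<Rightarrow> 's \<Rightarrow> (real ^ 'p) set"
  assumes "complete_measure M"
    and "\<And>x s. s \<in> space M \<Longrightarrow> D x s \<noteq> {} \<and> compact (D x s)"
    and "\<And>x. integrable M (f x)"
    and "AE s in M. locally_lipschitz (\<lambda>x. f x s) \<and> conservative_gradient (\<lambda>x. f x s) (\<lambda>x. D x s)"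
    and "(\<lambda>(x, s). D x s) \<in> borel \<Otimes>\<^sub>M M \<rightarrow>\<^sub>M hausdorff_borel"
    and "\<And>C. compact C \<Longrightarrow>
           \<exists>\<kappa> :: 's \<Rightarrow> real. integrable M \<kappa> \<and> (\<forall>s\<in>space M. 0 \<le> \<kappa> s) \<and>
             (\<forall>x\<in>C. \<forall>s\<in>space M. set_norm (D x s) \<le> \<kappa> s)"
  shows "path_differentiable (\<lambda>x. \<integral>s. f x s \<partial>M) \<and>
         conservative_gradient (\<lambda>x. \<integral>s. f x s \<partial>M) (\<lambda>x. aumann_integral M (D x))"
proof -
  interpret conservative_integrand M f D
    by unfold_locales (fact assms)+
  show ?thesis
    unfolding path_differentiable_def
    using locally_lipschitz_integral conservative_gradient_integral by blast
qed

end
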